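(* Let $M$ be a connected orientable hypersurface of $\mathbb{H}^2\times\mathbb{H}^2$ with unit normal $N$ and shape operator $A$, having three distinct constant principal curvatures and Gauss–Kronecker curvature $K=\det A=0$. If $V=PN-\langle PN,N\rangle N$ has nonzero components in at most two of the eigenspaces of $A$, then, up to an isometry of $\mathbb{H}^2\times\mathbb{H}^2$, $M$ is an open part of $M^c_{1,-1}$ for some $c\in(0,\tfrac12)\cup(\tfrac12,1)$, or an open part of $M^c_{1,1}$ for some $c\in(0,1)$, or an open part of $M_\tau$ for some $\tau<-1$.
   Context: $\mathbb{R}^3_1$ denotes $\mathbb{R}^3$ with the Lorentzian inner product $\langle x,y\rangle=-x_1y_1+x_2y_2+x_3y_3$, and $\mathbb{H}^2=\{x\in\mathbb{R}^3_1:\langle x,x\rangle=-1,\ x_1>0\}$. $\mathbb{H}^2\times\mathbb{H}^2$ carries the Riemannian product metric; $P(v_1,v_2)=(v_1,-v_2)$ is its product structure; the shape operator satisfies $\bar\nabla_XN=-AX$. For $0<c<1$, put $\gamma(r)=(\tfrac{2+r^2}{2},r,\tfrac{r^2}{2})$ and $N(r)=(-\tfrac{r^2}{2},-r,\tfrac{2-r^2}{2})$; $M^c_{1,-1}$ is the image of $(t,r,s)\mapsto\big(\cosh(\sqrt c\,t)\gamma(r)+\sinh(\sqrt c\,t)N(r),\ \cosh(\sqrt{1-c}\,t)\gamma(s)+\sinh(\sqrt{1-c}\,t)\tilde N(s)\big)$ with $\tilde N(s)=(\tfrac{s^2}{2},s,\tfrac{s^2-2}{2})$, and $M^c_{1,1}$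 is the image of the same map with $\tilde N(s)=(-\tfrac{s^2}{2},-s,\tfrac{2-s^2}{2})$. For $\tau<-1$, $M_\tau=\{(p,q)\in\mathbb{H}^2\times\mathbb{H}^2:\langle p,q\rangle=\tau\}$ (Lorentzian inner product of $\mathbb{R}^3_1$). *)

theory Defs
  imports "HOL-Analysis.Analysis"
begin

fun Ck_on :: "nat \<Rightarrow> ('a::real_normed_vector \<Rightarrow> 'b::real_normed_vector) \<Rightarrow> 'a set \<Rightarrow> bool" where
  "Ck_on 0 f S = continuous_on S f"
| "Ck_on (Suc k) f S =
     ((\<forall>x\<in>S. f differentiable (at x)) \<and>
      (\<forall>v. Ck_on k (\<lambda>x. frechet_derivative f (at x) v) S))"

definition smooth_on :: "('a::real_normed_vector \<Rightarrow> 'b::real_normed_vector) \<Rightarrow> 'a set \<Rightarrow> bool" where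
  "smooth_on f S \<longleftrightarrow> open S \<and> (\<forall>k. Ck_on k f S)"

type_synonym R3 = "real^3"
type_synonym R6 = "R3 \<times> R3"

definition lor :: "R3 \<Rightarrow> R3 \<Rightarrow> real" where
  "lor x y = - (x$1 * y$1) + x$2 * y$2 + x$3 * y$3"

definition H2 :: "R3 set" where
  "H2 = {x. lor x x = -1 \<and> x$1 > 0}"

definition H2xH2 :: "R6 set" where
  "H2xH2 = H2 \<times> H2"

text \<open>Product metric (restricted to tangent vectors of H^2 x H^2).\<close>
definition gprod :: "R6 \<Rightarrow> R6 \<Rightarrow> real" where
  "gprod u v = lor (fst u) (fst v) + lor (snd u) (snd v)"

definition Pstr :: "R6 \<Rightarrow> R6" where
  "Pstr v = (fst v, - snd v)"

text \<open>Tangent space of H^2 x H^2 at x, and orthogonal projection onto it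
 (w \<mapsto> w + <w,p>p in each factor, since <p,p> = -1).\<close>
definition amb_tangent :: "R6 \<Rightarrow> R6 set" where
  "amb_tangent x = {v. lor (fst v) (fst x) = 0 \<and> lor (snd v) (snd x) = 0}"

definition amb_proj :: "R6 \<Rightarrow> R6 \<Rightarrow> R6" where
  "amb_proj x w = (fst w + lor (fst w) (fst x) *\<^sub>R fst x,
                   snd w + lor (snd w) (snd x) *\<^sub>R snd x)"

definition dH :: "R3 \<Rightarrow> R3 \<Rightarrow> real" where
  "dH p q = arcosh (- lor p q)"

definition dprod :: "R6 \<Rightarrow> R6 \<Rightarrow> real" where
  "dprod x y = sqrt ((dH (fst x) (fst y))\<^sup>2 + (dH (snd x) (snd y))\<^sup>2)"

definition isometry_H2xH2 :: "(R6 \<Rightarrow> R6) \<Rightarrow> bool" where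
  "isometry_H2xH2 F \<longleftrightarrow> F ` H2xH2 = H2xH2 \<and>
     (\<forall>x\<in>H2xH2. \<forall>y\<in>H2xH2. dprod (F x) (F y) = dprod x y)"

definition hypersurface :: "R6 set \<Rightarrow> bool" where
  "hypersurface M \<longleftrightarrow> M \<subseteq> H2xH2 \<and>
    (\<forall>p\<in>M. \<exists>U W (\<phi>::R3 \<Rightarrow> R6). open W \<and> p \<in> W \<and> smooth_on \<phi> U \<and>
        (\<exists>\<psi>. homeomorphism U (M \<inter> W) \<phi> \<psi>) \<and>
        (\<forall>u\<in>U. inj (frechet_derivative \<phi> (at u))))"

definition curve_through :: "R6 set \<Rightarrow> R6 \<Rightarrow> R6 \<Rightarrow> (real \<Rightarrow> R6) \<Rightarrow> bool" where
  "curve_through M p X \<gamma> \<longleftrightarrow> (\<exists>e>0. \<gamma> ` ball 0 e \<subseteq> M) \<and> \<gamma> 0 = p \<and>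
      (\<gamma> has_vector_derivative X) (at 0)"

definition tangent_space :: "R6 set \<Rightarrow> R6 \<Rightarrow> R6 set" where
  "tangent_space M p = {X. \<exists>\<gamma>. curve_through M p X \<gamma>}"

definition smooth_along :: "R6 set \<Rightarrow> (R6 \<Rightarrow> R6) \<Rightarrow> bool" where
  "smooth_along M N \<longleftrightarrow> (\<forall>p\<in>M. \<exists>W Ne. p \<in> W \<and> smooth_on Ne W \<and> (\<forall>x\<in>M \<inter> W. Ne x = N x))"

definition unit_normal :: "R6 set \<Rightarrow> (R6 \<Rightarrow> R6) \<Rightarrow> bool" where
  "unit_normal M N \<longleftrightarrow> smooth_along M N \<and>
     (\<forall>p\<in>M. N p \<in> amb_tangent p \<and> gprod (N p) (N p) = 1 \<and>
             (\<forall>X\<in>tangent_space M p. gprod (N p) X = 0))"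

text \<open>Shape operator A X = - (ambient Levi-Civita derivative of N along X); the
 Levi-Civita connection of H^2 x H^2 is the tangential projection of the flat derivative
 of R^3_1 x R^3_1.\<close>
definition shape_op :: "R6 set \<Rightarrow> (R6 \<Rightarrow> R6) \<Rightarrow> R6 \<Rightarrow> R6 \<Rightarrow> R6" where
  "shape_op M N p X =
     - amb_proj p (vector_derivative (N \<circ> (SOME \<gamma>. curve_through M p X \<gamma>)) (at 0))"

definition principal_curvatures :: "R6 set \<Rightarrow> (R6 \<Rightarrow> R6) \<Rightarrow> R6 \<Rightarrow> real set" where
  "principal_curvatures M N p =
     {k. \<exists>X\<in>tangent_space M p. X \<noteq> 0 \<and> shape_op M N p X = k *\<^sub>R X}"

definition eigenspace :: "R6 set \<Rightarrow> (R6 \<Rightarrow> R6) \<Rightarrow> R6 \<Rightarrow> real \<Rightarrow> R6 set" where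
  "eigenspace M N p k = {X\<in>tangent_space M p. shape_op M N p X = k *\<^sub>R X}"

definition Vfield :: "(R6 \<Rightarrow> R6) \<Rightarrow> R6 \<Rightarrow> R6" where
  "Vfield N p = Pstr (N p) - gprod (Pstr (N p)) (N p) *\<^sub>R N p"

definition gam :: "real \<Rightarrow> R3" where
  "gam r = vector [(2 + r\<^sup>2) / 2, r, r\<^sup>2 / 2]"

definition Ngam :: "real \<Rightarrow> R3" where
  "Ngam r = vector [- (r\<^sup>2 / 2), - r, (2 - r\<^sup>2) / 2]"

definition Ntilde_m :: "real \<Rightarrow> R3" where
  "Ntilde_m s = vector [s\<^sup>2 / 2, s, (s\<^sup>2 - 2) / 2]"

definition model_param :: "real \<Rightarrow> (real \<Rightarrow> R3) \<Rightarrow> real \<Rightarrow> real \<Rightarrow> real \<Rightarrow> R6" where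
  "model_param c Nt t r s =
     (cosh (sqrt c * t) *\<^sub>R gam r + sinh (sqrt c * t) *\<^sub>R Ngam r,
      cosh (sqrt (1 - c) * t) *\<^sub>R gam s + sinh (sqrt (1 - c) * t) *\<^sub>R Nt s)"

definition M1m1 :: "real \<Rightarrow> R6 set" where
  "M1m1 c = {model_param c Ntilde_m t r s | t r s. True}"

definition M11 :: "real \<Rightarrow> R6 set" where
  "M11 c = {model_param c Ngam t r s | t r s. True}"

definition Mtau :: "real \<Rightarrow> R6 set" where
  "Mtau \<tau> = {x \<in> H2xH2. lor (fst x) (snd x) = \<tau>}"

definition open_part_of :: "R6 set \<Rightarrow> R6 set \<Rightarrow> bool" where
  "open_part_of S X \<longleftrightarrow> S \<subseteq> X \<and> openin (top_of_set X) S"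

end

theory Submission
  imports Defs
begin

text \<open>Write the unit normal as \<open>N = (c n1, s n2)\<close> with unit vectors \<open>n1, n2\<close> and \<open>c\<^sup>2 + s\<^sup>2 = 1\<close>. Where
  \<open>c, s > 0\<close>, the frame \<open>T = (s n1, - c n2), e1 = (J n1, 0), e2 = (0, J n2)\<close> of the hypersurface is determined
  by \<open>N\<close>, and \<open>V = 2 c s T\<close>. Since \<open>dn1\<close> and \<open>dn2\<close> are given by the shape operator \<open>A\<close>, the
  connection is an algebraic expression in \<open>A\<close>, and the Codazzi equations form a closed exterior
  system for the dual coframe and the rows of \<open>A\<close>.

  If \<open>T\<close> had components in exactly two eigenspaces, the Codazzi equations in the principal frame
  would imply an algebraic relation between \<open>(c s)\<^sup>2\<close> and \<open>\<langle>A T, T\<rangle>\<close>; its derivative along the third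
  principal direction is contradictory. So \<open>T\<close> is principal, and its eigenvalue vanishes because it
  is constant while \<open>d\<theta> = \<langle>A T, T\<rangle> \<eta>0\<close> for the angle \<open>\<theta>\<close> with \<open>c = cos \<theta>\<close>. Hence \<open>A T = 0\<close> and
  \<open>c, s\<close> are constant.

  The remaining block \<open>[[a, b], [b, d]]\<close> of \<open>A\<close> satisfies a Riccati equation along \<open>T\<close> and has
  constant trace and determinant, so either \<open>b = 0, a = \<plusminus> c, d = \<plusminus> s\<close> or \<open>c = s, a = d,
  a\<^sup>2 - b\<^sup>2 = 1 / 2\<close>. In the first case \<open>p \<plusminus> n1\<close> and \<open>q \<plusminus> n2\<close> are null vectors of fixed directions,
  and moving these directions to \<open>(1, 0, 1)\<close> gives \<open>M11\<close> or \<open>M1m1\<close>. In the second case the frames of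
  the two factors are related by a constant Lorentz map, which gives \<open>Mtau\<close>. That the image is open in the
  model is invariance of domain.\<close>

section \<open>Directional derivatives\<close>

text \<open>Two obstacles shape the argument. Eigenvectors are known only pointwise, and the pair of
  eigenspaces that carries \<open>V\<close> may change from point to point, so no principal frame is
  presupposed as a differentiable field. What is differentiated is the matrix of the shape operator
  in an explicit frame: the distinct constant curvatures enter through its characteristic
  polynomial, the condition on \<open>V\<close> through a quadratic polynomial in the shape operator
  that annihilates \<open>T\<close>. Failure of one such quadratic is an open condition, so a single
  one holds on some nonempty open set, and there a principal direction is obtained algebraically.

  The second obstacle is that the frame breaks down where a component of \<open>N\<close> vanishes.
  A component cannot vanish on an open piece, because two different nonzero curvatures would then
  share one direction. The good set is all of \<open>M\<close>, since \<open>c\<close> is locally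
  constant on it with a value strictly between 0 and 1 and \<open>M\<close> is connected.

  The value 1/2 is missing from the family \<open>M1m1\<close> because the two nonzero curvatures
  coincide there.\<close>

abbreviation dird :: "('a::real_normed_vector \<Rightarrow> 'b::real_normed_vector) \<Rightarrow> 'a \<Rightarrow> 'a \<Rightarrow> 'b" where
  "dird f x v \<equiv> frechet_derivative f (at x) v"

lemma has_derivative_dird:
  "f differentiable (at x) \<Longrightarrow> (f has_derivative dird f x) (at x)"
  by (simp add: frechet_derivative_works)

lemma dird_eq: "(f has_derivative f') (at x) \<Longrightarrow> dird f x v = f' v"
  using frechet_derivative_at by metis

lemma linear_dird: "f differentiable (at x) \<Longrightarrow> linear (dird f x)"
  by (simp add: linear_frechet_derivative)

lemma dird_cong_open:
  assumes "open U" "x \<in> U" "\<And>y. y \<in> U \<Longrightarrow> f y = g y"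
  shows "dird f x v = dird g x v"
proof (cases "f differentiable (at x)")
  case True
  then show ?thesis using frechet_derivative_transform_within_open[OF True assms] by simp
next
  case False
  have "(f has_derivative D) (at x) \<longleftrightarrow> (g has_derivative D) (at x)" for D
    using has_derivative_transform_within_open[of f D x UNIV U g] has_derivative_transform_within_open[of g D x UNIV U f] assms by auto
  then show ?thesis unfolding frechet_derivative_def by simp
qed

lemma differentiable_cong_open:
  assumes "open U" "x \<in> U" "\<And>y. y \<in> U \<Longrightarrow> f y = g y" "f differentiable (at x)"
  shows "g differentiable (at x)"
  using assms has_derivative_transform_within_open[of f _ x UNIV U g] unfolding differentiable_def by blast

lemma open_nonzero_set:
  fixes h :: "'a::real_normed_vector \<Rightarrow> real"
  assumes "open V" "\<And>x. x \<in> V \<Longrightarrow> h differentiable (at x)"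
  shows "open {x \<in> V. h x \<noteq> 0}"
proof -
  have "continuous_on V h"
    using assms by (intro continuous_at_imp_continuous_on ballI differentiable_imp_continuous_within) auto
  then have "open (h -` (- {0}) \<inter> V)"
    using continuous_on_open_vimage[OF assms(1)] by blast
  moreover have "h -` (- {0}) \<inter> V = {x \<in> V. h x \<noteq> 0}" by auto
  ultimately show ?thesis by simp
qed

text \<open>The mean value theorem in direction \<open>u\<close> turns the second difference into a
  difference of two values of the first derivative near \<open>x\<close>. Differentiability of that
  derivative at the single point \<open>x\<close> evaluates it.\<close>

lemma second_difference_tendsto:
  fixes f :: "'a::real_normed_vector \<Rightarrow> real"
  assumes U: "open U" "x \<in> U" and f: "\<And>y. y \<in> U \<Longrightarrow> f differentiable (at y)"
    and G: "((\<lambda>y. dird f y u) has_derivative G) (at x)"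
  shows "((\<lambda>s. (f (x + s *\<^sub>R u + s *\<^sub>R v) - f (x + s *\<^sub>R u) - f (x + s *\<^sub>R v) + f x) / s\<^sup>2) \<longlongrightarrow> G v) (at_right 0)"
proof (rule tendstoI)
  fix \<epsilon> :: real assume \<epsilon>: "\<epsilon> > 0"
  define K where "K = norm u + norm v + 1"
  have K: "K > 0" unfolding K_def by (simp add: add_nonneg_pos)
  \<comment> \<open>Each of the two increments below costs \<open>e * (s * K)\<close>; after
    division by \<open>s\<^sup>2\<close> the total error \<open>2 * e * K\<close> is half of
    \<epsilon>.\<close>
  define e where "e = \<epsilon> / (4 * K)"
  have e: "e > 0" using K \<epsilon> by (simp add: e_def)
  interpret G: linear G using G has_derivative_linear by blast
  obtain d1 where d1: "d1 > 0" "\<And>y. norm (y - x) < d1 \<Longrightarrow>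
      norm (dird f y u - dird f x u - G (y - x)) \<le> e * norm (y - x)"
    using G e unfolding has_derivative_at_alt by blast
  obtain d2 where d2: "d2 > 0" "ball x d2 \<subseteq> U" using U openE by blast
  define d where "d = min d1 d2"
  have d: "d > 0" "ball x d \<subseteq> U" using d1 d2 by (auto simp: d_def)
  have ev: "eventually (\<lambda>s. 0 < s \<and> s < d / K) (at_right (0::real))"
    using d K by (auto simp: eventually_at_right_field intro!: exI[of _ "d/K"])
  show "\<forall>\<^sub>F s in at_right 0. dist ((f (x + s *\<^sub>R u + s *\<^sub>R v) - f (x + s *\<^sub>R u) - f (x + s *\<^sub>R v) + f x) / s\<^sup>2) (G v) < \<epsilon>"
    using ev
  proof eventually_elim
    case (elim s)
    then have s: "0 < s" "s * K < d" using K by (auto simp: field_simps)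
    have near: "norm (r *\<^sub>R u + q *\<^sub>R v) \<le> s * K" if "0 \<le> r" "r \<le> s" "0 \<le> q" "q \<le> s" for r q
    proof -
      have "norm (r *\<^sub>R u + q *\<^sub>R v) \<le> r * norm u + q * norm v"
        using norm_triangle_ineq[of "r *\<^sub>R u" "q *\<^sub>R v"] that by simp
      also have "\<dots> \<le> s * norm u + s * norm v"
        using that by (intro add_mono mult_right_mono) auto
      also have "\<dots> \<le> s * K" using s by (simp add: K_def algebra_simps)
      finally show ?thesis .
    qed
    have inU: "x + r *\<^sub>R u + q *\<^sub>R v \<in> U" "norm (x + r *\<^sub>R u + q *\<^sub>R v - x) < d1"
      if "0 \<le> r" "r \<le> s" "0 \<le> q" "q \<le> s" for r q
    proof -
      have n: "norm (r *\<^sub>R u + q *\<^sub>R v) < d" using near[OF that] s by linarith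
      then have "dist x (x + r *\<^sub>R u + q *\<^sub>R v) < d" by (simp add: dist_norm norm_minus_commute add.assoc add.commute)
      then show "x + r *\<^sub>R u + q *\<^sub>R v \<in> U" using d by auto
      show "norm (x + r *\<^sub>R u + q *\<^sub>R v - x) < d1" using n by (simp add: d_def add.assoc)
    qed
    \<comment> \<open>The increment in direction \<open>v\<close> as a function of the displacement
      along \<open>u\<close>; its change over [0, s] is the second difference.\<close>
    define h where "h r = f (x + r *\<^sub>R u + s *\<^sub>R v) - f (x + r *\<^sub>R u + 0 *\<^sub>R v)" for r
    have der: "(h has_real_derivative dird f (x + r *\<^sub>R u + s *\<^sub>R v) u - dird f (x + r *\<^sub>R u + 0 *\<^sub>R v) u) (at r)"
      if r: "0 \<le> r" "r \<le> s" for r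
    proof -
      have one: "((\<lambda>r. f (x + r *\<^sub>R u + q *\<^sub>R v)) has_real_derivative dird f (x + r *\<^sub>R u + q *\<^sub>R v) u) (at r)"
        if q: "0 \<le> q" "q \<le> s" for q
      proof -
        have 1: "(f has_derivative dird f (x + r *\<^sub>R u + q *\<^sub>R v)) (at (x + r *\<^sub>R u + q *\<^sub>R v))"
          using f[OF inU(1)[OF r q]] by (rule has_derivative_dird)
        have 2: "((\<lambda>r. x + r *\<^sub>R u + q *\<^sub>R v) has_derivative (\<lambda>h. h *\<^sub>R u)) (at r)"
          by (auto intro!: derivative_eq_intros)
        have "((\<lambda>r. f (x + r *\<^sub>R u + q *\<^sub>R v)) has_derivative (\<lambda>h. dird f (x + r *\<^sub>R u + q *\<^sub>R v) (h *\<^sub>R u))) (at r)"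
          by (rule has_derivative_compose[OF 2 1])
        moreover have "linear (dird f (x + r *\<^sub>R u + q *\<^sub>R v))"
          using linear_dird[OF f[OF inU(1)[OF r q]]] .
        ultimately show ?thesis unfolding has_field_derivative_def
          by (simp add: linear_cmul mult_commute_abs)
      qed
      show ?thesis unfolding h_def using one[of s] one[of 0] s by (intro DERIV_diff) auto
    qed
    obtain \<xi> where \<xi>: "0 < \<xi>" "\<xi> < s" "h s - h 0 = (s - 0) * (dird f (x + \<xi> *\<^sub>R u + s *\<^sub>R v) u - dird f (x + \<xi> *\<^sub>R u + 0 *\<^sub>R v) u)"
      using MVT2[OF s(1) der] by blast
    have b: "norm (dird f (x + \<xi> *\<^sub>R u + q *\<^sub>R v) u - dird f x u - G (\<xi> *\<^sub>R u + q *\<^sub>R v)) \<le> e * (s * K)"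
      if q: "0 \<le> q" "q \<le> s" for q
    proof -
      have "norm (dird f (x + \<xi> *\<^sub>R u + q *\<^sub>R v) u - dird f x u - G (x + \<xi> *\<^sub>R u + q *\<^sub>R v - x)) \<le> e * norm (x + \<xi> *\<^sub>R u + q *\<^sub>R v - x)"
        using d1(2)[OF inU(2)] \<xi> q by simp
      moreover have "x + \<xi> *\<^sub>R u + q *\<^sub>R v - x = \<xi> *\<^sub>R u + q *\<^sub>R v" by simp
      moreover have "e * norm (\<xi> *\<^sub>R u + q *\<^sub>R v) \<le> e * (s * K)" using near[of \<xi> q] \<xi> q e by simp
      ultimately show ?thesis by simp
    qed
    have "\<bar>dird f (x + \<xi> *\<^sub>R u + s *\<^sub>R v) u - dird f (x + \<xi> *\<^sub>R u + 0 *\<^sub>R v) u - s * G v\<bar> \<le> 2 * (e * (s * K))"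
      using b[of s] b[of 0] s by (simp add: G.add G.scale abs_if split: if_splits)
    then have "\<bar>(h s - h 0) - s\<^sup>2 * G v\<bar> \<le> s * (2 * (e * (s * K)))"
    proof -
      assume *: "\<bar>dird f (x + \<xi> *\<^sub>R u + s *\<^sub>R v) u - dird f (x + \<xi> *\<^sub>R u + 0 *\<^sub>R v) u - s * G v\<bar> \<le> 2 * (e * (s * K))"
      have "(h s - h 0) - s\<^sup>2 * G v = s * (dird f (x + \<xi> *\<^sub>R u + s *\<^sub>R v) u - dird f (x + \<xi> *\<^sub>R u + 0 *\<^sub>R v) u - s * G v)"
        using \<xi>(3) by (simp add: power2_eq_square algebra_simps)
      then show ?thesis using * s(1) by (simp add: abs_mult)
    qed
    then have "\<bar>(h s - h 0) / s\<^sup>2 - G v\<bar> \<le> 2 * e * K"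
    proof -
      assume *: "\<bar>(h s - h 0) - s\<^sup>2 * G v\<bar> \<le> s * (2 * (e * (s * K)))"
      have "(h s - h 0) / s\<^sup>2 - G v = ((h s - h 0) - s\<^sup>2 * G v) / s\<^sup>2" using s by (simp add: field_simps)
      then have "\<bar>(h s - h 0) / s\<^sup>2 - G v\<bar> = \<bar>(h s - h 0) - s\<^sup>2 * G v\<bar> / s\<^sup>2" by simp
      also have "\<dots> \<le> s * (2 * (e * (s * K))) / s\<^sup>2" using * by (simp add: divide_right_mono)
      also have "\<dots> = 2 * e * K" using s by (simp add: power2_eq_square)
      finally show ?thesis .
    qed
    moreover have "2 * e * K < \<epsilon>" using K \<epsilon> by (simp add: e_def)
    moreover have "h s - h 0 = f (x + s *\<^sub>R u + s *\<^sub>R v) - f (x + s *\<^sub>R u) - f (x + s *\<^sub>R v) + f x"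
      by (simp add: h_def)
    ultimately show ?case by (simp add: dist_norm)
  qed
qed

text \<open>The second difference is symmetric in \<open>u\<close> and \<open>v\<close>, and its
  limit is unique.\<close>

lemma dird_commute_real:
  fixes f :: "'a::real_normed_vector \<Rightarrow> real"
  assumes U: "open U" "x \<in> U" and f: "\<And>y. y \<in> U \<Longrightarrow> f differentiable (at y)"
    and u: "(\<lambda>y. dird f y u) differentiable (at x)" and v: "(\<lambda>y. dird f y v) differentiable (at x)"
  shows "dird (\<lambda>y. dird f y u) x v = dird (\<lambda>y. dird f y v) x u"
proof -
  note 1 = second_difference_tendsto[OF U f has_derivative_dird[OF u], of v]
  note 2 = second_difference_tendsto[OF U f has_derivative_dird[OF v], of u]
  have "(\<lambda>s. (f (x + s *\<^sub>R v + s *\<^sub>R u) - f (x + s *\<^sub>R v) - f (x + s *\<^sub>R u) + f x) / s\<^sup>2)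
      = (\<lambda>s. (f (x + s *\<^sub>R u + s *\<^sub>R v) - f (x + s *\<^sub>R u) - f (x + s *\<^sub>R v) + f x) / s\<^sup>2)"
    by (simp add: algebra_simps)
  with 2 have 3: "((\<lambda>s. (f (x + s *\<^sub>R u + s *\<^sub>R v) - f (x + s *\<^sub>R u) - f (x + s *\<^sub>R v) + f x) / s\<^sup>2) \<longlongrightarrow> dird (\<lambda>y. dird f y v) x u) (at_right 0)"
    by simp
  show ?thesis by (rule tendsto_unique[OF trivial_limit_at_right_real 1 3])
qed

lemma dird_inner:
  fixes f :: "'a::real_normed_vector \<Rightarrow> 'b::euclidean_space"
  assumes "f differentiable (at x)"
  shows "dird (\<lambda>y. f y \<bullet> b) x v = dird f x v \<bullet> b"
  using has_derivative_inner_left[OF has_derivative_dird[OF assms]] dird_eq by blast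

lemma dird_commute:
  fixes f :: "'a::real_normed_vector \<Rightarrow> 'b::euclidean_space"
  assumes U: "open U" "x \<in> U" and f: "\<And>y. y \<in> U \<Longrightarrow> f differentiable (at y)"
    and f2: "\<And>w. (\<lambda>y. dird f y w) differentiable (at x)"
  shows "dird (\<lambda>y. dird f y u) x v = dird (\<lambda>y. dird f y v) x u"
proof (rule euclidean_eqI)
  fix b :: 'b assume "b \<in> Basis"
  let ?g = "\<lambda>y. f y \<bullet> b"
  have diff: "?g differentiable (at y)" if "y \<in> U" for y
    using has_derivative_inner_left[OF has_derivative_dird[OF f[OF that]]] unfolding differentiable_def by blast
  have eq: "dird ?g y w = dird f y w \<bullet> b" if "y \<in> U" for y w using dird_inner f that by blast
  have d2: "(\<lambda>y. dird ?g y w) differentiable (at x)" "dird (\<lambda>y. dird ?g y w) x z = dird (\<lambda>y. dird f y w) x z \<bullet> b" for w z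
  proof -
    have "((\<lambda>y. dird f y w \<bullet> b) has_derivative (\<lambda>h. dird (\<lambda>y. dird f y w) x h \<bullet> b)) (at x)"
      using has_derivative_inner_left[OF has_derivative_dird[OF f2]] .
    then have *: "((\<lambda>y. dird ?g y w) has_derivative (\<lambda>h. dird (\<lambda>y. dird f y w) x h \<bullet> b)) (at x)"
      by (rule has_derivative_transform_within_open[OF _ U]) (simp add: eq)
    show "(\<lambda>y. dird ?g y w) differentiable (at x)" using * unfolding differentiable_def by blast
    show "dird (\<lambda>y. dird ?g y w) x z = dird (\<lambda>y. dird f y w) x z \<bullet> b" using dird_eq[OF *] by simp
  qed
  show "dird (\<lambda>y. dird f y u) x v \<bullet> b = dird (\<lambda>y. dird f y v) x u \<bullet> b"
    using dird_commute_real[OF U diff d2(1) d2(1)] d2(2)[of u v] d2(2)[of v u] by simp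
qed

section \<open>Exterior derivatives and Lorentzian linear algebra\<close>

lemma dird_add:
  assumes "f differentiable (at x)" "g differentiable (at x)"
  shows "dird (\<lambda>y. f y + g y) x v = dird f x v + dird g x v"
  using dird_eq[OF has_derivative_add[OF assms[THEN has_derivative_dird]]] by simp

lemma dird_diff:
  assumes "f differentiable (at x)" "g differentiable (at x)"
  shows "dird (\<lambda>y. f y - g y) x v = dird f x v - dird g x v"
  using dird_eq[OF has_derivative_diff[OF assms[THEN has_derivative_dird]]] by simp

lemma dird_minus:
  assumes "f differentiable (at x)"
  shows "dird (\<lambda>y. - f y) x v = - dird f x v"
  using dird_eq[OF has_derivative_minus[OF assms[THEN has_derivative_dird]]] by simp

lemma dird_bilinear:
  assumes "bounded_bilinear B" "f differentiable (at x)" "g differentiable (at x)"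
  shows "dird (\<lambda>y. B (f y) (g y)) x v = B (dird f x v) (g x) + B (f x) (dird g x v)"
    and "(\<lambda>y. B (f y) (g y)) differentiable (at x)"
proof -
  have *: "((\<lambda>y. B (f y) (g y)) has_derivative (\<lambda>h. B (f x) (dird g x h) + B (dird f x h) (g x))) (at x)"
    using bounded_bilinear.FDERIV[OF assms(1) has_derivative_dird[OF assms(2)] has_derivative_dird[OF assms(3)]] by simp
  show "dird (\<lambda>y. B (f y) (g y)) x v = B (dird f x v) (g x) + B (f x) (dird g x v)"
    using dird_eq[OF *] by simp
  show "(\<lambda>y. B (f y) (g y)) differentiable (at x)" using * unfolding differentiable_def by blast
qed

lemma dird_mult:
  fixes f g :: "'a::real_normed_vector \<Rightarrow> real"
  assumes "f differentiable (at x)" "g differentiable (at x)"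
  shows "dird (\<lambda>y. f y * g y) x v = dird f x v * g x + f x * dird g x v"
  using dird_bilinear(1)[OF bounded_bilinear_mult assms] .

lemma dird_scaleR:
  assumes "f differentiable (at x)" "g differentiable (at x)"
  shows "dird (\<lambda>y. f y *\<^sub>R g y) x v = dird f x v *\<^sub>R g x + f x *\<^sub>R dird g x v"
    and "(\<lambda>y. f y *\<^sub>R g y) differentiable (at x)"
  using dird_bilinear[OF bounded_bilinear_scaleR assms] by auto

lemma dird_power2:
  fixes f :: "'a::real_normed_vector \<Rightarrow> real"
  assumes "f differentiable (at x)"
  shows "dird (\<lambda>y. (f y)\<^sup>2) x v = 2 * f x * dird f x v"
  unfolding power2_eq_square using dird_mult[OF assms assms] by simp

lemma dird_linear_compose:
  assumes "bounded_linear L" "f differentiable (at x)"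
  shows "dird (\<lambda>y. L (f y)) x v = L (dird f x v)" "(\<lambda>y. L (f y)) differentiable (at x)"
proof -
  have *: "((\<lambda>y. L (f y)) has_derivative (\<lambda>h. L (dird f x h))) (at x)"
    using bounded_linear.has_derivative[OF assms(1) has_derivative_dird[OF assms(2)]] .
  show "dird (\<lambda>y. L (f y)) x v = L (dird f x v)" using dird_eq[OF *] .
  show "(\<lambda>y. L (f y)) differentiable (at x)" using * unfolding differentiable_def by blast
qed

lemma dird_eq_0_of_zero_on:
  assumes "open U" "x \<in> U" "\<And>y. y \<in> U \<Longrightarrow> f y = k"
  shows "dird f x v = 0"
  using dird_cong_open[OF assms(1,2), of f "\<lambda>_. k" v] assms(3) by simp

text \<open>\<open>v\<close> and \<open>u\<close> act as constant vector fields, whose bracket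
  vanishes; hence this exterior derivative has no bracket term.\<close>

definition ext :: "('a::real_normed_vector \<Rightarrow> 'a \<Rightarrow> real) \<Rightarrow> 'a \<Rightarrow> 'a \<Rightarrow> 'a \<Rightarrow> real" where
  "ext \<omega> x v u = dird (\<lambda>y. \<omega> y u) x v - dird (\<lambda>y. \<omega> y v) x u"

definition wedge :: "('a \<Rightarrow> 'a \<Rightarrow> real) \<Rightarrow> ('a \<Rightarrow> 'a \<Rightarrow> real) \<Rightarrow> 'a \<Rightarrow> 'a \<Rightarrow> 'a \<Rightarrow> real" where
  "wedge \<omega> \<rho> x v u = \<omega> x v * \<rho> x u - \<omega> x u * \<rho> x v"

lemma ext_add:
  assumes "\<And>u. (\<lambda>y. \<omega> y u) differentiable (at x)" "\<And>u. (\<lambda>y. \<rho> y u) differentiable (at x)"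
  shows "ext (\<lambda>y u. \<omega> y u + \<rho> y u) x v u = ext \<omega> x v u + ext \<rho> x v u"
  unfolding ext_def using assms by (simp add: dird_add)

lemma ext_scale:
  assumes "f differentiable (at x)" "\<And>u. (\<lambda>y. \<omega> y u) differentiable (at x)"
  shows "ext (\<lambda>y u. f y * \<omega> y u) x v u = dird f x v * \<omega> x u - dird f x u * \<omega> x v + f x * ext \<omega> x v u"
  unfolding ext_def using assms by (simp add: dird_mult algebra_simps)

lemma ext_cong_open:
  assumes "open U" "x \<in> U" "\<And>y u. y \<in> U \<Longrightarrow> \<omega> y u = \<rho> y u"
  shows "ext \<omega> x v u = ext \<rho> x v u"
  unfolding ext_def using dird_cong_open[OF assms(1,2), of "\<lambda>y. \<omega> y u" "\<lambda>y. \<rho> y u" v]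
   dird_cong_open[OF assms(1,2), of "\<lambda>y. \<omega> y v" "\<lambda>y. \<rho> y v" u] assms(3) by simp

text \<open>The Lorentzian cross product: \<open>lor (lcross a b) z\<close> is the determinant of
  \<open>a, b, z\<close>. For \<open>p\<close> in \<open>H2\<close>, \<open>lcross p\<close> is the
  quarter turn J of the tangent plane at \<open>p\<close>.\<close>

definition lcross :: "R3 \<Rightarrow> R3 \<Rightarrow> R3" where
  "lcross a b = vector [a$3 * b$2 - a$2 * b$3, a$3 * b$1 - a$1 * b$3, a$1 * b$2 - a$2 * b$1]"

lemma bounded_bilinear_lor: "bounded_bilinear lor"
  unfolding bilinear_conv_bounded_bilinear[symmetric]
  by (auto simp: bilinear_def linear_iff lor_def algebra_simps)

lemma bounded_bilinear_lcross: "bounded_bilinear lcross"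
  unfolding bilinear_conv_bounded_bilinear[symmetric]
  by (auto simp: bilinear_def linear_iff lcross_def algebra_simps vec_eq_iff forall_3)

lemma lor_sym: "lor a b = lor b a"
  by (simp add: lor_def)

lemma lor_simps:
  "lor (a + b) z = lor a z + lor b z" "lor z (a + b) = lor z a + lor z b"
  "lor (a - b) z = lor a z - lor b z" "lor z (a - b) = lor z a - lor z b"
  "lor (r *\<^sub>R a) z = r * lor a z" "lor z (r *\<^sub>R a) = r * lor z a"
  "lor (- a) z = - lor a z" "lor z (- a) = - lor z a"
  "lor 0 z = 0" "lor z 0 = 0"
  by (simp_all add: lor_def algebra_simps)

lemma lor_lcross:
  "lor (lcross a b) a = 0" "lor (lcross a b) b = 0" "lor a (lcross a b) = 0" "lor b (lcross a b) = 0"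
  "lor (lcross a b) (lcross a b) = (lor a b)\<^sup>2 - lor a a * lor b b"
  by (simp_all add: lor_def lcross_def algebra_simps power2_eq_square)

lemma lcross_lcross:
  "lcross a (lcross a b) = lor a a *\<^sub>R b - lor a b *\<^sub>R a"
  "lcross (lcross a b) b = lor b b *\<^sub>R a - lor a b *\<^sub>R b"
  by (simp_all add: vec_eq_iff forall_3 lor_def lcross_def algebra_simps)

lemma lcross_self: "lcross a a = 0"
  by (simp add: vec_eq_iff forall_3 lcross_def)

text \<open>A polynomial identity with the Gram determinant of \<open>p\<close> and \<open>n\<close>
  as a factor holds for arbitrary vectors; for an orthonormal pair that factor is -1.\<close>

lemma lor_expand:
  assumes "lor p p = -1" "lor n n = 1" "lor n p = 0"
  shows "z = (- lor z p) *\<^sub>R p + lor z n *\<^sub>R n + lor z (lcross p n) *\<^sub>R lcross p n"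
proof -
  have "(lor p p * lor n n - (lor n p)\<^sup>2) *\<^sub>R z =
      (lor n n * lor z p - lor n p * lor z n) *\<^sub>R p + (lor p p * lor z n - lor n p * lor z p) *\<^sub>R n
      - lor z (lcross p n) *\<^sub>R lcross p n"
    by (simp add: vec_eq_iff forall_3 lor_def lcross_def) (algebra)
  then have "- z = lor z p *\<^sub>R p - lor z n *\<^sub>R n - lor z (lcross p n) *\<^sub>R lcross p n"
    using assms by simp
  then show ?thesis by (simp add: algebra_simps minus_equation_iff[of z])
qed

lemma lor_nondegenerate: "(\<And>z. lor w z = 0) \<Longrightarrow> w = 0"
proof -
  assume a: "\<And>z. lor w z = 0"
  from a[of "vector [1,0,0]"] a[of "vector [0,1,0]"] a[of "vector [0,0,1]"]
  show "w = 0" by (simp add: lor_def vec_eq_iff forall_3)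
qed

section \<open>The moving frame of one hyperbolic factor\<close>

locale factor_chart =
  fixes U :: "R3 set" and P \<mu> :: "R3 \<Rightarrow> R3"
  assumes open_U: "open U"
    and dP: "x \<in> U \<Longrightarrow> P differentiable (at x)"
    and ddP: "x \<in> U \<Longrightarrow> (\<lambda>y. dird P y u) differentiable (at x)"
    and dmu: "x \<in> U \<Longrightarrow> \<mu> differentiable (at x)"
    and ddmu: "x \<in> U \<Longrightarrow> (\<lambda>y. dird \<mu> y u) differentiable (at x)"
    and PP: "x \<in> U \<Longrightarrow> lor (P x) (P x) = -1"
    and muP: "x \<in> U \<Longrightarrow> lor (\<mu> x) (P x) = 0"
    and mu_pos: "x \<in> U \<Longrightarrow> lor (\<mu> x) (\<mu> x) > 0"
begin

definition r :: "R3 \<Rightarrow> real" where "r x = sqrt (lor (\<mu> x) (\<mu> x))"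
definition n :: "R3 \<Rightarrow> R3" where "n x = (1 / r x) *\<^sub>R \<mu> x"
definition m :: "R3 \<Rightarrow> R3" where "m x = lcross (P x) (n x)"
definition \<alpha> :: "R3 \<Rightarrow> R3 \<Rightarrow> real" where "\<alpha> x u = lor (dird P x u) (n x)"
definition \<beta> :: "R3 \<Rightarrow> R3 \<Rightarrow> real" where "\<beta> x u = lor (dird P x u) (m x)"
definition K :: "R3 \<Rightarrow> R3 \<Rightarrow> real" where "K x u = lor (dird \<mu> x u) (n x)"
text \<open>The sign makes \<open>Z\<close> part of the shape operator, which is minus the
  derivative of the normal.\<close>

definition Z :: "R3 \<Rightarrow> R3 \<Rightarrow> real" where "Z x u = - lor (dird \<mu> x u) (m x)"

lemma r_pos: "x \<in> U \<Longrightarrow> r x > 0" and r_sq: "x \<in> U \<Longrightarrow> (r x)\<^sup>2 = lor (\<mu> x) (\<mu> x)"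
  using mu_pos[of x] by (auto simp: r_def)

lemma mu_eq: "x \<in> U \<Longrightarrow> \<mu> x = r x *\<^sub>R n x"
  using r_pos[of x] by (simp add: n_def)

lemma nn: "x \<in> U \<Longrightarrow> lor (n x) (n x) = 1"
  using mu_pos[of x] r_sq[of x] by (simp add: n_def lor_simps power2_eq_square[symmetric])
lemma nP: "x \<in> U \<Longrightarrow> lor (n x) (P x) = 0"
  using muP[of x] by (simp add: n_def lor_simps)
lemma mm: "x \<in> U \<Longrightarrow> lor (m x) (m x) = 1"
  using PP[of x] nn[of x] nP[of x] lor_sym[of "P x" "n x"] by (simp add: m_def lor_lcross)
lemma mP: "lor (m x) (P x) = 0" and mn: "lor (m x) (n x) = 0"
  by (simp_all add: m_def lor_lcross)

lemmas frame = PP nn nP mm mP mn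

lemma frame': "x \<in> U \<Longrightarrow> lor (P x) (n x) = 0" "lor (P x) (m x) = 0" "lor (n x) (m x) = 0"
  using nP mP mn by (simp_all add: lor_sym)

lemma expand: "x \<in> U \<Longrightarrow> z = (- lor z (P x)) *\<^sub>R P x + lor z (n x) *\<^sub>R n x + lor z (m x) *\<^sub>R m x"
  unfolding m_def by (rule lor_expand) (auto simp: frame)

lemma dird_lor:
  assumes "f differentiable (at x)" "g differentiable (at x)"
  shows "dird (\<lambda>y. lor (f y) (g y)) x v = lor (dird f x v) (g x) + lor (f x) (dird g x v)"
    "(\<lambda>y. lor (f y) (g y)) differentiable (at x)"
  using dird_bilinear[OF bounded_bilinear_lor assms] by auto

lemma dP_P: assumes "x \<in> U" shows "lor (dird P x u) (P x) = 0"
proof -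
  have "dird (\<lambda>y. lor (P y) (P y)) x u = 0"
    by (rule dird_eq_0_of_zero_on[OF open_U assms]) (rule PP)
  then show ?thesis using dird_lor(1)[OF dP dP, OF assms assms, of u] by (simp add: lor_sym[of "P x"])
qed

lemma dP_eq: assumes "x \<in> U" shows "dird P x u = \<alpha> x u *\<^sub>R n x + \<beta> x u *\<^sub>R m x"
  using expand[OF assms, of "dird P x u"] dP_P[OF assms] by (simp add: \<alpha>_def \<beta>_def)

text \<open>Differentiating \<open>lor (\<mu> y) (P y) = 0\<close> yields the component along
  \<open>P\<close>; its sign flips because \<open>P\<close> is timelike.\<close>

lemma dmu_eq: assumes "x \<in> U" shows "dird \<mu> x u = K x u *\<^sub>R n x - Z x u *\<^sub>R m x + (r x * \<alpha> x u) *\<^sub>R P x"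
proof -
  have "dird (\<lambda>y. lor (\<mu> y) (P y)) x u = 0"
    by (rule dird_eq_0_of_zero_on[OF open_U assms]) (rule muP)
  then have "lor (dird \<mu> x u) (P x) = - r x * \<alpha> x u"
    using dird_lor(1)[OF dmu dP, OF assms assms, of u] mu_eq[OF assms]
    by (simp add: lor_simps \<alpha>_def lor_sym[of "n x"])
  then show ?thesis using expand[OF assms, of "dird \<mu> x u"] by (simp add: K_def Z_def add.commute add.left_commute)
qed

lemma dr: assumes "x \<in> U" shows "r differentiable (at x)" "dird r x u = K x u"
proof -
  let ?g = "\<lambda>y. lor (\<mu> y) (\<mu> y)"
  have "(?g has_derivative dird ?g x) (at x)"
    by (rule has_derivative_dird[OF dird_lor(2)[OF dmu dmu, OF assms assms]])
  from has_derivative_real_sqrt[OF mu_pos[OF assms] this]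
  have *: "(r has_derivative (\<lambda>u. dird ?g x u * inverse (sqrt (?g x)) / 2)) (at x)"
    unfolding r_def[abs_def] by simp
  show "r differentiable (at x)" using * unfolding differentiable_def by blast
  have "dird r x u = dird ?g x u * inverse (r x) / 2" using dird_eq[OF *] by (simp add: r_def)
  also have "dird ?g x u = 2 * lor (dird \<mu> x u) (\<mu> x)"
    using dird_lor(1)[OF dmu dmu, OF assms assms, of u] by (simp add: lor_sym[of "\<mu> x"])
  also have "\<dots> = 2 * r x * K x u" using mu_eq[OF assms] by (simp add: K_def lor_simps)
  finally show "dird r x u = K x u" using r_pos[OF assms] by simp
qed

lemma dn: assumes "x \<in> U"
  shows "n differentiable (at x)" "dird n x u = (\<alpha> x u) *\<^sub>R P x - (Z x u / r x) *\<^sub>R m x"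
proof -
  have ir: "(\<lambda>y. 1 / r y) differentiable (at x)"
    using dr(1)[OF assms] r_pos[OF assms] by (intro differentiable_divide) auto
  show n: "n differentiable (at x)"
    unfolding n_def[abs_def] by (rule dird_scaleR(2)[OF ir dmu[OF assms]])
  \<comment> \<open>The product rule for \<open>\<mu> = r n\<close> is solved for the derivative of
    \<open>n\<close>, so the derivative of \<open>1 / r\<close> need not be computed.\<close>
  have "dird \<mu> x u = dird (\<lambda>y. r y *\<^sub>R n y) x u"
    by (rule dird_cong_open[OF open_U assms]) (rule mu_eq)
  also have "\<dots> = K x u *\<^sub>R n x + r x *\<^sub>R dird n x u"
    using dird_scaleR(1)[OF dr(1)[OF assms] n] dr(2)[OF assms] by simp
  finally have "r x *\<^sub>R dird n x u = (r x * \<alpha> x u) *\<^sub>R P x - Z x u *\<^sub>R m x"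
    using dmu_eq[OF assms, of u] by (simp add: algebra_simps)
  then have "(1 / r x) *\<^sub>R (r x *\<^sub>R dird n x u) = (1 / r x) *\<^sub>R ((r x * \<alpha> x u) *\<^sub>R P x - Z x u *\<^sub>R m x)"
    by simp
  then show "dird n x u = (\<alpha> x u) *\<^sub>R P x - (Z x u / r x) *\<^sub>R m x"
    using r_pos[OF assms] by (simp add: scaleR_diff_right)
qed

lemma dm: assumes "x \<in> U"
  shows "m differentiable (at x)" "dird m x u = (Z x u / r x) *\<^sub>R n x + \<beta> x u *\<^sub>R P x"
proof -
  interpret bounded_bilinear lcross by (rule bounded_bilinear_lcross)
  show "m differentiable (at x)"
    unfolding m_def[abs_def] by (rule dird_bilinear(2)[OF bounded_bilinear_lcross dP dn(1)]) (fact assms)+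
  have "dird m x u = lcross (dird P x u) (n x) + lcross (P x) (dird n x u)"
    unfolding m_def[abs_def] by (rule dird_bilinear(1)[OF bounded_bilinear_lcross dP dn(1)]) (fact assms)+
  also have "\<dots> = \<beta> x u *\<^sub>R lcross (m x) (n x) - (Z x u / r x) *\<^sub>R lcross (P x) (m x)"
    by (simp add: dP_eq[OF assms] dn(2)[OF assms] add_left add_right diff_right scaleR_left scaleR_right lcross_self)
  also have "lcross (m x) (n x) = P x"
    using frame'(1)[OF assms] nn[OF assms] by (simp add: m_def lcross_lcross)
  also have "lcross (P x) (m x) = - n x"
    using frame'(1)[OF assms] PP[OF assms] by (simp add: m_def lcross_lcross)
  finally show "dird m x u = (Z x u / r x) *\<^sub>R n x + \<beta> x u *\<^sub>R P x" by simp
qed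

text \<open>The hypothesis on \<open>Z\<close> cancels the components along \<open>m\<close>. What
  remains says that the null vector \<open>P + \<epsilon> n\<close> moves along its own line, so it
  points to a fixed point at infinity.\<close>

lemma null_section:
  assumes x: "x \<in> U" and Z: "\<And>v. Z x v = \<epsilon> * r x * \<beta> x v" and \<epsilon>: "\<epsilon> * \<epsilon> = 1"
  shows "(\<lambda>y. P y + \<epsilon> *\<^sub>R n y) differentiable (at x)"
    "dird (\<lambda>y. P y + \<epsilon> *\<^sub>R n y) x v = (\<epsilon> * \<alpha> x v) *\<^sub>R (P x + \<epsilon> *\<^sub>R n x)"
proof -
  note e = dird_linear_compose[OF bounded_linear_scaleR_right dn(1)[OF x], of \<epsilon>]
  show "(\<lambda>y. P y + \<epsilon> *\<^sub>R n y) differentiable (at x)" by (intro differentiable_add dP[OF x] e(2))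
  have Z: "Z x v / r x = \<epsilon> * \<beta> x v" using Z r_pos[OF x] by simp
  have "dird (\<lambda>y. P y + \<epsilon> *\<^sub>R n y) x v
    = \<alpha> x v *\<^sub>R n x + \<beta> x v *\<^sub>R m x + \<epsilon> *\<^sub>R (\<alpha> x v *\<^sub>R P x - (\<epsilon> * \<beta> x v) *\<^sub>R m x)"
    unfolding dird_add[OF dP[OF x] e(2)] e(1) dP_eq[OF x] dn(2)[OF x] Z ..
  also have "\<dots> = (\<epsilon> * \<alpha> x v) *\<^sub>R P x + \<alpha> x v *\<^sub>R n x + (\<beta> x v - \<epsilon> * \<epsilon> * \<beta> x v) *\<^sub>R m x"
    by (simp add: algebra_simps)
  also have "\<dots> = (\<epsilon> * \<alpha> x v) *\<^sub>R P x + (\<epsilon> * \<epsilon> * \<alpha> x v) *\<^sub>R n x" by (simp add: \<epsilon>)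
  also have "\<dots> = (\<epsilon> * \<alpha> x v) *\<^sub>R (P x + \<epsilon> *\<^sub>R n x)" by (simp add: scaleR_add_right mult_ac)
  finally show "dird (\<lambda>y. P y + \<epsilon> *\<^sub>R n y) x v = (\<epsilon> * \<alpha> x v) *\<^sub>R (P x + \<epsilon> *\<^sub>R n x)" .
qed

lemma commP: "x \<in> U \<Longrightarrow> dird (\<lambda>y. dird P y u) x v = dird (\<lambda>y. dird P y v) x u"
  by (rule dird_commute[OF open_U _ dP ddP])
lemma commmu: "x \<in> U \<Longrightarrow> dird (\<lambda>y. dird \<mu> y u) x v = dird (\<lambda>y. dird \<mu> y v) x u"
  by (rule dird_commute[OF open_U _ dmu ddmu])

lemma form_diff:
  assumes "x \<in> U"
  shows "(\<lambda>y. \<alpha> y u) differentiable (at x)" "(\<lambda>y. \<beta> y u) differentiable (at x)"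
    "(\<lambda>y. K y u) differentiable (at x)" "(\<lambda>y. Z y u) differentiable (at x)"
  unfolding \<alpha>_def \<beta>_def K_def Z_def
  by (auto intro!: dird_lor(2) ddP ddmu dn(1) dm(1) differentiable_minus assms)

lemma form_linear:
  assumes "x \<in> U"
  shows "linear (\<alpha> x)" "linear (\<beta> x)" "linear (K x)" "linear (Z x)"
  using linear_dird[OF dP[OF assms]] linear_dird[OF dmu[OF assms]]
  by (auto simp: \<alpha>_def[abs_def] \<beta>_def[abs_def] K_def[abs_def] Z_def[abs_def] linear_iff lor_simps)

text \<open>Cartan's equations. The second derivatives of \<open>P\<close> and \<mu> are symmetric
  and cancel, which leaves the derivatives of the frame. \<open>K\<close> is closed as the
  differential of \<open>r\<close>; the term with \<alpha> and \<beta> in the last equation is the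
  curvature of \<open>H2\<close>.\<close>

lemma structure_equations:
  assumes "x \<in> U"
  shows "ext \<alpha> x v u = wedge \<beta> Z x v u / r x"
    "ext \<beta> x v u = - wedge \<alpha> Z x v u / r x"
    "ext K x v u = 0"
    "ext Z x v u = wedge K Z x v u / r x - r x * wedge \<alpha> \<beta> x v u"
proof -
  note d = dird_lor(1)[OF ddP dn(1), OF assms assms] dird_lor(1)[OF ddP dm(1), OF assms assms]
    dird_lor(1)[OF ddmu dn(1), OF assms assms] dird_lor(1)[OF ddmu dm(1), OF assms assms]
  have Zd: "dird (\<lambda>y. Z y a) x b = - dird (\<lambda>y. lor (dird \<mu> y a) (m y)) x b" for a b
    unfolding Z_def by (rule dird_minus[OF dird_lor(2)[OF ddmu dm(1), OF assms assms]])
  note fr = frame[of x] frame'[of x]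
  have "ext \<alpha> x v u = lor (dird P x u) (dird n x v) - lor (dird P x v) (dird n x u)"
    using commP[OF assms, of u v] by (simp add: ext_def \<alpha>_def d)
  then show "ext \<alpha> x v u = wedge \<beta> Z x v u / r x"
    using assms by (simp add: dP_eq dn(2) lor_simps fr wedge_def diff_divide_distrib mult.commute)
  have "ext \<beta> x v u = lor (dird P x u) (dird m x v) - lor (dird P x v) (dird m x u)"
    using commP[OF assms, of u v] by (simp add: ext_def \<beta>_def d)
  then show "ext \<beta> x v u = - wedge \<alpha> Z x v u / r x"
    using assms by (simp add: dP_eq dm(2) lor_simps fr wedge_def diff_divide_distrib mult.commute)
  have "ext K x v u = lor (dird \<mu> x u) (dird n x v) - lor (dird \<mu> x v) (dird n x u)"
    using commmu[OF assms, of u v] by (simp add: ext_def K_def d)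
  then show "ext K x v u = 0"
    using assms by (simp add: dmu_eq dn(2) lor_simps fr)
  have "ext Z x v u = lor (dird \<mu> x v) (dird m x u) - lor (dird \<mu> x u) (dird m x v)"
    using commmu[OF assms, of u v] by (simp add: ext_def Zd d)
  then show "ext Z x v u = wedge K Z x v u / r x - r x * wedge \<alpha> \<beta> x v u"
    using assms by (simp add: dmu_eq dm(2) lor_simps fr wedge_def algebra_simps diff_divide_distrib)
qed

end

section \<open>The structure equations of the adapted coframe\<close>

text \<open>\<open>\<eta>0, \<eta>1, \<eta>2\<close> is the coframe dual to \<open>T = (s n1, - c n2), e1 = (m1, 0), e2 = (0, m2)\<close>, and
  \<open>\<kappa>, \<zeta>1, \<zeta>2\<close> are the rows of the shape operator in this frame. The connection forms of the two
  factors are \<open>- \<zeta>1 / c\<close> and \<open>- \<zeta>2 / s\<close>, so no further unknown occurs.\<close>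

locale structure_eqs =
  fixes U :: "R3 set" and c s :: "R3 \<Rightarrow> real"
    and \<eta>0 \<eta>1 \<eta>2 \<kappa> \<zeta>1 \<zeta>2 :: "R3 \<Rightarrow> R3 \<Rightarrow> real"
  assumes open_U: "open U"
    and lin: "x \<in> U \<Longrightarrow> linear (\<eta>0 x)" "x \<in> U \<Longrightarrow> linear (\<eta>1 x)" "x \<in> U \<Longrightarrow> linear (\<eta>2 x)"
      "x \<in> U \<Longrightarrow> linear (\<kappa> x)" "x \<in> U \<Longrightarrow> linear (\<zeta>1 x)" "x \<in> U \<Longrightarrow> linear (\<zeta>2 x)"
    and diff: "x \<in> U \<Longrightarrow> (\<lambda>y. \<eta>0 y u) differentiable (at x)"
      "x \<in> U \<Longrightarrow> (\<lambda>y. \<eta>1 y u) differentiable (at x)"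
      "x \<in> U \<Longrightarrow> (\<lambda>y. \<eta>2 y u) differentiable (at x)"
      "x \<in> U \<Longrightarrow> (\<lambda>y. \<kappa> y u) differentiable (at x)"
      "x \<in> U \<Longrightarrow> (\<lambda>y. \<zeta>1 y u) differentiable (at x)"
      "x \<in> U \<Longrightarrow> (\<lambda>y. \<zeta>2 y u) differentiable (at x)"
    and cs_diff: "x \<in> U \<Longrightarrow> c differentiable (at x)" "x \<in> U \<Longrightarrow> s differentiable (at x)"
    and cs_pos: "x \<in> U \<Longrightarrow> c x > 0" "x \<in> U \<Longrightarrow> s x > 0"
    and cs_1: "x \<in> U \<Longrightarrow> (c x)\<^sup>2 + (s x)\<^sup>2 = 1"
    and dc: "x \<in> U \<Longrightarrow> dird c x v = - s x * \<kappa> x v"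
    and ds: "x \<in> U \<Longrightarrow> dird s x v = c x * \<kappa> x v"
    and ext_\<eta>0: "x \<in> U \<Longrightarrow> ext \<eta>0 x v u = - (s x / c x) * wedge \<zeta>1 \<eta>1 x v u + (c x / s x) * wedge \<zeta>2 \<eta>2 x v u"
    and ext_\<eta>1: "x \<in> U \<Longrightarrow> ext \<eta>1 x v u = - (s x / c x) * wedge \<eta>0 \<zeta>1 x v u"
    and ext_\<eta>2: "x \<in> U \<Longrightarrow> ext \<eta>2 x v u = (c x / s x) * wedge \<eta>0 \<zeta>2 x v u"
    and ext_\<kappa>: "x \<in> U \<Longrightarrow> ext \<kappa> x v u = 0"
    and ext_\<zeta>1: "x \<in> U \<Longrightarrow> ext \<zeta>1 x v u = - (s x / c x) * wedge \<kappa> \<zeta>1 x v u - c x * s x * wedge \<eta>0 \<eta>1 x v u"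
    and ext_\<zeta>2: "x \<in> U \<Longrightarrow> ext \<zeta>2 x v u = (c x / s x) * wedge \<kappa> \<zeta>2 x v u + c x * s x * wedge \<eta>0 \<eta>2 x v u"
    and symm: "x \<in> U \<Longrightarrow> wedge \<kappa> \<eta>0 x v u + wedge \<zeta>1 \<eta>1 x v u + wedge \<zeta>2 \<eta>2 x v u = 0"
    and indep: "x \<in> U \<Longrightarrow> \<eta>0 x u = 0 \<Longrightarrow> \<eta>1 x u = 0 \<Longrightarrow> \<eta>2 x u = 0 \<Longrightarrow> u = 0"

lemma structure_eqs_subset:
  assumes "structure_eqs U c s e0 e1 e2 k z1 z2" "open V" "V \<subseteq> U"
  shows "structure_eqs V c s e0 e1 e2 k z1 z2"
proof -
  interpret S: structure_eqs U c s e0 e1 e2 k z1 z2 by fact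
  have V: "x \<in> V \<Longrightarrow> x \<in> U" for x using assms(3) by blast
  show ?thesis
    by (rule structure_eqs.intro; (rule assms(2) S.lin[OF V] S.diff[OF V] S.cs_diff[OF V] S.cs_pos[OF V] S.cs_1[OF V] S.dc[OF V] S.ds[OF V]
      S.ext_\<eta>0[OF V] S.ext_\<eta>1[OF V] S.ext_\<eta>2[OF V] S.ext_\<kappa>[OF V] S.ext_\<zeta>1[OF V] S.ext_\<zeta>2[OF V]
      S.symm[OF V] S.indep[OF V]); assumption)
qed

context structure_eqs
begin

lemma dual_vector:
  assumes x: "x \<in> U"
  obtains u where "\<eta>0 x u = p" "\<eta>1 x u = q" "\<eta>2 x u = r"
proof -
  define L where "L u = (vector [\<eta>0 x u, \<eta>1 x u, \<eta>2 x u] :: R3)" for u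
  have L: "linear L"
    using lin[OF x] by (auto simp: L_def linear_iff vec_eq_iff forall_3)
  have "L u = 0 \<Longrightarrow> u = 0" for u
    using indep[OF x, of u] by (simp add: L_def vec_eq_iff forall_3)
  then have "inj L" using linear_injective_0[OF L] by blast
  then have "surj L" using linear_injective_imp_surjective[OF L] by blast
  then obtain u where "vector [p, q, r] = L u" by (auto elim: surjE)
  then show ?thesis using that[of u] by (simp add: L_def vec_eq_iff forall_3)
qed

section \<open>Coefficients of a 1-form in the coframe\<close>

definition comp :: "(R3 \<Rightarrow> R3 \<Rightarrow> real) \<Rightarrow> 3 \<Rightarrow> R3 \<Rightarrow> real" where
  "comp \<omega> i x = \<omega> x (axis i 1)"

text \<open>The wedge of the three forms evaluated on the standard basis, that is, the determinant
  of their components.\<close>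

definition triple :: "(R3 \<Rightarrow> R3 \<Rightarrow> real) \<Rightarrow> (R3 \<Rightarrow> R3 \<Rightarrow> real) \<Rightarrow> (R3 \<Rightarrow> R3 \<Rightarrow> real) \<Rightarrow> R3 \<Rightarrow> real" where
  "triple \<omega> \<rho> \<sigma> x = comp \<omega> 1 x * (comp \<rho> 2 x * comp \<sigma> 3 x - comp \<rho> 3 x * comp \<sigma> 2 x)
    + comp \<omega> 2 x * (comp \<rho> 3 x * comp \<sigma> 1 x - comp \<rho> 1 x * comp \<sigma> 3 x)
    + comp \<omega> 3 x * (comp \<rho> 1 x * comp \<sigma> 2 x - comp \<rho> 2 x * comp \<sigma> 1 x)"

lemma linear_comp:
  assumes "linear (\<omega> x)"
  shows "\<omega> x u = u$1 * comp \<omega> 1 x + u$2 * comp \<omega> 2 x + u$3 * comp \<omega> 3 x"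
proof -
  have "u = u$1 *\<^sub>R axis 1 1 + u$2 *\<^sub>R axis 2 1 + u$3 *\<^sub>R (axis 3 1 :: R3)"
    by (simp add: vec_eq_iff forall_3 axis_def)
  then have "\<omega> x u = \<omega> x (u$1 *\<^sub>R axis 1 1 + u$2 *\<^sub>R axis 2 1 + u$3 *\<^sub>R axis 3 1)" by simp
  also have "\<dots> = u$1 * comp \<omega> 1 x + u$2 * comp \<omega> 2 x + u$3 * comp \<omega> 3 x"
    using assms by (simp add: linear_add linear_scale comp_def)
  finally show ?thesis .
qed

lemma triple_differentiable:
  assumes "\<And>u. (\<lambda>y. \<omega> y u) differentiable (at x)" "\<And>u. (\<lambda>y. \<rho> y u) differentiable (at x)"
    "\<And>u. (\<lambda>y. \<sigma> y u) differentiable (at x)"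
  shows "triple \<omega> \<rho> \<sigma> differentiable (at x)"
  unfolding triple_def[abs_def] comp_def using assms
  by (intro differentiable_add differentiable_mult differentiable_diff) auto

text \<open>Determinants multiply: against the dual vectors the coframe gives the identity
  matrix.\<close>

lemma triple_nz:
  assumes x: "x \<in> U" shows "triple \<eta>0 \<eta>1 \<eta>2 x \<noteq> 0"
proof
  assume 0: "triple \<eta>0 \<eta>1 \<eta>2 x = 0"
  obtain u where u: "\<eta>0 x u = 1" "\<eta>1 x u = 0" "\<eta>2 x u = 0" by (rule dual_vector[OF x])
  obtain v where v: "\<eta>0 x v = 0" "\<eta>1 x v = 1" "\<eta>2 x v = 0" by (rule dual_vector[OF x])
  obtain w where w: "\<eta>0 x w = 0" "\<eta>1 x w = 0" "\<eta>2 x w = 1" by (rule dual_vector[OF x])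
  have "triple \<eta>0 \<eta>1 \<eta>2 x * (u$1 * (v$2*w$3 - v$3*w$2) + u$2 * (v$3*w$1 - v$1*w$3) + u$3*(v$1*w$2 - v$2*w$1))
    = \<eta>0 x u * (\<eta>1 x v * \<eta>2 x w - \<eta>1 x w * \<eta>2 x v) + \<eta>0 x v * (\<eta>1 x w * \<eta>2 x u - \<eta>1 x u * \<eta>2 x w)
      + \<eta>0 x w * (\<eta>1 x u * \<eta>2 x v - \<eta>1 x v * \<eta>2 x u)"
    unfolding triple_def linear_comp[of \<eta>0, OF lin(1)[OF x]] linear_comp[of \<eta>1, OF lin(2)[OF x]] linear_comp[of \<eta>2, OF lin(3)[OF x]]
    by algebra
  then show False using 0 u v w by simp
qed

text \<open>Cramer's rule. The explicit quotients inherit differentiability from the forms, which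
  dual vectors chosen pointwise would not provide.\<close>

definition cf0 :: "(R3 \<Rightarrow> R3 \<Rightarrow> real) \<Rightarrow> R3 \<Rightarrow> real" where
  "cf0 \<omega> x = triple \<omega> \<eta>1 \<eta>2 x / triple \<eta>0 \<eta>1 \<eta>2 x"
definition cf1 :: "(R3 \<Rightarrow> R3 \<Rightarrow> real) \<Rightarrow> R3 \<Rightarrow> real" where
  "cf1 \<omega> x = triple \<eta>0 \<omega> \<eta>2 x / triple \<eta>0 \<eta>1 \<eta>2 x"
definition cf2 :: "(R3 \<Rightarrow> R3 \<Rightarrow> real) \<Rightarrow> R3 \<Rightarrow> real" where
  "cf2 \<omega> x = triple \<eta>0 \<eta>1 \<omega> x / triple \<eta>0 \<eta>1 \<eta>2 x"

lemma cf_expand: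
  assumes x: "x \<in> U" and l: "linear (\<omega> x)"
  shows "\<omega> x u = cf0 \<omega> x * \<eta>0 x u + cf1 \<omega> x * \<eta>1 x u + cf2 \<omega> x * \<eta>2 x u"
proof -
  have "triple \<eta>0 \<eta>1 \<eta>2 x * \<omega> x u = triple \<omega> \<eta>1 \<eta>2 x * \<eta>0 x u + triple \<eta>0 \<omega> \<eta>2 x * \<eta>1 x u + triple \<eta>0 \<eta>1 \<omega> x * \<eta>2 x u"
    unfolding triple_def linear_comp[of \<eta>0, OF lin(1)[OF x]] linear_comp[of \<eta>1, OF lin(2)[OF x]] linear_comp[of \<eta>2, OF lin(3)[OF x]]
      linear_comp[of \<omega>, OF l] by algebra
  then show ?thesis using triple_nz[OF x] by (simp add: cf0_def cf1_def cf2_def field_simps)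
qed

lemma cf_differentiable:
  assumes x: "x \<in> U" and "\<And>u. (\<lambda>y. \<omega> y u) differentiable (at x)"
  shows "cf0 \<omega> differentiable (at x)" "cf1 \<omega> differentiable (at x)" "cf2 \<omega> differentiable (at x)"
  unfolding cf0_def[abs_def] cf1_def[abs_def] cf2_def[abs_def]
  by (intro differentiable_divide triple_differentiable triple_nz[OF x] diff[OF x] assms(2))+

text \<open>The shape operator in the frame \<open>T, e1, e2\<close> is the matrix
  \<open>[[A, B1, B2], [B1, a, b], [B2, b, d]]\<close>; the remaining entries follow from
  \<open>symm\<close>.\<close>

definition "A = cf0 \<kappa>"
definition "B1 = cf1 \<kappa>"
definition "B2 = cf2 \<kappa>"
definition "a = cf1 \<zeta>1"
definition "b = cf2 \<zeta>1"
definition "d = cf2 \<zeta>2"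

lemma coef_diff:
  assumes x: "x \<in> U"
  shows "A differentiable (at x)" "B1 differentiable (at x)" "B2 differentiable (at x)"
    "a differentiable (at x)" "b differentiable (at x)" "d differentiable (at x)"
  unfolding A_def B1_def B2_def a_def b_def d_def
  by (intro cf_differentiable[OF x] diff[OF x])+

lemma forms_eq:
  assumes x: "x \<in> U"
  shows "\<kappa> x u = A x * \<eta>0 x u + B1 x * \<eta>1 x u + B2 x * \<eta>2 x u"
    "\<zeta>1 x u = B1 x * \<eta>0 x u + a x * \<eta>1 x u + b x * \<eta>2 x u"
    "\<zeta>2 x u = B2 x * \<eta>0 x u + b x * \<eta>1 x u + d x * \<eta>2 x u"
proof -
  note k = cf_expand[of x \<kappa>, OF x lin(4)[OF x]]
    and z1 = cf_expand[of x \<zeta>1, OF x lin(5)[OF x]] and z2 = cf_expand[of x \<zeta>2, OF x lin(6)[OF x]]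
  obtain u0 where u0: "\<eta>0 x u0 = 1" "\<eta>1 x u0 = 0" "\<eta>2 x u0 = 0" by (rule dual_vector[OF x])
  obtain u1 where u1: "\<eta>0 x u1 = 0" "\<eta>1 x u1 = 1" "\<eta>2 x u1 = 0" by (rule dual_vector[OF x])
  obtain u2 where u2: "\<eta>0 x u2 = 0" "\<eta>1 x u2 = 0" "\<eta>2 x u2 = 1" by (rule dual_vector[OF x])
  have "cf0 \<zeta>1 x = cf1 \<kappa> x" "cf0 \<zeta>2 x = cf2 \<kappa> x" "cf1 \<zeta>2 x = cf2 \<zeta>1 x"
    using symm[OF x, of u0 u1] symm[OF x, of u0 u2] symm[OF x, of u1 u2] u0 u1 u2
      k[of u0] k[of u1] k[of u2] z1[of u0] z1[of u1] z1[of u2] z2[of u0] z2[of u1] z2[of u2]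
    by (simp_all add: wedge_def)
  then show "\<kappa> x u = A x * \<eta>0 x u + B1 x * \<eta>1 x u + B2 x * \<eta>2 x u"
    "\<zeta>1 x u = B1 x * \<eta>0 x u + a x * \<eta>1 x u + b x * \<eta>2 x u"
    "\<zeta>2 x u = B2 x * \<eta>0 x u + b x * \<eta>1 x u + d x * \<eta>2 x u"
    using k[of u] z1[of u] z2[of u] by (simp_all add: A_def B1_def B2_def a_def b_def d_def)
qed

lemma dcs2: "x \<in> U \<Longrightarrow> dird (\<lambda>y. c y * s y) x v = ((c x)\<^sup>2 - (s x)\<^sup>2) * \<kappa> x v"
  by (simp add: dird_mult cs_diff dc ds power2_eq_square algebra_simps)

text \<open>A constant \<open>(c s)\<^sup>2\<close> with \<kappa> nonzero forces
  \<open>c\<^sup>2 = s\<^sup>2\<close> on the whole region, but the derivative of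
  \<open>c\<^sup>2 - s\<^sup>2\<close> is \<open>- 4 c s \<kappa>\<close>.\<close>

lemma cs_not_const:
  assumes ne: "U \<noteq> {}" and k: "\<And>x. x \<in> U \<Longrightarrow> \<exists>u. \<kappa> x u \<noteq> 0"
    and const: "\<And>x. x \<in> U \<Longrightarrow> (c x * s x)\<^sup>2 = C"
  shows False
proof -
  have 1: "(c x)\<^sup>2 - (s x)\<^sup>2 = 0" if x: "x \<in> U" for x
  proof -
    obtain u where u: "\<kappa> x u \<noteq> 0" using k[OF x] by blast
    have "dird (\<lambda>y. (c y * s y)\<^sup>2) x u = 0" by (rule dird_eq_0_of_zero_on[OF open_U x const])
    moreover have "(\<lambda>y. c y * s y) differentiable (at x)" by (intro differentiable_mult cs_diff x)
    ultimately have "2 * (c x * s x) * (((c x)\<^sup>2 - (s x)\<^sup>2) * \<kappa> x u) = 0"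
      by (simp add: dird_power2 dcs2[OF x])
    then show ?thesis using u cs_pos[OF x] by simp
  qed
  obtain x where x: "x \<in> U" using ne by blast
  obtain u where u: "\<kappa> x u \<noteq> 0" using k[OF x] by blast
  have "dird (\<lambda>y. (c y)\<^sup>2 - (s y)\<^sup>2) x u = 0" by (rule dird_eq_0_of_zero_on[OF open_U x 1])
  then have "2 * c x * (- s x * \<kappa> x u) - 2 * s x * (c x * \<kappa> x u) = 0"
    using x cs_diff[OF x] by (simp add: dird_diff dird_power2 dc ds differentiable_power)
  then have "c x * s x * \<kappa> x u = 0" by (simp add: algebra_simps)
  then show False using u cs_pos[OF x] by simp
qed

end

section \<open>The field V oblique to the principal directions\<close>

locale rotated = structure_eqs +
  fixes X Y :: "R3 \<Rightarrow> real"
  assumes XY_diff: "x \<in> U \<Longrightarrow> X differentiable (at x)" "x \<in> U \<Longrightarrow> Y differentiable (at x)"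
    and XY_1: "x \<in> U \<Longrightarrow> (X x)\<^sup>2 + (Y x)\<^sup>2 = 1"
begin

definition "\<eta>3 x u = X x * \<eta>1 x u + Y x * \<eta>2 x u"
definition "\<eta>4 x u = - Y x * \<eta>1 x u + X x * \<eta>2 x u"
definition "\<zeta>3 x u = X x * \<zeta>1 x u + Y x * \<zeta>2 x u"
definition "\<zeta>4 x u = - Y x * \<zeta>1 x u + X x * \<zeta>2 x u"
text \<open>The differential of the rotation angle, written without choosing an angle.\<close>

definition "f x v = X x * dird Y x v - Y x * dird X x v"
definition "t x = s x / c x"
definition "t' x = c x / s x"
text \<open>The matrix of \<open>diag (- t, t')\<close> in the frame rotated by \<open>(X, Y)\<close> is \<open>[[p, q], [q, w]]\<close>, that of
  \<open>diag (1, - 1)\<close> is \<open>[[e, - g], [- g, - e]]\<close>.\<close>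

definition "p x = - t x * (X x)\<^sup>2 + t' x * (Y x)\<^sup>2"
definition "q x = X x * Y x * (t x + t' x)"
definition "w x = - t x * (Y x)\<^sup>2 + t' x * (X x)\<^sup>2"
definition "e x = (X x)\<^sup>2 - (Y x)\<^sup>2"
definition "g x = 2 * X x * Y x"

lemma dXY0: assumes x: "x \<in> U" shows "X x * dird X x v + Y x * dird Y x v = 0"
proof -
  have "dird (\<lambda>y. (X y)\<^sup>2 + (Y y)\<^sup>2) x v = 0"
    by (rule dird_eq_0_of_zero_on[OF open_U x XY_1])
  then show ?thesis using XY_diff[OF x] by (simp add: dird_add dird_power2)
qed

lemma dXY:
  assumes x: "x \<in> U"
  shows "dird X x v = - Y x * f x v" "dird Y x v = X x * f x v"
  using dXY0[OF x, of v] XY_1[OF x] unfolding f_def by algebra+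

lemma unrotate:
  assumes x: "x \<in> U"
  shows "\<eta>1 x u = X x * \<eta>3 x u - Y x * \<eta>4 x u" "\<eta>2 x u = Y x * \<eta>3 x u + X x * \<eta>4 x u"
    "\<zeta>1 x u = X x * \<zeta>3 x u - Y x * \<zeta>4 x u" "\<zeta>2 x u = Y x * \<zeta>3 x u + X x * \<zeta>4 x u"
  using XY_1[OF x] unfolding \<eta>3_def \<eta>4_def \<zeta>3_def \<zeta>4_def by algebra+

lemma rot_diff:
  assumes x: "x \<in> U"
  shows "(\<lambda>y. \<eta>3 y u) differentiable (at x)" "(\<lambda>y. \<eta>4 y u) differentiable (at x)"
    "(\<lambda>y. \<zeta>3 y u) differentiable (at x)" "(\<lambda>y. \<zeta>4 y u) differentiable (at x)"
  unfolding \<eta>3_def \<eta>4_def \<zeta>3_def \<zeta>4_def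
  by (intro differentiable_add differentiable_mult differentiable_minus XY_diff diff x)+

lemma ext_rot:
  assumes x: "x \<in> U" and "F differentiable (at x)" "G differentiable (at x)"
    "\<And>u. (\<lambda>y. \<omega> y u) differentiable (at x)" "\<And>u. (\<lambda>y. \<rho> y u) differentiable (at x)"
    and eq: "\<And>y u. y \<in> U \<Longrightarrow> \<tau> y u = F y * \<omega> y u + G y * \<rho> y u"
  shows "ext \<tau> x v u = (dird F x v * \<omega> x u - dird F x u * \<omega> x v + F x * ext \<omega> x v u)
     + (dird G x v * \<rho> x u - dird G x u * \<rho> x v + G x * ext \<rho> x v u)"
proof -
  have "ext \<tau> x v u = ext (\<lambda>y u. F y * \<omega> y u + G y * \<rho> y u) x v u"
    by (rule ext_cong_open[OF open_U x eq])
  also have "\<dots> = ext (\<lambda>y u. F y * \<omega> y u) x v u + ext (\<lambda>y u. G y * \<rho> y u) x v u"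
    by (rule ext_add) (intro differentiable_mult assms(2-5))+
  finally show ?thesis using assms by (simp add: ext_scale)
qed

lemma ext_\<eta>3:
  assumes x: "x \<in> U"
  shows "ext \<eta>3 x v u = f x v * \<eta>4 x u - f x u * \<eta>4 x v
    + (\<eta>0 x v * (p x * \<zeta>3 x u + q x * \<zeta>4 x u) - \<eta>0 x u * (p x * \<zeta>3 x v + q x * \<zeta>4 x v))"
proof -
  have "ext \<eta>3 x v u = (dird X x v * \<eta>1 x u - dird X x u * \<eta>1 x v + X x * ext \<eta>1 x v u)
     + (dird Y x v * \<eta>2 x u - dird Y x u * \<eta>2 x v + Y x * ext \<eta>2 x v u)"
    by (rule ext_rot) (auto intro: XY_diff diff x simp: \<eta>3_def)
  then show ?thesis
    unfolding dXY[OF x] ext_\<eta>1[OF x] ext_\<eta>2[OF x] wedge_def unrotate(3,4)[OF x] t_def[symmetric] t'_def[symmetric]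
      p_def q_def \<eta>4_def by (simp add: algebra_simps power2_eq_square)
qed

lemma ext_\<eta>4:
  assumes x: "x \<in> U"
  shows "ext \<eta>4 x v u = - (f x v * \<eta>3 x u - f x u * \<eta>3 x v)
    + (\<eta>0 x v * (q x * \<zeta>3 x u + w x * \<zeta>4 x u) - \<eta>0 x u * (q x * \<zeta>3 x v + w x * \<zeta>4 x v))"
proof -
  have "ext \<eta>4 x v u = (dird (\<lambda>y. - Y y) x v * \<eta>1 x u - dird (\<lambda>y. - Y y) x u * \<eta>1 x v + - Y x * ext \<eta>1 x v u)
     + (dird X x v * \<eta>2 x u - dird X x u * \<eta>2 x v + X x * ext \<eta>2 x v u)"
    by (rule ext_rot) (auto intro: XY_diff diff x differentiable_minus simp: \<eta>4_def)
  then show ?thesis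
    unfolding dird_minus[OF XY_diff(2)[OF x]] dXY[OF x] ext_\<eta>1[OF x] ext_\<eta>2[OF x] wedge_def unrotate(3,4)[OF x] t_def[symmetric] t'_def[symmetric]
      w_def q_def \<eta>3_def by (simp add: algebra_simps power2_eq_square)
qed

lemma ext_\<zeta>3:
  assumes x: "x \<in> U"
  shows "ext \<zeta>3 x v u = f x v * \<zeta>4 x u - f x u * \<zeta>4 x v
    + (\<kappa> x v * (p x * \<zeta>3 x u + q x * \<zeta>4 x u) - \<kappa> x u * (p x * \<zeta>3 x v + q x * \<zeta>4 x v))
    + c x * s x * (\<eta>0 x v * (- e x * \<eta>3 x u + g x * \<eta>4 x u) - \<eta>0 x u * (- e x * \<eta>3 x v + g x * \<eta>4 x v))"
proof -
  have "ext \<zeta>3 x v u = (dird X x v * \<zeta>1 x u - dird X x u * \<zeta>1 x v + X x * ext \<zeta>1 x v u)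
     + (dird Y x v * \<zeta>2 x u - dird Y x u * \<zeta>2 x v + Y x * ext \<zeta>2 x v u)"
    by (rule ext_rot) (auto intro: XY_diff diff x simp: \<zeta>3_def)
  also have "\<dots> = f x v * \<zeta>4 x u - f x u * \<zeta>4 x v + (X x * ext \<zeta>1 x v u + Y x * ext \<zeta>2 x v u)"
    unfolding dXY[OF x] \<zeta>4_def by (simp add: algebra_simps)
  also have "X x * ext \<zeta>1 x v u + Y x * ext \<zeta>2 x v u =
    (\<kappa> x v * (p x * \<zeta>3 x u + q x * \<zeta>4 x u) - \<kappa> x u * (p x * \<zeta>3 x v + q x * \<zeta>4 x v))
    + c x * s x * (\<eta>0 x v * (- e x * \<eta>3 x u + g x * \<eta>4 x u) - \<eta>0 x u * (- e x * \<eta>3 x v + g x * \<eta>4 x v))"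
    unfolding ext_\<zeta>1[OF x] ext_\<zeta>2[OF x] wedge_def unrotate[OF x] t_def[symmetric] t'_def[symmetric]
      p_def q_def e_def g_def by (simp add: algebra_simps power2_eq_square)
  finally show ?thesis by simp
qed

lemma ext_\<zeta>4:
  assumes x: "x \<in> U"
  shows "ext \<zeta>4 x v u = - (f x v * \<zeta>3 x u - f x u * \<zeta>3 x v)
    + (\<kappa> x v * (q x * \<zeta>3 x u + w x * \<zeta>4 x u) - \<kappa> x u * (q x * \<zeta>3 x v + w x * \<zeta>4 x v))
    + c x * s x * (\<eta>0 x v * (g x * \<eta>3 x u + e x * \<eta>4 x u) - \<eta>0 x u * (g x * \<eta>3 x v + e x * \<eta>4 x v))"
proof -
  have "ext \<zeta>4 x v u = (dird (\<lambda>y. - Y y) x v * \<zeta>1 x u - dird (\<lambda>y. - Y y) x u * \<zeta>1 x v + - Y x * ext \<zeta>1 x v u)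
     + (dird X x v * \<zeta>2 x u - dird X x u * \<zeta>2 x v + X x * ext \<zeta>2 x v u)"
    by (rule ext_rot) (auto intro: XY_diff diff x differentiable_minus simp: \<zeta>4_def)
  also have "\<dots> = - (f x v * \<zeta>3 x u - f x u * \<zeta>3 x v) + (- Y x * ext \<zeta>1 x v u + X x * ext \<zeta>2 x v u)"
    unfolding dird_minus[OF XY_diff(2)[OF x]] dXY[OF x] \<zeta>3_def by (simp add: algebra_simps)
  also have "- Y x * ext \<zeta>1 x v u + X x * ext \<zeta>2 x v u =
    (\<kappa> x v * (q x * \<zeta>3 x u + w x * \<zeta>4 x u) - \<kappa> x u * (q x * \<zeta>3 x v + w x * \<zeta>4 x v))
    + c x * s x * (\<eta>0 x v * (g x * \<eta>3 x u + e x * \<eta>4 x u) - \<eta>0 x u * (g x * \<eta>3 x v + e x * \<eta>4 x v))"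
    unfolding ext_\<zeta>1[OF x] ext_\<zeta>2[OF x] wedge_def unrotate[OF x] t_def[symmetric] t'_def[symmetric]
      w_def q_def e_def g_def by (simp add: algebra_simps power2_eq_square)
  finally show ?thesis by simp
qed

lemma ext_\<eta>0':
  assumes x: "x \<in> U"
  shows "ext \<eta>0 x v u = p x * wedge \<zeta>3 \<eta>3 x v u + q x * (wedge \<zeta>3 \<eta>4 x v u + wedge \<zeta>4 \<eta>3 x v u) + w x * wedge \<zeta>4 \<eta>4 x v u"
  unfolding ext_\<eta>0[OF x] wedge_def unrotate[OF x] t_def[symmetric] t'_def[symmetric] p_def q_def w_def
  by (simp add: algebra_simps power2_eq_square)

lemma dual_rot:
  assumes x: "x \<in> U"
  obtains u where "\<eta>0 x u = i" "\<eta>3 x u = j" "\<eta>4 x u = k"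
proof -
  obtain u where u: "\<eta>0 x u = i" "\<eta>1 x u = X x * j - Y x * k" "\<eta>2 x u = Y x * j + X x * k"
    by (rule dual_vector[OF x])
  have "\<eta>3 x u = j" "\<eta>4 x u = k" using XY_1[OF x] unfolding \<eta>3_def \<eta>4_def u by algebra+
  then show ?thesis using that u by blast
qed

end

text \<open>Here \<open>\<eta>3\<close> is dual to a principal direction orthogonal to \<open>T\<close>, with curvature \<open>l\<close>; the
  other two principal curvatures, with sum \<open>S\<close> and product \<open>R\<close>, belong to directions oblique to \<open>T\<close>.\<close>

locale oblique = rotated +
  fixes \<alpha> \<beta> :: "R3 \<Rightarrow> real" and S l R :: real
  assumes ne: "U \<noteq> {}"
    and \<alpha>_diff: "x \<in> U \<Longrightarrow> \<alpha> differentiable (at x)" and \<beta>_diff: "x \<in> U \<Longrightarrow> \<beta> differentiable (at x)"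
    and \<beta>_nz: "x \<in> U \<Longrightarrow> \<beta> x \<noteq> 0"
    and \<beta>_sq: "x \<in> U \<Longrightarrow> (\<beta> x)\<^sup>2 = \<alpha> x * (S - \<alpha> x) - R"
    and \<kappa>_eq: "x \<in> U \<Longrightarrow> \<kappa> x u = \<alpha> x * \<eta>0 x u + \<beta> x * \<eta>4 x u"
    and \<zeta>3_eq: "x \<in> U \<Longrightarrow> \<zeta>3 x u = l * \<eta>3 x u"
    and \<zeta>4_eq: "x \<in> U \<Longrightarrow> \<zeta>4 x u = \<beta> x * \<eta>0 x u + (S - \<alpha> x) * \<eta>4 x u"

lemma oblique_subset:
  assumes "oblique U c s e0 e1 e2 k z1 z2 X Y \<alpha> \<beta> S l R" "open V" "V \<subseteq> U" "V \<noteq> {}"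
  shows "oblique V c s e0 e1 e2 k z1 z2 X Y \<alpha> \<beta> S l R"
proof -
  interpret O: oblique U c s e0 e1 e2 k z1 z2 X Y \<alpha> \<beta> S l R by fact
  have V: "x \<in> V \<Longrightarrow> x \<in> U" for x using assms(3) by blast
  interpret W: structure_eqs V c s e0 e1 e2 k z1 z2
    by (rule structure_eqs_subset[OF O.structure_eqs_axioms assms(2,3)])
  interpret W: rotated V c s e0 e1 e2 k z1 z2 X Y
    by unfold_locales (auto intro: O.XY_diff O.XY_1 V)
  show ?thesis
    by unfold_locales (rule assms(4) O.\<alpha>_diff[OF V] O.\<beta>_diff[OF V] O.\<beta>_nz[OF V] O.\<beta>_sq[OF V] O.\<kappa>_eq[OF V]
      O.\<zeta>3_eq[OF V] O.\<zeta>4_eq[OF V]; assumption)+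
qed

context oblique
begin

lemma d\<beta>: assumes x: "x \<in> U" shows "2 * \<beta> x * dird \<beta> x v = (S - 2 * \<alpha> x) * dird \<alpha> x v"
proof -
  have "dird (\<lambda>y. (\<beta> y)\<^sup>2) x v = dird (\<lambda>y. \<alpha> y * (S - \<alpha> y) - R) x v"
    by (rule dird_cong_open[OF open_U x \<beta>_sq])
  also have "\<dots> = dird \<alpha> x v * (S - \<alpha> x) + \<alpha> x * - dird \<alpha> x v"
    using \<alpha>_diff[OF x] by (subst dird_diff, auto intro!: differentiable_mult differentiable_diff)
      (subst dird_mult, auto intro!: differentiable_diff simp: dird_diff)
  finally show ?thesis using \<beta>_diff[OF x]
    by (simp add: dird_power2 algebra_simps)
qed

text \<open>Each row of the shape operator has two exterior derivatives: one from its expansion in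
  the coframe, one from the structure equations. Comparing them on pairs of dual vectors gives three
  equations from \<zeta>3, two from \<zeta>4 and three from \<kappa>.\<close>

lemma codazzi:
  assumes x: "x \<in> U"
    and u0: "\<eta>0 x u0 = 1" "\<eta>3 x u0 = 0" "\<eta>4 x u0 = 0"
    and u3: "\<eta>0 x u3 = 0" "\<eta>3 x u3 = 1" "\<eta>4 x u3 = 0"
    and u4: "\<eta>0 x u4 = 0" "\<eta>3 x u4 = 0" "\<eta>4 x u4 = 1"
  shows "\<beta> x * f x u3 = \<alpha> x * l * p x - l * l * p x - c x * s x * e x"
    "(l - (S - \<alpha> x)) * f x u3 = - \<beta> x * l * p x"
    "l * (q x * (S - \<alpha> x) + f x u0) - f x u0 * (S - \<alpha> x) + f x u4 * \<beta> x
      = \<alpha> x * q x * (S - \<alpha> x) - q x * (\<beta> x)\<^sup>2 + c x * s x * g x"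
    "- dird \<beta> x u4 + w x * (\<beta> x)\<^sup>2 - dird \<alpha> x u0 + w x * (S - \<alpha> x)\<^sup>2
      = \<alpha> x * w x * (S - \<alpha> x) - w x * (\<beta> x)\<^sup>2 + c x * s x * e x"
    "- dird \<alpha> x u3 = (l - (S - \<alpha> x)) * f x u4 - \<beta> x * q x * (2 * l - (S - \<alpha> x))"
    "dird \<alpha> x u3 = \<beta> x * (\<alpha> x * q x + l * q x - f x u0)"
    "dird \<alpha> x u4 = dird \<beta> x u0 + \<beta> x * w x * S"
    "dird \<beta> x u3 = - \<alpha> x * q x * (l - (S - \<alpha> x)) - \<beta> x * f x u4"
proof -
  note \<delta>_diff = differentiable_diff[OF differentiable_const \<alpha>_diff[OF x]]
  have d\<delta>: "dird (\<lambda>y. S - \<alpha> y) x v = - dird \<alpha> x v" for v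
    using dird_diff[OF differentiable_const \<alpha>_diff[OF x]] by simp
  have E\<kappa>: "0 = (dird \<alpha> x v * \<eta>0 x u - dird \<alpha> x u * \<eta>0 x v + \<alpha> x * ext \<eta>0 x v u)
     + (dird \<beta> x v * \<eta>4 x u - dird \<beta> x u * \<eta>4 x v + \<beta> x * ext \<eta>4 x v u)" for v u
    unfolding ext_\<kappa>[OF x, of v u, symmetric]
    by (rule ext_rot[OF x]) (auto intro: \<alpha>_diff \<beta>_diff diff rot_diff x simp: \<kappa>_eq)
  \<comment> \<open>\<open>ext_rot\<close> expects two summands; the second one gets the coefficient
    zero.\<close>
  have E\<zeta>3: "ext \<zeta>3 x v u = (dird (\<lambda>y. l) x v * \<eta>3 x u - dird (\<lambda>y. l) x u * \<eta>3 x v + l * ext \<eta>3 x v u)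
     + (dird (\<lambda>y. 0) x v * \<eta>3 x u - dird (\<lambda>y. 0) x u * \<eta>3 x v + 0 * ext \<eta>3 x v u)" for v u
    by (rule ext_rot[OF x]) (auto intro: rot_diff x simp: \<zeta>3_eq)
  have E\<zeta>4: "ext \<zeta>4 x v u = (dird \<beta> x v * \<eta>0 x u - dird \<beta> x u * \<eta>0 x v + \<beta> x * ext \<eta>0 x v u)
     + (dird (\<lambda>y. S - \<alpha> y) x v * \<eta>4 x u - dird (\<lambda>y. S - \<alpha> y) x u * \<eta>4 x v + (S - \<alpha> x) * ext \<eta>4 x v u)" for v u
    by (rule ext_rot[OF x]) (auto intro: \<delta>_diff \<beta>_diff diff rot_diff x simp: \<zeta>4_eq)
  note ev = ext_\<eta>0'[OF x] ext_\<eta>3[OF x] ext_\<eta>4[OF x] ext_\<zeta>3[OF x] ext_\<zeta>4[OF x] wedge_def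
    \<kappa>_eq[OF x] \<zeta>3_eq[OF x] \<zeta>4_eq[OF x] u0 u3 u4 d\<delta>
  show "\<beta> x * f x u3 = \<alpha> x * l * p x - l * l * p x - c x * s x * e x"
    using E\<zeta>3[of u0 u3] unfolding ev by (simp add: algebra_simps)
  show "(l - (S - \<alpha> x)) * f x u3 = - \<beta> x * l * p x"
    using E\<zeta>3[of u3 u4] unfolding ev by (simp add: algebra_simps)
  show "l * (q x * (S - \<alpha> x) + f x u0) - f x u0 * (S - \<alpha> x) + f x u4 * \<beta> x
      = \<alpha> x * q x * (S - \<alpha> x) - q x * (\<beta> x)\<^sup>2 + c x * s x * g x"
    using E\<zeta>3[of u0 u4] unfolding ev by (simp add: algebra_simps power2_eq_square)
  show "- dird \<beta> x u4 + w x * (\<beta> x)\<^sup>2 - dird \<alpha> x u0 + w x * (S - \<alpha> x)\<^sup>2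
      = \<alpha> x * w x * (S - \<alpha> x) - w x * (\<beta> x)\<^sup>2 + c x * s x * e x"
    using E\<zeta>4[of u0 u4] unfolding ev by (simp add: algebra_simps power2_eq_square)
  show "- dird \<alpha> x u3 = (l - (S - \<alpha> x)) * f x u4 - \<beta> x * q x * (2 * l - (S - \<alpha> x))"
    using E\<zeta>4[of u3 u4] unfolding ev by (simp add: algebra_simps)
  show "dird \<alpha> x u3 = \<beta> x * (\<alpha> x * q x + l * q x - f x u0)"
    using E\<kappa>[of u0 u3] unfolding ev by (simp add: algebra_simps)
  show "dird \<alpha> x u4 = dird \<beta> x u0 + \<beta> x * w x * S"
    using E\<kappa>[of u0 u4] unfolding ev by (simp add: algebra_simps)
  show "dird \<beta> x u3 = - \<alpha> x * q x * (l - (S - \<alpha> x)) - \<beta> x * f x u4"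
    using E\<kappa>[of u3 u4] unfolding ev by (simp add: algebra_simps)
qed

lemma no_const: "(\<And>x. x \<in> U \<Longrightarrow> (c x * s x)\<^sup>2 = C) \<Longrightarrow> False"
proof (rule cs_not_const[OF ne])
  fix x assume x: "x \<in> U"
  obtain u where "\<eta>0 x u = 0" "\<eta>3 x u = 0" "\<eta>4 x u = 1" by (rule dual_rot[OF x])
  then show "\<exists>u. \<kappa> x u \<noteq> 0" using \<kappa>_eq[OF x, of u] \<beta>_nz[OF x] by (intro exI[of _ u]) simp
qed

lemma csq:
  assumes x: "x \<in> U"
  shows "c x * s x * q x = X x * Y x"
proof -
  have "q x = X x * Y x * (((c x)\<^sup>2 + (s x)\<^sup>2) / (c x * s x))"
    using cs_pos[OF x] by (simp add: q_def t_def t'_def field_simps power2_eq_square)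
  then show ?thesis using cs_1[OF x] cs_pos[OF x] by simp
qed

lemma csg:
  assumes x: "x \<in> U"
  shows "c x * s x * g x = 2 * (c x * s x)\<^sup>2 * q x"
proof -
  have "2 * (c x * s x)\<^sup>2 * q x = 2 * (c x * s x) * (c x * s x * q x)" by (simp add: power2_eq_square)
  then show ?thesis unfolding csq[OF x] by (simp add: g_def)
qed

lemma q_nz: "x \<in> U \<Longrightarrow> X x * Y x \<noteq> 0 \<Longrightarrow> q x \<noteq> 0"
  using csq by fastforce

text \<open>If \<open>X Y\<close> vanished identically, the rotated frame would be aligned with
  \<open>e1, e2\<close> and would not turn, so \<open>f = 0\<close>. The first two Codazzi equations
  then give \<open>c s e = 0\<close>, although \<open>e\<close> is 1 or -1.\<close>

lemma XY_not_zero: "\<exists>x\<in>U. X x * Y x \<noteq> 0"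
proof (rule ccontr)
  assume "\<not> (\<exists>x\<in>U. X x * Y x \<noteq> 0)"
  then have 0: "X x * Y x = 0" if "x \<in> U" for x using that by blast
  obtain x where x: "x \<in> U" using ne by blast
  have e: "e x * e x = 1"
  proof -
    have "e x * e x = ((X x)\<^sup>2 + (Y x)\<^sup>2)\<^sup>2 - 4 * (X x * Y x)\<^sup>2"
      unfolding e_def by algebra
    then show ?thesis using 0[OF x] XY_1[OF x] by simp
  qed
  have f: "f x v = 0" for v
  proof -
    have "dird (\<lambda>y. X y * Y y) x v = 0" by (rule dird_eq_0_of_zero_on[OF open_U x 0])
    then have "dird X x v * Y x + X x * dird Y x v = 0" by (simp add: dird_mult XY_diff[OF x])
    then have "f x v * e x = 0" unfolding dXY[OF x] e_def by algebra
    then show ?thesis using e by auto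
  qed
  obtain u0 where u0: "\<eta>0 x u0 = 1" "\<eta>3 x u0 = 0" "\<eta>4 x u0 = 0" by (rule dual_rot[OF x])
  obtain u3 where u3: "\<eta>0 x u3 = 0" "\<eta>3 x u3 = 1" "\<eta>4 x u3 = 0" by (rule dual_rot[OF x])
  obtain u4 where u4: "\<eta>0 x u4 = 0" "\<eta>3 x u4 = 0" "\<eta>4 x u4 = 1" by (rule dual_rot[OF x])
  note cod = codazzi[OF x u0 u3 u4]
  have "l * p x = 0" using cod(2) \<beta>_nz[OF x] f by simp
  then have "c x * s x * e x = 0" using cod(1) f by (auto simp: algebra_simps)
  then show False using e cs_pos[OF x] by simp
qed

lemma R_impossible:
  assumes "\<And>x. x \<in> U \<Longrightarrow> q x * (R + 2 * (c x * s x)\<^sup>2) = 0" "\<And>x. x \<in> U \<Longrightarrow> q x \<noteq> 0"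
  shows False
  by (rule no_const[of "- R / 2"]) (use assms in fastforce)

text \<open>\<open>e = 0\<close> fixes the rotation angle, hence \<open>f = 0\<close>. The third
  Codazzi equation with \<beta> eliminated then makes \<open>(c s)\<^sup>2\<close> constant.\<close>

lemma l_zero_e_zero:
  assumes l: "l = 0" and q: "\<And>x. x \<in> U \<Longrightarrow> q x \<noteq> 0" and XY: "\<And>x. x \<in> U \<Longrightarrow> X x * Y x \<noteq> 0"
    and e: "\<And>x. x \<in> U \<Longrightarrow> e x = 0"
  shows False
proof (rule R_impossible[OF _ q])
  fix x assume x: "x \<in> U"
  have f: "f x v = 0" for v
  proof -
    have "dird e x v = 0" by (rule dird_eq_0_of_zero_on[OF open_U x e])
    moreover have "dird e x v = 2 * X x * dird X x v - 2 * Y x * dird Y x v"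
      unfolding e_def[abs_def] using XY_diff[OF x] by (simp add: dird_diff dird_power2 differentiable_power)
    ultimately have "X x * Y x * f x v = 0" unfolding dXY[OF x] by algebra
    then show ?thesis using XY[OF x] by simp
  qed
  obtain u0 where u0: "\<eta>0 x u0 = 1" "\<eta>3 x u0 = 0" "\<eta>4 x u0 = 0" by (rule dual_rot[OF x])
  obtain u3 where u3: "\<eta>0 x u3 = 0" "\<eta>3 x u3 = 1" "\<eta>4 x u3 = 0" by (rule dual_rot[OF x])
  obtain u4 where u4: "\<eta>0 x u4 = 0" "\<eta>3 x u4 = 0" "\<eta>4 x u4 = 1" by (rule dual_rot[OF x])
  note cod = codazzi[OF x u0 u3 u4]
  show "q x * (R + 2 * (c x * s x)\<^sup>2) = 0"
    using cod(3) \<beta>_sq[OF x] unfolding csg[OF x] f l by algebra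
qed

text \<open>The first two Codazzi equations force \<open>\<alpha> = S\<close>, so \<alpha> and
  \<beta> are constant. The others then give \<open>S = 0\<close> and a frame that does not turn
  along \<open>u0\<close> and \<open>u4\<close>, and the third equation again makes
  \<open>(c s)\<^sup>2\<close> constant.\<close>

lemma l_zero_e_nonzero:
  assumes l: "l = 0" and q: "\<And>x. x \<in> U \<Longrightarrow> q x \<noteq> 0" and e: "\<And>x. x \<in> U \<Longrightarrow> e x \<noteq> 0"
  shows False
proof (rule R_impossible[OF _ q])
  have \<alpha>S: "\<alpha> x = S" if x: "x \<in> U" for x
  proof -
    obtain u0 where u0: "\<eta>0 x u0 = 1" "\<eta>3 x u0 = 0" "\<eta>4 x u0 = 0" by (rule dual_rot[OF x])
    obtain u3 where u3: "\<eta>0 x u3 = 0" "\<eta>3 x u3 = 1" "\<eta>4 x u3 = 0" by (rule dual_rot[OF x])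
    obtain u4 where u4: "\<eta>0 x u4 = 0" "\<eta>3 x u4 = 0" "\<eta>4 x u4 = 1" by (rule dual_rot[OF x])
    note cod = codazzi[OF x u0 u3 u4]
    have "f x u3 \<noteq> 0" using cod(1) l e[OF x] cs_pos[OF x] by auto
    then show ?thesis using cod(2) l by simp
  qed
  fix x assume x: "x \<in> U"
  obtain u0 where u0: "\<eta>0 x u0 = 1" "\<eta>3 x u0 = 0" "\<eta>4 x u0 = 0" by (rule dual_rot[OF x])
  obtain u3 where u3: "\<eta>0 x u3 = 0" "\<eta>3 x u3 = 1" "\<eta>4 x u3 = 0" by (rule dual_rot[OF x])
  obtain u4 where u4: "\<eta>0 x u4 = 0" "\<eta>3 x u4 = 0" "\<eta>4 x u4 = 1" by (rule dual_rot[OF x])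
  note cod = codazzi[OF x u0 u3 u4]
  have d\<alpha>: "dird \<alpha> x v = 0" for v by (rule dird_eq_0_of_zero_on[OF open_U x \<alpha>S])
  have d\<beta>0: "dird \<beta> x v = 0" for v using d\<beta>[OF x, of v] \<beta>_nz[OF x] by (simp add: d\<alpha>)
  have "2 * w x * (\<beta> x)\<^sup>2 = c x * s x * e x" using cod(4) by (simp add: d\<alpha> d\<beta>0 \<alpha>S[OF x] mult_ac)
  then have w: "w x \<noteq> 0" using e[OF x] cs_pos[OF x] by auto
  then have S: "S = 0" using cod(7) \<beta>_nz[OF x] by (simp add: d\<alpha> d\<beta>0)
  have "f x u0 = 0" using cod(6) \<beta>_nz[OF x] by (simp add: d\<alpha> \<alpha>S[OF x] S l)
  moreover have "f x u4 = 0" using cod(8) \<beta>_nz[OF x] by (simp add: d\<beta>0 \<alpha>S[OF x] S)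
  ultimately show "q x * (R + 2 * (c x * s x)\<^sup>2) = 0"
    using cod(3) \<beta>_sq[OF x] unfolding csg[OF x] l \<alpha>S[OF x] S by algebra
qed

text \<open>With \<open>R = 0\<close> the two oblique curvatures are 0 and \<open>S\<close>. The
  rotation rates \<open>f0\<close> and \<open>f4\<close> satisfy three linear equations, and
  \<open>rel\<close> is their compatibility condition.\<close>

lemma l_nonzero:
  assumes l: "l \<noteq> 0" and R: "R = 0" and S: "S \<noteq> 0" "l \<noteq> S" and q: "\<And>x. x \<in> U \<Longrightarrow> q x \<noteq> 0"
  shows False
proof -
  have rel: "(l - S) * S * l\<^sup>2 = 2 * (c x * s x)\<^sup>2 * (S * (l - S) - \<alpha> x * (2 * l - S))" if x: "x \<in> U" for x
  proof -
    obtain u0 where u0: "\<eta>0 x u0 = 1" "\<eta>3 x u0 = 0" "\<eta>4 x u0 = 0" by (rule dual_rot[OF x])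
    obtain u3 where u3: "\<eta>0 x u3 = 0" "\<eta>3 x u3 = 1" "\<eta>4 x u3 = 0" by (rule dual_rot[OF x])
    obtain u4 where u4: "\<eta>0 x u4 = 0" "\<eta>3 x u4 = 0" "\<eta>4 x u4 = 1" by (rule dual_rot[OF x])
    note cod = codazzi[OF x u0 u3 u4]
    define \<mu> where "\<mu> = l - (S - \<alpha> x)"
    define z where "z = (c x * s x)\<^sup>2"
    define f0 where "f0 = f x u0"
    define f4 where "f4 = f x u4"
    have b2: "(\<beta> x)\<^sup>2 = \<alpha> x * (S - \<alpha> x)" using \<beta>_sq[OF x] R by simp
    have 1: "\<beta> x * f0 - \<mu> * f4 = \<beta> x * q x * (S - l)"
      using cod(5,6) unfolding \<mu>_def f0_def f4_def by algebra
    have 2: "\<mu> * f0 + \<beta> x * f4 = - q x * l * (S - \<alpha> x) + 2 * z * q x"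
      using cod(3) b2 unfolding csg[OF x] \<mu>_def f0_def f4_def z_def by algebra
    \<comment> \<open>The third equation comes from differentiating the constraint between \<alpha>
      and \<beta> along \<open>u3\<close> and inserting the Codazzi values of both
      derivatives.\<close>
    have "\<beta> x * ((S - 2 * \<alpha> x) * f0 - 2 * \<beta> x * f4) = \<beta> x * (q x * S * (l - \<alpha> x))"
      using d\<beta>[OF x, of u3] unfolding cod(8) unfolding cod(6) \<mu>_def f0_def f4_def by algebra
    then have 3: "(S - 2 * \<alpha> x) * f0 - 2 * \<beta> x * f4 = q x * S * (l - \<alpha> x)" using \<beta>_nz[OF x] by simp
    \<comment> \<open>\<open>D\<close> equals \<open>\<mu>\<^sup>2 + (\<beta> x)\<^sup>2\<close>,
      the determinant of equations 1 and 2 in \<open>f0\<close> and \<open>f4\<close>;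
      \<open>G\<close> is the multiplier of equation 2 in the elimination.\<close>
    define D where "D = (l - S)\<^sup>2 + \<alpha> x * (2 * l - S)"
    define G where "G = S * (l - S) - \<alpha> x * (2 * l - S)"
    have "D * ((S - 2 * \<alpha> x) * f0 - 2 * \<beta> x * f4) = \<beta> x * (2 * l - S) * (\<beta> x * f0 - \<mu> * f4) + G * (\<mu> * f0 + \<beta> x * f4)"
      using b2 unfolding D_def G_def \<mu>_def by algebra
    then have "D * (q x * S * (l - \<alpha> x)) = \<beta> x * (2 * l - S) * (\<beta> x * q x * (S - l)) + G * (- q x * l * (S - \<alpha> x) + 2 * z * q x)"
      unfolding 1 2 3 .
    then have "q x * ((l - S) * S * l\<^sup>2) = q x * (2 * z * (S * (l - S) - \<alpha> x * (2 * l - S)))"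
      using b2 unfolding D_def G_def by algebra
    then show ?thesis using q[OF x] unfolding z_def by simp
  qed
  \<comment> \<open>For \<open>2 * l = S\<close> the function \<alpha> drops out of
    \<open>rel\<close>, which would make \<open>c s\<close> constant.\<close>
  have \<Sigma>: "2 * l - S \<noteq> 0"
  proof
    assume 0: "2 * l - S = 0"
    have "(c x * s x)\<^sup>2 = l\<^sup>2 / 2" if "x \<in> U" for x
    proof -
      have "(l - S) * S * (l\<^sup>2 - 2 * (c x * s x)\<^sup>2) = 0" using rel[OF that] 0 by algebra
      then show ?thesis using S by simp
    qed
    then show False by (rule no_const)
  qed
  obtain x where x: "x \<in> U" using ne by blast
  obtain u0 where u0: "\<eta>0 x u0 = 1" "\<eta>3 x u0 = 0" "\<eta>4 x u0 = 0" by (rule dual_rot[OF x])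
  obtain u3 where u3: "\<eta>0 x u3 = 0" "\<eta>3 x u3 = 1" "\<eta>4 x u3 = 0" by (rule dual_rot[OF x])
  obtain u4 where u4: "\<eta>0 x u4 = 0" "\<eta>3 x u4 = 0" "\<eta>4 x u4 = 1" by (rule dual_rot[OF x])
  note cod = codazzi[OF x u0 u3 u4]
  \<comment> \<open>\<kappa> vanishes on \<open>u3\<close>, so \<open>c s\<close> is stationary in
    that direction and \<open>rel\<close> passes this on to \<alpha>.\<close>
  have a3: "dird \<alpha> x u3 = 0"
  proof -
    let ?H = "\<lambda>y. (c y * s y) * (c y * s y) * (S * (l - S) - \<alpha> y * (2 * l - S))"
    have "dird ?H x u3 = 0"
    proof (rule dird_eq_0_of_zero_on[OF open_U x])
      fix y assume "y \<in> U"
      then show "?H y = (l - S) * S * l\<^sup>2 / 2" using rel[of y] by (simp add: power2_eq_square)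
    qed
    moreover have cs: "(\<lambda>y. c y * s y) differentiable (at x)" by (intro differentiable_mult cs_diff x)
    moreover have "dird (\<lambda>y. c y * s y) x u3 = 0" using dcs2[OF x, of u3] by (simp add: \<kappa>_eq[OF x] u3)
    moreover have "dird (\<lambda>y. S * (l - S) - \<alpha> y * (2 * l - S)) x u3 = - dird \<alpha> x u3 * (2 * l - S)"
      using \<alpha>_diff[OF x] by (simp add: dird_diff dird_mult)
    ultimately have "(c x * s x) * (c x * s x) * (- dird \<alpha> x u3 * (2 * l - S)) = 0"
      using \<alpha>_diff[OF x] dird_mult[of "\<lambda>y. (c y * s y) * (c y * s y)" x "\<lambda>y. S * (l - S) - \<alpha> y * (2 * l - S)" u3]
        dird_mult[OF cs cs, of u3] by (simp add: differentiable_mult differentiable_diff)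
    then show ?thesis using \<Sigma> cs_pos[OF x] by simp
  qed
  have b3: "dird \<beta> x u3 = 0" using d\<beta>[OF x, of u3] \<beta>_nz[OF x] by (simp add: a3)
  have b2: "(\<beta> x)\<^sup>2 = \<alpha> x * (S - \<alpha> x)" using \<beta>_sq[OF x] R by simp
  \<comment> \<open>With the left sides zero, \<open>f4\<close> is eliminated between the two
    Codazzi equations; the quadratic factor that remains collapses to
    \<open>l\<^sup>2\<close>.\<close>
  have "q x * (\<alpha> x * l\<^sup>2) = 0"
    using cod(5) cod(8) b2 unfolding a3 b3 by algebra
  moreover have "\<alpha> x \<noteq> 0" using b2 \<beta>_nz[OF x] by auto
  ultimately show False using q[OF x] l by simp
qed

end

text \<open>The preceding lemmas need \<open>X Y\<close>, and possibly \<open>e\<close>, to be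
  nonzero on a whole region. These are open conditions, so the region is shrunk; if \<open>e\<close>
  is nowhere nonzero, it vanishes identically, which is the other case.\<close>

lemma oblique_impossible:
  assumes "oblique U c s e0 e1 e2 k z1 z2 X Y \<alpha> \<beta> S l R"
    and cases: "l = 0 \<or> R = 0 \<and> S \<noteq> 0 \<and> l \<noteq> S"
  shows False
proof -
  interpret O: oblique U c s e0 e1 e2 k z1 z2 X Y \<alpha> \<beta> S l R by fact
  define V where "V = {x \<in> U. X x * Y x \<noteq> 0}"
  have "open V"
    unfolding V_def by (intro open_nonzero_set O.open_U differentiable_mult O.XY_diff)
  then have V: "open V" "V \<subseteq> U" "V \<noteq> {}"
    using O.XY_not_zero by (auto simp: V_def)
  interpret V: oblique V c s e0 e1 e2 k z1 z2 X Y \<alpha> \<beta> S l R by (rule oblique_subset[OF assms(1) V])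
  have q: "V.q x \<noteq> 0" if "x \<in> V" for x using V.q_nz[OF that] that by (simp add: V_def)
  show False
  proof (cases "l = 0")
    case True
    define E where "E = {x \<in> V. V.e x \<noteq> 0}"
    have "open E"
      unfolding E_def V.e_def[abs_def] using V(2)
      by (intro open_nonzero_set V(1) differentiable_diff differentiable_power O.XY_diff) auto
    then have E: "open E" "E \<subseteq> V" unfolding E_def by blast+
    show False
    proof (cases "E = {}")
      case True
      have "V.e x = 0" if "x \<in> V" for x using True that unfolding E_def by blast
      moreover have "X x * Y x \<noteq> 0" if "x \<in> V" for x using that unfolding V_def by blast
      ultimately show False using V.l_zero_e_zero[OF \<open>l = 0\<close> q] by blast
    next
      case False
      interpret E: oblique E c s e0 e1 e2 k z1 z2 X Y \<alpha> \<beta> S l R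
        by (rule oblique_subset[OF V.oblique_axioms E False])
      have "V.q x \<noteq> 0" "V.e x \<noteq> 0" if "x \<in> E" for x using q that unfolding E_def by blast+
      then show False using E.l_zero_e_nonzero[OF \<open>l = 0\<close>] by blast
    qed
  next
    case False
    then show False using V.l_nonzero cases q by blast
  qed
qed

section \<open>The field V principal\<close>

text \<open>At a simple root the product rule leaves the derivative of \<open>F\<close> times
  nonzero factors.\<close>

lemma dird_zero_of_cubic:
  fixes F :: "'a::real_normed_vector \<Rightarrow> real"
  assumes U: "open U" "x \<in> U" and F: "F differentiable (at x)"
    and root: "\<And>y. y \<in> U \<Longrightarrow> (F y - k1) * (F y - k2) * (F y - k3) = 0"
    and distinct: "k1 \<noteq> k2" "k1 \<noteq> k3" "k2 \<noteq> k3"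
  shows "dird F x v = 0"
proof -
  have d: "(\<lambda>y. F y - k) differentiable (at x)" "dird (\<lambda>y. F y - k) x v = dird F x v" for k
    using F dird_diff[OF F differentiable_const, of k v] by simp_all
  have m: "(\<lambda>y. (F y - k1) * (F y - k2)) differentiable (at x)" by (intro differentiable_mult d)
  have "dird (\<lambda>y. (F y - k1) * (F y - k2) * (F y - k3)) x v = 0"
    by (rule dird_eq_0_of_zero_on[OF U root])
  then have eq: "(dird F x v * (F x - k2) + (F x - k1) * dird F x v) * (F x - k3) + (F x - k1) * (F x - k2) * dird F x v = 0"
    unfolding dird_mult[OF m d(1)[of k3]] dird_mult[OF d(1)[of k1] d(1)[of k2]] d(2) .
  have "F x = k1 \<or> F x = k2 \<or> F x = k3" using root[OF U(2)] by auto
  then show ?thesis using eq distinct by auto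
qed

lemma ratio_eq:
  fixes c s :: real
  assumes "s / c = c / s" "c > 0" "s > 0"
  shows "c = s"
proof -
  have "s\<^sup>2 = c\<^sup>2" using assms by (simp add: field_simps power2_eq_square)
  then show ?thesis using assms(2,3) by (simp add: power2_eq_iff_nonneg)
qed

text \<open>A symmetric matrix preserves the orthogonal complement of an eigenvector; the trace
  supplies the other eigenvalue. Here \<open>(B1, B2)\<close> is orthogonal to
  \<open>(X, Y)\<close>.\<close>

lemma symmetric_2x2_eigen:
  fixes a b d X Y B :: real
  assumes "X\<^sup>2 + Y\<^sup>2 = 1" "B \<noteq> 0" "B1 = - B * Y" "B2 = B * X"
    and "B1 * a + B2 * b = \<delta> * B1" "B1 * b + B2 * d = \<delta> * B2" "a + d = \<delta> + l"
  shows "X * a + Y * b = l * X" "X * b + Y * d = l * Y"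
proof -
  have 1: "X * b = Y * (a - \<delta>)" and 2: "Y * b = X * (d - \<delta>)"
    using assms(2,5,6) unfolding assms(3,4) by (simp_all add: algebra_simps, algebra+)
  show "X * a + Y * b = l * X" "X * b + Y * d = l * Y"
    using 1 2 assms(7) by algebra+
qed

text \<open>\<open>tr\<close>, \<open>minors\<close> and \<open>dets\<close> fix the characteristic
  polynomial of the shape operator. \<open>two\<close> says that the quadratic with sum
  \<open>S\<close> and product \<open>R\<close> of two curvatures, applied to the shape operator,
  annihilates \<open>T\<close>; the pair may depend on the point.\<close>

locale principal = structure_eqs +
  fixes k1 k2 k3 :: real
  assumes distinct: "k1 \<noteq> k2" "k1 \<noteq> k3" "k2 \<noteq> k3" and zero: "k1 * k2 * k3 = 0"
    and tr: "x \<in> U \<Longrightarrow> A x + a x + d x = k1 + k2 + k3"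
    and minors: "x \<in> U \<Longrightarrow> A x * a x + A x * d x + a x * d x - (B1 x)\<^sup>2 - (B2 x)\<^sup>2 - (b x)\<^sup>2 = k1 * k2 + k1 * k3 + k2 * k3"
    and dets: "x \<in> U \<Longrightarrow> A x * a x * d x + 2 * B1 x * B2 x * b x - A x * (b x)\<^sup>2 - a x * (B2 x)\<^sup>2 - d x * (B1 x)\<^sup>2 = k1 * k2 * k3"
    and two: "x \<in> U \<Longrightarrow> \<exists>(S, R) \<in> {(k1 + k2, k1 * k2), (k1 + k3, k1 * k3), (k2 + k3, k2 * k3)}.
        (A x)\<^sup>2 + (B1 x)\<^sup>2 + (B2 x)\<^sup>2 - S * A x + R = 0 \<and>
        A x * B1 x + B1 x * a x + B2 x * b x = S * B1 x \<and> A x * B2 x + B1 x * b x + B2 x * d x = S * B2 x"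
begin

text \<open>A sum of squares turns the three equations of \<open>two\<close> into one function,
  whose nonvanishing is an open condition.\<close>

definition "defect S R x = ((A x)\<^sup>2 + (B1 x)\<^sup>2 + (B2 x)\<^sup>2 - S * A x + R)\<^sup>2 +
   (A x * B1 x + B1 x * a x + B2 x * b x - S * B1 x)\<^sup>2 + (A x * B2 x + B1 x * b x + B2 x * d x - S * B2 x)\<^sup>2"

lemma defect_zero_iff: "defect S R x = 0 \<longleftrightarrow> (A x)\<^sup>2 + (B1 x)\<^sup>2 + (B2 x)\<^sup>2 - S * A x + R = 0 \<and>
        A x * B1 x + B1 x * a x + B2 x * b x = S * B1 x \<and> A x * B2 x + B1 x * b x + B2 x * d x = S * B2 x"
  unfolding defect_def by (simp add: add_nonneg_eq_0_iff)

lemma defect_diff: "x \<in> U \<Longrightarrow> defect S R differentiable (at x)"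
  unfolding defect_def[abs_def]
  by (intro differentiable_add differentiable_mult differentiable_diff differentiable_power coef_diff differentiable_const)

text \<open>The part of \<open>A T\<close> orthogonal to \<open>T\<close> has length \<beta> and the
  direction of \<open>e4 = (- Y, X)\<close>. As a quadratic in the shape operator annihilates
  \<open>T\<close>, the span of \<open>T\<close> and \<open>e4\<close> is invariant, so its
  complement \<open>e3 = (X, Y)\<close> is principal, with the curvature \<open>l\<close> left over
  by the trace.\<close>

lemma oblique_region:
  assumes W: "open W" "W \<subseteq> U" "W \<noteq> {}" and nz: "\<And>x. x \<in> W \<Longrightarrow> (B1 x)\<^sup>2 + (B2 x)\<^sup>2 \<noteq> 0"
    and def0: "\<And>x. x \<in> W \<Longrightarrow> defect S R x = 0" and l: "S + l = k1 + k2 + k3"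
    and cases: "l = 0 \<or> R = 0 \<and> S \<noteq> 0 \<and> l \<noteq> S"
  shows False
proof -
  have WU: "x \<in> W \<Longrightarrow> x \<in> U" for x using W(2) by blast
  define \<beta> where "\<beta> x = sqrt ((B1 x)\<^sup>2 + (B2 x)\<^sup>2)" for x
  define X where "X x = B2 x / \<beta> x" for x
  define Y where "Y x = - B1 x / \<beta> x" for x
  have pos: "(B1 x)\<^sup>2 + (B2 x)\<^sup>2 > 0" if "x \<in> W" for x
    using nz[OF that] by (simp add: sum_power2_gt_zero_iff)
  have \<beta>: "\<beta> x > 0" "(\<beta> x)\<^sup>2 = (B1 x)\<^sup>2 + (B2 x)\<^sup>2" if "x \<in> W" for x
    using pos[OF that] by (auto simp: \<beta>_def)
  have \<beta>_diff: "\<beta> differentiable (at x)" if "x \<in> W" for x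
  proof -
    let ?h = "\<lambda>x. (B1 x)\<^sup>2 + (B2 x)\<^sup>2"
    have "?h differentiable (at x)"
      by (intro differentiable_add differentiable_power coef_diff WU that)
    from has_derivative_real_sqrt[OF pos[OF that] has_derivative_dird[OF this]]
    show ?thesis unfolding \<beta>_def[abs_def] differentiable_def by blast
  qed
  interpret S: structure_eqs W c s \<eta>0 \<eta>1 \<eta>2 \<kappa> \<zeta>1 \<zeta>2
    by (rule structure_eqs_subset[OF structure_eqs_axioms W(1,2)])
  interpret R: rotated W c s \<eta>0 \<eta>1 \<eta>2 \<kappa> \<zeta>1 \<zeta>2 X Y
  proof
    fix x assume x: "x \<in> W"
    show "X differentiable (at x)" "Y differentiable (at x)"
      unfolding X_def[abs_def] Y_def[abs_def] using \<beta>(1)[OF x]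
      by (auto intro!: differentiable_divide differentiable_minus coef_diff WU x \<beta>_diff)
    have "(X x)\<^sup>2 + (Y x)\<^sup>2 = ((B1 x)\<^sup>2 + (B2 x)\<^sup>2) / (\<beta> x)\<^sup>2"
      by (simp add: X_def Y_def power_divide add_divide_distrib)
    then show "(X x)\<^sup>2 + (Y x)\<^sup>2 = 1" unfolding \<beta>(2)[OF x, symmetric] using \<beta>(1)[OF x] by simp
  qed
  have BXY: "B1 x = - \<beta> x * Y x" "B2 x = \<beta> x * X x" if "x \<in> W" for x
    using \<beta>(1)[OF that] by (simp_all add: X_def Y_def)
  have eig: "X x * a x + Y x * b x = l * X x" "X x * b x + Y x * d x = l * Y x" if x: "x \<in> W" for x
  proof -
    have "B1 x * a x + B2 x * b x = (S - A x) * B1 x" "B1 x * b x + B2 x * d x = (S - A x) * B2 x"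
      "a x + d x = (S - A x) + l"
      using def0[OF x] tr[OF WU[OF x]] l unfolding defect_zero_iff by (auto simp: algebra_simps)
    from symmetric_2x2_eigen[OF R.XY_1[OF x] _ BXY[OF x] this]
    show "X x * a x + Y x * b x = l * X x" "X x * b x + Y x * d x = l * Y x"
      using \<beta>(1)[OF x] by auto
  qed
  have "oblique W c s \<eta>0 \<eta>1 \<eta>2 \<kappa> \<zeta>1 \<zeta>2 X Y A \<beta> S l R"
  proof
    show "W \<noteq> {}" by fact
  next
    fix x assume x: "x \<in> W"
    show "A differentiable (at x)" by (intro coef_diff WU x)
    show "\<beta> differentiable (at x)" by (rule \<beta>_diff[OF x])
    show "\<beta> x \<noteq> 0" using \<beta>(1)[OF x] by simp
    show "(\<beta> x)\<^sup>2 = A x * (S - A x) - R"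
      using def0[OF x] \<beta>(2)[OF x] unfolding defect_zero_iff by (simp add: algebra_simps power2_eq_square)
  next
    fix x u assume x: "x \<in> W"
    note f = forms_eq[OF WU[OF x], of u] and XY = R.XY_1[OF x]
    show "\<kappa> x u = A x * \<eta>0 x u + \<beta> x * R.\<eta>4 x u"
      unfolding f R.\<eta>4_def BXY[OF x] by (simp add: algebra_simps)
    have "R.\<zeta>3 x u = (X x * B1 x + Y x * B2 x) * \<eta>0 x u + (X x * a x + Y x * b x) * \<eta>1 x u + (X x * b x + Y x * d x) * \<eta>2 x u"
      unfolding f R.\<zeta>3_def by (simp add: algebra_simps)
    then show "R.\<zeta>3 x u = l * R.\<eta>3 x u"
      unfolding eig[OF x] R.\<eta>3_def BXY[OF x] by (simp add: algebra_simps)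
    have "a x + d x = (S - A x) + l" using tr[OF WU[OF x]] l by simp
    then have e: "- Y x * a x + X x * b x = - (S - A x) * Y x" "- Y x * b x + X x * d x = (S - A x) * X x"
      using eig[OF x] XY by algebra+
    have z: "R.\<zeta>4 x u = (- Y x * B1 x + X x * B2 x) * \<eta>0 x u + (- Y x * a x + X x * b x) * \<eta>1 x u + (- Y x * b x + X x * d x) * \<eta>2 x u"
      unfolding f R.\<zeta>4_def by (simp add: algebra_simps)
    have b: "- Y x * B1 x + X x * B2 x = \<beta> x" using XY unfolding BXY[OF x] by algebra
    show "R.\<zeta>4 x u = \<beta> x * \<eta>0 x u + (S - A x) * R.\<eta>4 x u"
      unfolding z e b R.\<eta>4_def by (simp add: algebra_simps)
  qed
  then show False using oblique_impossible cases by blast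
qed

text \<open>The admissible pair may vary, so the region is split by open conditions: on
  \<open>V1\<close> the first pair fails, on \<open>V2\<close> also the second. Either
  \<open>V1\<close> is empty and the first pair serves on \<open>V\<close>, or \<open>V2\<close> is
  empty and the second serves on \<open>V1\<close>, or the third serves on
  \<open>V2\<close>.\<close>

lemma B_zero:
  assumes x: "x \<in> U" shows "B1 x = 0" "B2 x = 0"
proof -
  define V where "V = {x \<in> U. (B1 x)\<^sup>2 + (B2 x)\<^sup>2 \<noteq> 0}"
  have "open V"
    unfolding V_def
    by (intro open_nonzero_set[OF open_U] differentiable_add differentiable_power coef_diff)
  then have V: "open V" "V \<subseteq> U" unfolding V_def by blast+
  have nz: "(B1 x)\<^sup>2 + (B2 x)\<^sup>2 \<noteq> 0" if "x \<in> V" for x using that unfolding V_def by blast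
  have sub: "open {x \<in> W. defect S R x \<noteq> 0}" if "open W" "W \<subseteq> U" for W S R
    using that by (intro open_nonzero_set defect_diff) auto
  have "V = {}"
  proof (rule ccontr)
    assume ne: "V \<noteq> {}"
    define V1 where "V1 = {x \<in> V. defect (k1 + k2) (k1 * k2) x \<noteq> 0}"
    define V2 where "V2 = {x \<in> V1. defect (k1 + k3) (k1 * k3) x \<noteq> 0}"
    have V1: "open V1" "V1 \<subseteq> V" and V2: "open V2" "V2 \<subseteq> V"
      using sub[OF V] sub[of V1 "k1 + k3" "k1 * k3"] V unfolding V1_def V2_def by blast+
    have ne1: "V1 \<noteq> {}"
    proof
      assume 0: "V1 = {}"
      show False
      proof (rule oblique_region[OF V(1,2) ne nz, of "k1 + k2" "k1 * k2" k3])
        show "defect (k1 + k2) (k1 * k2) x = 0" if "x \<in> V" for x using 0 that unfolding V1_def by blast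
        \<comment> \<open>If \<open>k3\<close> is nonzero, one of \<open>k1\<close> and
          \<open>k2\<close> is zero and the sum is the other one; distinctness gives the
          inequalities.\<close>
        show "k3 = 0 \<or> k1 * k2 = 0 \<and> k1 + k2 \<noteq> 0 \<and> k3 \<noteq> k1 + k2" using zero distinct by auto
      qed auto
    qed
    have ne2: "V2 \<noteq> {}"
    proof
      assume 0: "V2 = {}"
      show False
      proof (rule oblique_region[OF V1(1) _ ne1, of "k1 + k3" "k1 * k3" k2])
        show "V1 \<subseteq> U" using V V1 by blast
        show "(B1 x)\<^sup>2 + (B2 x)\<^sup>2 \<noteq> 0" if "x \<in> V1" for x using nz V1 that by blast
        show "defect (k1 + k3) (k1 * k3) x = 0" if "x \<in> V1" for x using 0 that unfolding V2_def by blast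
        show "k2 = 0 \<or> k1 * k3 = 0 \<and> k1 + k3 \<noteq> 0 \<and> k2 \<noteq> k1 + k3" using zero distinct by auto
      qed auto
    qed
    show False
    proof (rule oblique_region[OF V2(1) _ ne2, of "k2 + k3" "k2 * k3" k1])
      show "V2 \<subseteq> U" using V V2 by blast
      show "(B1 x)\<^sup>2 + (B2 x)\<^sup>2 \<noteq> 0" if "x \<in> V2" for x using nz V2 that by blast
      show "defect (k2 + k3) (k2 * k3) x = 0" if "x \<in> V2" for x
      proof -
        have "x \<in> U" "defect (k1 + k2) (k1 * k2) x \<noteq> 0" "defect (k1 + k3) (k1 * k3) x \<noteq> 0"
          using that V unfolding V2_def V1_def by auto
        then show ?thesis using two[of x] unfolding defect_zero_iff by auto
      qed
      show "k1 = 0 \<or> k2 * k3 = 0 \<and> k2 + k3 \<noteq> 0 \<and> k1 \<noteq> k2 + k3" using zero distinct by auto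
    qed auto
  qed
  then have "(B1 x)\<^sup>2 + (B2 x)\<^sup>2 = 0" using x unfolding V_def by blast
  then show "B1 x = 0" "B2 x = 0" by (auto simp: add_nonneg_eq_0_iff)
qed

section \<open>The eigenvalue of T\<close>

lemma dual_basis:
  assumes x: "x \<in> U"
  obtains u0 u1 u2 where "\<eta>0 x u0 = 1" "\<eta>1 x u0 = 0" "\<eta>2 x u0 = 0"
    "\<eta>0 x u1 = 0" "\<eta>1 x u1 = 1" "\<eta>2 x u1 = 0" "\<eta>0 x u2 = 0" "\<eta>1 x u2 = 0" "\<eta>2 x u2 = 1"
  using dual_vector[OF x] by metis

lemma \<kappa>_A: "x \<in> U \<Longrightarrow> \<kappa> x u = A x * \<eta>0 x u"
  using forms_eq(1) B_zero by simp

lemma dA: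
  assumes x: "x \<in> U" shows "dird A x v = 0"
proof (rule dird_zero_of_cubic[OF open_U x _ _ distinct])
  show "A differentiable (at x)" by (rule coef_diff[OF x])
  fix y assume y: "y \<in> U"
  show "(A y - k1) * (A y - k2) * (A y - k3) = 0"
    using tr[OF y] minors[OF y] dets[OF y] B_zero[OF y] by algebra
qed

text \<open>Where \<open>A\<close> is nonzero, the closed form \<open>\<kappa> = A \<eta>0\<close>
  makes the kernels of \<eta>0 integrable. Their integrability defect is
  \<open>b (s / c + c / s)\<close>, and the second factor is positive.\<close>

lemma b_zero_of_A:
  assumes x: "x \<in> U" and A: "A x \<noteq> 0" shows "b x = 0"
proof -
  obtain u0 u1 u2 where u: "\<eta>0 x u0 = 1" "\<eta>1 x u0 = 0" "\<eta>2 x u0 = 0"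
    "\<eta>0 x u1 = 0" "\<eta>1 x u1 = 1" "\<eta>2 x u1 = 0" "\<eta>0 x u2 = 0" "\<eta>1 x u2 = 0" "\<eta>2 x u2 = 1"
    by (rule dual_basis[OF x])
  have "0 = ext \<kappa> x u1 u2" by (simp add: ext_\<kappa>[OF x])
  also have "\<dots> = ext (\<lambda>y u. A y * \<eta>0 y u) x u1 u2"
    by (rule ext_cong_open[OF open_U x \<kappa>_A])
  also have "\<dots> = A x * ext \<eta>0 x u1 u2"
    using ext_scale[of A x \<eta>0 u1 u2] coef_diff[OF x] diff[OF x] u by simp
  finally have "ext \<eta>0 x u1 u2 = 0" using A by simp
  then have "b x * (s x / c x + c x / s x) = 0"
    unfolding ext_\<eta>0[OF x] wedge_def forms_eq[OF x] by (simp add: u algebra_simps)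
  moreover have "s x / c x + c x / s x > 0" using cs_pos[OF x] by (simp add: add_pos_pos)
  ultimately show ?thesis by simp
qed

text \<open>Near a point with \<open>A\<close> nonzero \<open>b\<close> vanishes, so
  \<open>a\<close> is an eigenvalue too and is stationary. The Codazzi equation for \<zeta>1 then
  expresses \<open>c\<close> through \<open>a\<close> and \<open>A\<close>, so \<open>c\<close> is
  stationary along \<open>T\<close>, against \<open>dc = - s \<kappa>\<close>.\<close>

lemma A_zero:
  assumes x: "x \<in> U" shows "A x = 0"
proof (rule ccontr)
  assume Ax: "A x \<noteq> 0"
  define V where "V = {x \<in> U. A x \<noteq> 0}"
  have V: "open V" "x \<in> V" and VU: "y \<in> V \<Longrightarrow> y \<in> U" and VA: "y \<in> V \<Longrightarrow> A y \<noteq> 0" for y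
    unfolding V_def using open_nonzero_set[OF open_U, of A] coef_diff x Ax by auto
  have b: "b y = 0" if "y \<in> V" for y using b_zero_of_A VU VA that by blast
  have da: "dird a y v = 0" if y: "y \<in> V" for y v
  proof (rule dird_zero_of_cubic[OF V(1) y _ _ distinct])
    show "a differentiable (at y)" by (rule coef_diff[OF VU[OF y]])
    fix z assume z: "z \<in> V"
    show "(a z - k1) * (a z - k2) * (a z - k3) = 0"
      using tr[OF VU[OF z]] minors[OF VU[OF z]] dets[OF VU[OF z]] B_zero[OF VU[OF z]] b[OF z] by algebra
  qed
  have rel: "(c y)\<^sup>2 = (a y)\<^sup>2 - A y * a y" if y: "y \<in> V" for y
  proof -
    note yU = VU[OF y]
    obtain u0 u1 u2 where u: "\<eta>0 y u0 = 1" "\<eta>1 y u0 = 0" "\<eta>2 y u0 = 0"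
      "\<eta>0 y u1 = 0" "\<eta>1 y u1 = 1" "\<eta>2 y u1 = 0" "\<eta>0 y u2 = 0" "\<eta>1 y u2 = 0" "\<eta>2 y u2 = 1"
      by (rule dual_basis[OF yU])
    have z1: "\<zeta>1 z w = a z * \<eta>1 z w" if "z \<in> V" for z w
      using forms_eq(2)[OF VU[OF that], of w] B_zero[OF VU[OF that]] b[OF that] by simp
    have "ext \<zeta>1 y u0 u1 = ext (\<lambda>z w. a z * \<eta>1 z w) y u0 u1" by (rule ext_cong_open[OF V(1) y z1])
    also have "\<dots> = a y * ext \<eta>1 y u0 u1"
      using ext_scale[of a y \<eta>1 u0 u1] coef_diff[OF yU] diff[OF yU] da[OF y] by simp
    finally have "- (s y / c y) * (A y * a y) - c y * s y = - (s y / c y) * (a y)\<^sup>2"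
      unfolding ext_\<zeta>1[OF yU] ext_\<eta>1[OF yU] wedge_def \<kappa>_A[OF yU] z1[OF y]
      by (simp add: u power2_eq_square)
    moreover have "c y * s y = s y / c y * (c y)\<^sup>2" using cs_pos[OF yU] by (simp add: power2_eq_square)
    ultimately have "s y / c y * ((a y)\<^sup>2 - A y * a y - (c y)\<^sup>2) = 0" by algebra
    then show ?thesis using cs_pos[OF yU] by simp
  qed
  obtain u0 where u0: "\<eta>0 x u0 = 1" by (rule dual_vector[OF x])
  have "dird (\<lambda>y. (c y)\<^sup>2) x u0 = dird (\<lambda>y. a y * a y - A y * a y) x u0"
    by (rule dird_cong_open[OF V]) (use rel in \<open>simp add: power2_eq_square\<close>)
  also have "\<dots> = 0"
    using coef_diff[OF x] da[OF V(2), of u0] dA[OF x, of u0]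
    by (simp add: dird_diff dird_mult differentiable_mult)
  finally have "c x * s x * A x = 0"
    using cs_diff[OF x] by (simp add: dird_power2 dc[OF x] \<kappa>_A[OF x] u0)
  then show False using Ax cs_pos[OF x] by simp
qed

lemma \<kappa>_zero: "x \<in> U \<Longrightarrow> \<kappa> x u = 0"
  using \<kappa>_A A_zero by simp

lemma dc_zero: "x \<in> U \<Longrightarrow> dird c x v = 0" and ds_zero: "x \<in> U \<Longrightarrow> dird s x v = 0"
  by (simp_all add: dc ds \<kappa>_zero)

section \<open>The 2x2 block orthogonal to T and its Riccati equation\<close>

lemma \<zeta>_eq:
  assumes "x \<in> U"
  shows "\<zeta>1 x u = a x * \<eta>1 x u + b x * \<eta>2 x u" "\<zeta>2 x u = b x * \<eta>1 x u + d x * \<eta>2 x u"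
  using forms_eq(2,3)[OF assms, of u] B_zero[OF assms] by simp_all

lemma ext_combination:
  assumes x: "x \<in> U" and "F differentiable (at x)" "G differentiable (at x)"
    and eq: "\<And>y u. y \<in> U \<Longrightarrow> \<tau> y u = F y * \<eta>1 y u + G y * \<eta>2 y u"
  shows "ext \<tau> x v u = (dird F x v * \<eta>1 x u - dird F x u * \<eta>1 x v + F x * ext \<eta>1 x v u)
     + (dird G x v * \<eta>2 x u - dird G x u * \<eta>2 x v + G x * ext \<eta>2 x v u)"
proof -
  have "ext \<tau> x v u = ext (\<lambda>y u. F y * \<eta>1 y u + G y * \<eta>2 y u) x v u"
    by (rule ext_cong_open[OF open_U x eq])
  also have "\<dots> = ext (\<lambda>y u. F y * \<eta>1 y u) x v u + ext (\<lambda>y u. G y * \<eta>2 y u) x v u"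
    by (rule ext_add) (intro differentiable_mult assms(2,3) diff x)+
  finally show ?thesis using assms(2,3) diff[OF x] by (simp add: ext_scale)
qed

lemma codazzi_T:
  assumes x: "x \<in> U"
    and u: "\<eta>0 x u0 = 1" "\<eta>1 x u0 = 0" "\<eta>2 x u0 = 0" "\<eta>0 x u1 = 0" "\<eta>1 x u1 = 1" "\<eta>2 x u1 = 0"
      "\<eta>0 x u2 = 0" "\<eta>1 x u2 = 0" "\<eta>2 x u2 = 1"
  shows "dird a x u0 = s x / c x * (a x)\<^sup>2 - c x / s x * (b x)\<^sup>2 - c x * s x"
    "dird b x u0 = s x / c x * (a x * b x) - c x / s x * (b x * d x)"
    "dird d x u0 = s x / c x * (b x)\<^sup>2 - c x / s x * (d x)\<^sup>2 + c x * s x"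
    "dird a x u2 = dird b x u1" "dird d x u1 = dird b x u2"
proof -
  note E1 = ext_combination[OF x coef_diff(4)[OF x] coef_diff(5)[OF x] \<zeta>_eq(1)]
    and E2 = ext_combination[OF x coef_diff(5)[OF x] coef_diff(6)[OF x] \<zeta>_eq(2)]
  note ev = ext_\<zeta>1[OF x] ext_\<zeta>2[OF x] ext_\<eta>1[OF x] ext_\<eta>2[OF x] wedge_def \<kappa>_zero[OF x] \<zeta>_eq[OF x] u
  show "dird a x u0 = s x / c x * (a x)\<^sup>2 - c x / s x * (b x)\<^sup>2 - c x * s x"
    using E1[of u0 u1] unfolding ev by (simp add: power2_eq_square algebra_simps)
  show "dird b x u0 = s x / c x * (a x * b x) - c x / s x * (b x * d x)"
    using E1[of u0 u2] unfolding ev by (simp add: algebra_simps)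
  show "dird d x u0 = s x / c x * (b x)\<^sup>2 - c x / s x * (d x)\<^sup>2 + c x * s x"
    using E2[of u0 u2] unfolding ev by (simp add: power2_eq_square algebra_simps)
  show "dird a x u2 = dird b x u1" using E1[of u1 u2] unfolding ev by simp
  show "dird d x u1 = dird b x u2" using E2[of u1 u2] unfolding ev by simp
qed

lemma trace2: "x \<in> U \<Longrightarrow> a x + d x = k1 + k2 + k3"
  using tr A_zero by force
lemma det2: "x \<in> U \<Longrightarrow> a x * d x - (b x)\<^sup>2 = k1 * k2 + k1 * k3 + k2 * k3"
  using minors A_zero B_zero by force
text \<open>\<open>T\<close> takes the curvature zero, so the block carries the two others; its
  discriminant is the square of their difference.\<close>

lemma disc_nz: "x \<in> U \<Longrightarrow> (a x - d x)\<^sup>2 + 4 * (b x)\<^sup>2 \<noteq> 0"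
proof -
  assume x: "x \<in> U"
  have "(a x - d x)\<^sup>2 + 4 * (b x)\<^sup>2 = (k1 + k2 + k3)\<^sup>2 - 4 * (k1 * k2 + k1 * k3 + k2 * k3)"
    using trace2[OF x] det2[OF x] by algebra
  also have "\<dots> = (k1 - k2)\<^sup>2 \<or> \<dots> = (k1 - k3)\<^sup>2 \<or> \<dots> = (k2 - k3)\<^sup>2"
    using zero by (auto simp: power2_eq_square algebra_simps)
  ultimately show ?thesis using distinct by auto
qed

lemma dtrace: assumes x: "x \<in> U" shows "dird d x v = - dird a x v"
proof -
  have "dird (\<lambda>y. a y + d y) x v = 0" by (rule dird_eq_0_of_zero_on[OF open_U x trace2])
  then show ?thesis using coef_diff[OF x] by (simp add: dird_add)
qed

lemma ddet: assumes x: "x \<in> U" shows "dird a x v * (d x - a x) = 2 * b x * dird b x v"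
proof -
  have "dird (\<lambda>y. a y * d y - (b y)\<^sup>2) x v = 0" by (rule dird_eq_0_of_zero_on[OF open_U x det2])
  then have "dird a x v * d x + a x * dird d x v - 2 * b x * dird b x v = 0"
    using coef_diff[OF x] by (simp add: dird_diff dird_mult dird_power2 differentiable_mult differentiable_power)
  then show ?thesis unfolding dtrace[OF x] by (simp add: algebra_simps)
qed

text \<open>Trace and determinant of the block do not change along \<open>T\<close>; the Riccati
  equations are inserted for the derivatives.\<close>

lemma T_relations:
  assumes x: "x \<in> U"
  shows "s x / c x * ((a x)\<^sup>2 + (b x)\<^sup>2) = c x / s x * ((b x)\<^sup>2 + (d x)\<^sup>2)"
    "(k1 * k2 + k1 * k3 + k2 * k3) * (s x / c x * a x - c x / s x * d x) + c x * s x * (a x - d x) = 0"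
proof -
  obtain u0 u1 u2 where u: "\<eta>0 x u0 = 1" "\<eta>1 x u0 = 0" "\<eta>2 x u0 = 0"
    "\<eta>0 x u1 = 0" "\<eta>1 x u1 = 1" "\<eta>2 x u1 = 0" "\<eta>0 x u2 = 0" "\<eta>1 x u2 = 0" "\<eta>2 x u2 = 1"
    by (rule dual_basis[OF x])
  note cod = codazzi_T[OF x u]
  show T1: "s x / c x * ((a x)\<^sup>2 + (b x)\<^sup>2) = c x / s x * ((b x)\<^sup>2 + (d x)\<^sup>2)"
    using cod(1,3) dtrace[OF x, of u0] by algebra
  show "(k1 * k2 + k1 * k3 + k2 * k3) * (s x / c x * a x - c x / s x * d x) + c x * s x * (a x - d x) = 0"
    using cod(1,2) ddet[OF x, of u0] T1 unfolding det2[OF x, symmetric] by algebra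
qed

lemma tt': "x \<in> U \<Longrightarrow> c x * s x * (s x / c x + c x / s x) = 1"
  using cs_1[of x] cs_pos[of x] by (simp add: field_simps power2_eq_square)

lemma t_diff:
  assumes x: "x \<in> U"
  shows "(\<lambda>y. s y / c y) differentiable (at x)" "(\<lambda>y. c y / s y) differentiable (at x)"
    "dird (\<lambda>y. s y / c y) x v = 0" "dird (\<lambda>y. c y / s y) x v = 0"
proof -
  show 1: "(\<lambda>y. s y / c y) differentiable (at x)" "(\<lambda>y. c y / s y) differentiable (at x)"
    using cs_pos[OF x] by (auto intro!: differentiable_divide cs_diff x)
  have nz: "c y \<noteq> 0" "s y \<noteq> 0" if "y \<in> U" for y using cs_pos[OF that] by auto
  have "dird s x v = dird (\<lambda>y. s y / c y * c y) x v" "dird c x v = dird (\<lambda>y. c y / s y * s y) x v"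
    by (auto intro!: dird_cong_open[OF open_U x] simp: nz)
  then show "dird (\<lambda>y. s y / c y) x v = 0" "dird (\<lambda>y. c y / s y) x v = 0"
    using dird_mult[OF 1(1) cs_diff(1)[OF x], of v] dird_mult[OF 1(2) cs_diff(2)[OF x], of v] cs_pos[OF x]
    by (auto simp: dc_zero[OF x] ds_zero[OF x])
qed

text \<open>If the block is stationary along \<open>T\<close>, its Riccati equations are algebraic,
  and eliminating \<open>a\<close>, \<open>b\<close>, \<open>d\<close> leaves
  \<open>t\<^sup>2 = 1\<close>. The off-diagonal equation then equates \<open>a\<close> and
  \<open>d\<close>.\<close>

lemma branch_of_stationary:
  assumes x: "x \<in> U" and u: "\<eta>0 x u0 = 1" "\<eta>1 x u0 = 0" "\<eta>2 x u0 = 0" and da: "dird a x u0 = 0" and b: "b x \<noteq> 0"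
  shows "a x = d x"
proof -
  obtain u1 where u1: "\<eta>0 x u1 = 0" "\<eta>1 x u1 = 1" "\<eta>2 x u1 = 0" by (rule dual_vector[OF x])
  obtain u2 where u2: "\<eta>0 x u2 = 0" "\<eta>1 x u2 = 0" "\<eta>2 x u2 = 1" by (rule dual_vector[OF x])
  note cod = codazzi_T[OF x u u1 u2]
  define t where "t = s x / c x"
  define t' where "t' = c x / s x"
  have pos: "t > 0" "t' > 0" "c x * s x > 0" and inv: "t * t' = 1" using cs_pos[OF x] by (simp_all add: t_def t'_def)
  have "dird b x u0 = 0" using ddet[OF x, of u0] da b by simp
  then have "t * (a x * b x) = t' * (b x * d x)" using cod(2) unfolding t_def t'_def by simp
  then have "b x * (t * a x - t' * d x) = 0" by algebra
  then have 1: "t * a x = t' * d x" using b by simp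
  have 2: "t * (a x)\<^sup>2 - t' * (b x)\<^sup>2 = c x * s x" using cod(1) da unfolding t_def t'_def by simp
  have 3: "t * (b x)\<^sup>2 - t' * (d x)\<^sup>2 = - (c x * s x)" using cod(3) da dtrace[OF x, of u0] unfolding t_def t'_def by simp
  have "(t\<^sup>2 - 1) * (c x * s x) = 0" using 1 2 3 inv by algebra
  then have "t = 1" using pos by (auto simp: power2_eq_1_iff)
  then show ?thesis using 1 inv by simp
qed

text \<open>Here \<open>c = s\<close> and the principal curvatures are \<open>0, 1 / sqrt 2, - 1 / sqrt 2\<close>. The Codazzi equations
  leave \<open>da = - 2 b\<^sup>2 \<eta>0\<close> and \<open>db = 2 a b \<eta>0\<close>, and then \<open>dda = 0\<close> forces \<open>b = 0\<close>.\<close>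

lemma traceless_case:
  assumes H: "k1 + k2 + k3 = 0" and De: "k1 * k2 + k1 * k3 + k2 * k3 = - 1 / 2" and x: "x \<in> U"
  shows "b x = 0"
proof (rule ccontr)
  assume bx: "b x \<noteq> 0"
  define V where "V = {y \<in> U. b y \<noteq> 0}"
  have V: "open V" "x \<in> V" and VU: "y \<in> V \<Longrightarrow> y \<in> U" and Vb: "y \<in> V \<Longrightarrow> b y \<noteq> 0" for y
    unfolding V_def using open_nonzero_set[OF open_U, of b] coef_diff x bx by auto
  have d: "d y = - a y" and ab: "(a y)\<^sup>2 + (b y)\<^sup>2 = 1 / 2" if "y \<in> U" for y
    using trace2[OF that] det2[OF that] H De by (auto simp: power2_eq_square algebra_simps, algebra+)
  have t1: "s y / c y = 1" "c y / s y = 1" "c y * s y = 1 / 2" if y: "y \<in> U" for y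
  proof -
    have "s y / c y = c y / s y" using T_relations(1)[OF y] ab[OF y] d[OF y] by (simp add: add.commute)
    then have "c y = s y" using ratio_eq cs_pos[OF y] by blast
    then show "s y / c y = 1" "c y / s y = 1" "c y * s y = 1 / 2"
      using cs_pos[OF y] cs_1[OF y] by (auto simp: power2_eq_square)
  qed
  have grad: "dird a y v = - 2 * (b y)\<^sup>2 * \<eta>0 y v" "dird b y v = 2 * a y * b y * \<eta>0 y v" if y: "y \<in> V" for y v
  proof -
    note yU = VU[OF y] and by0 = Vb[OF y]
    obtain u0 u1 u2 where u: "\<eta>0 y u0 = 1" "\<eta>1 y u0 = 0" "\<eta>2 y u0 = 0"
      "\<eta>0 y u1 = 0" "\<eta>1 y u1 = 1" "\<eta>2 y u1 = 0" "\<eta>0 y u2 = 0" "\<eta>1 y u2 = 0" "\<eta>2 y u2 = 1"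
      by (rule dual_basis[OF yU])
    note cod = codazzi_T[OF yU u]
    have rel: "a y * dird a y w + b y * dird b y w = 0" for w
      using ddet[OF yU, of w] d[OF yU] by (simp add: algebra_simps)
    have 0: "dird a y u0 = - 2 * (b y)\<^sup>2" "dird b y u0 = 2 * a y * b y"
      using cod(1,2) ab[OF yU] unfolding t1[OF yU] d[OF yU] by (simp_all add: algebra_simps)
    have m: "dird b y u2 = - dird a y u1" using cod(5) dtrace[OF yU, of u1] by simp
    \<comment> \<open>\<open>rel\<close> along \<open>u1\<close> and \<open>u2\<close> is a linear
      system for the derivatives of \<open>a\<close> and \<open>b\<close> along \<open>u1\<close>,
      with determinant \<open>a\<^sup>2 + b\<^sup>2 = 1 / 2\<close> up to sign.\<close>
    have "dird a y u1 * ((a y)\<^sup>2 + (b y)\<^sup>2) = 0" using rel[of u1] rel[of u2] m cod(4) by algebra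
    then have 1: "dird a y u1 = 0" using ab[OF yU] by simp
    then have b1: "dird b y u1 = 0" using rel[of u1] by0 by simp
    have 2: "dird a y u2 = 0" "dird b y u2 = 0" using cod(4) m 1 b1 by simp_all
    define z where "z = v - (\<eta>0 y v *\<^sub>R u0 + \<eta>1 y v *\<^sub>R u1 + \<eta>2 y v *\<^sub>R u2)"
    have "z = 0"
      unfolding z_def by (rule indep[OF yU]) (simp_all add: linear_diff linear_add linear_scale lin[OF yU] u)
    then have v: "v = \<eta>0 y v *\<^sub>R u0 + \<eta>1 y v *\<^sub>R u1 + \<eta>2 y v *\<^sub>R u2" by (simp add: z_def)
    have lina: "linear (dird a y)" and linb: "linear (dird b y)" by (intro linear_dird coef_diff yU)+
    have "dird a y v = dird a y (\<eta>0 y v *\<^sub>R u0 + \<eta>1 y v *\<^sub>R u1 + \<eta>2 y v *\<^sub>R u2)" using v by simp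
    then show "dird a y v = - 2 * (b y)\<^sup>2 * \<eta>0 y v"
      using lina by (simp add: linear_add linear_scale 0 1 2)
    have "dird b y v = dird b y (\<eta>0 y v *\<^sub>R u0 + \<eta>1 y v *\<^sub>R u1 + \<eta>2 y v *\<^sub>R u2)" using v by simp
    then show "dird b y v = 2 * a y * b y * \<eta>0 y v"
      using linb by (simp add: linear_add linear_scale 0 b1 2)
  qed
  have bb: "(\<lambda>y. - 2 * (b y)\<^sup>2) differentiable (at x)"
    by (intro differentiable_mult differentiable_power coef_diff x differentiable_const)
  have dif: "(\<lambda>y. dird a y w) differentiable (at x)" for w
  proof (rule differentiable_cong_open[OF V])
    show "- 2 * (b y)\<^sup>2 * \<eta>0 y w = dird a y w" if "y \<in> V" for y using grad(1)[OF that] by simp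
    show "(\<lambda>y. - 2 * (b y)\<^sup>2 * \<eta>0 y w) differentiable (at x)"
      by (intro differentiable_mult[OF bb] diff x)
  qed
  obtain u0 u1 u2 where u: "\<eta>0 x u0 = 1" "\<eta>1 x u0 = 0" "\<eta>2 x u0 = 0"
    "\<eta>0 x u1 = 0" "\<eta>1 x u1 = 1" "\<eta>2 x u1 = 0" "\<eta>0 x u2 = 0" "\<eta>1 x u2 = 0" "\<eta>2 x u2 = 1"
    by (rule dual_basis[OF x])
  have "0 = ext (\<lambda>y w. dird a y w) x u1 u2"
    unfolding ext_def using dird_commute_real[OF open_U x coef_diff(4) dif dif] by simp
  also have "\<dots> = ext (\<lambda>y w. - 2 * (b y)\<^sup>2 * \<eta>0 y w) x u1 u2"
    by (rule ext_cong_open[OF V]) (rule grad(1))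
  also have "\<dots> = - 2 * (b x)\<^sup>2 * ext \<eta>0 x u1 u2"
    using ext_scale[OF bb, of \<eta>0 u1 u2] diff(1)[OF x] u by simp
  also have "ext \<eta>0 x u1 u2 = 2 * b x"
    unfolding ext_\<eta>0[OF x] t1[OF x] wedge_def \<zeta>_eq[OF x] by (simp add: u)
  finally show False using bx by simp
qed

text \<open>Suppose \<open>b\<close> is nonzero and \<open>a\<close> moves along \<open>T\<close>.
  The derivative of the second relation in \<open>T_relations\<close> fixes the determinant
  \<open>De\<close>; inserted back, it forces \<open>c = s\<close> or trace zero, and trace zero
  gives \<open>c = s\<close> by the first relation. Then \<open>traceless_case\<close> excludes
  trace zero, and for nonzero trace the derivative of the first relation makes \<open>a\<close>
  stationary after all.\<close>

lemma branch:
  assumes x: "x \<in> U"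
  shows "b x * (a x - d x) = 0"
proof (cases "b x = 0")
  case False
  obtain u0 u1 u2 where u: "\<eta>0 x u0 = 1" "\<eta>1 x u0 = 0" "\<eta>2 x u0 = 0"
    "\<eta>0 x u1 = 0" "\<eta>1 x u1 = 1" "\<eta>2 x u1 = 0" "\<eta>0 x u2 = 0" "\<eta>1 x u2 = 0" "\<eta>2 x u2 = 1"
    by (rule dual_basis[OF x])
  define De where "De = k1 * k2 + k1 * k3 + k2 * k3"
  define H where "H = k1 + k2 + k3"
  define t where "t = s x / c x"
  define t' where "t' = c x / s x"
  have pos: "t > 0" "t' > 0" "c x * s x > 0" and inv: "t * t' = 1" using cs_pos[OF x] by (simp_all add: t_def t'_def)
  have tt: "c x * s x * (t + t') = 1" using tt'[OF x] by (simp add: t_def t'_def)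
  have t_eqs: "t * c x = s x" "t' * s x = c x" using cs_pos[OF x] by (simp_all add: t_def t'_def)
  have cs_d: "(\<lambda>y. c y * s y) differentiable (at x)" "dird (\<lambda>y. c y * s y) x u0 = 0"
    using dcs2[OF x, of u0] by (auto intro!: differentiable_mult cs_diff x simp: \<kappa>_zero[OF x])
  note td = t_diff[OF x] and ad = coef_diff(4)[OF x] and bd = coef_diff(5)[OF x] and dd = coef_diff(6)[OF x]
  have "dird a x u0 = 0"
  proof (rule ccontr)
    assume a0: "dird a x u0 \<noteq> 0"
    have "dird (\<lambda>y. De * (s y / c y * a y - c y / s y * d y) + c y * s y * (a y - d y)) x u0 = 0"
      unfolding De_def by (rule dird_eq_0_of_zero_on[OF open_U x T_relations(2)])
    also have "dird (\<lambda>y. De * (s y / c y * a y - c y / s y * d y) + c y * s y * (a y - d y)) x u0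
      = De * (t * dird a x u0 - t' * dird d x u0) + c x * s x * (dird a x u0 - dird d x u0)"
    proof -
      have 1: "(\<lambda>y. s y / c y * a y) differentiable (at x)" "(\<lambda>y. c y / s y * d y) differentiable (at x)"
        by (intro differentiable_mult td(1,2) ad dd)+
      have 2: "(\<lambda>y. s y / c y * a y - c y / s y * d y) differentiable (at x)" "(\<lambda>y. a y - d y) differentiable (at x)"
        by (intro differentiable_diff 1 ad dd)+
      show ?thesis
        unfolding dird_add[OF differentiable_mult[OF differentiable_const 2(1)] differentiable_mult[OF cs_d(1) 2(2)]]
          dird_mult[OF differentiable_const 2(1)] dird_mult[OF cs_d(1) 2(2)] dird_diff[OF 1] dird_diff[OF ad dd]
          dird_mult[OF td(1) ad] dird_mult[OF td(2) dd] td(3,4) cs_d(2)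
        by (simp add: t_def t'_def)
    qed
    finally have "dird a x u0 * (De * (t + t') + 2 * (c x * s x)) = 0"
      unfolding dtrace[OF x] by (simp add: algebra_simps)
    then have "De * (t + t') + 2 * (c x * s x) = 0" using a0 by simp
    then have De: "De = - 2 * (c x * s x)\<^sup>2" using tt by algebra
    have "De * (t * a x - t' * d x) + c x * s x * (a x - d x) = 0"
      using T_relations(2)[OF x] by (simp add: De_def t_def t'_def)
    then have "c x * s x * (((c x)\<^sup>2 - (s x)\<^sup>2) * (a x + d x)) = 0"
      using De t_eqs cs_1[OF x] by algebra
    then have "c x = s x \<or> H = 0"
      using pos(3) cs_pos[OF x] trace2[OF x] by (auto simp: H_def power2_eq_iff_nonneg)
    moreover have "c x = s x" if H: "H = 0"
    proof -
      have "d x = - a x" using trace2[OF x] H by (simp add: H_def)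
      then have "(t - t') * ((a x)\<^sup>2 + (b x)\<^sup>2) = 0"
        using T_relations(1)[OF x] unfolding t_def t'_def by (simp add: algebra_simps)
      moreover have "(a x)\<^sup>2 + (b x)\<^sup>2 > 0" using False by (simp add: sum_power2_gt_zero_iff)
      ultimately have "t = t'" by auto
      then show ?thesis unfolding t_def t'_def using ratio_eq cs_pos[OF x] by blast
    qed
    ultimately have cs: "c x = s x" by blast
    then have cs2: "c x * s x = 1 / 2" using cs_1[OF x] by (simp add: power2_eq_square)
    have t1: "t = 1" "t' = 1" using cs cs_pos[OF x] by (simp_all add: t_def t'_def)
    show False
    proof (cases "H = 0")
      case True
      then show False using traceless_case[OF _ _ x] De cs2 \<open>b x \<noteq> 0\<close> by (simp add: H_def De_def power2_eq_square)
    next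
      case False
      have sq: "(\<lambda>y. (a y)\<^sup>2 + (b y)\<^sup>2) differentiable (at x)" "(\<lambda>y. (b y)\<^sup>2 + (d y)\<^sup>2) differentiable (at x)"
        by (intro differentiable_add differentiable_power ad bd dd)+
      have "dird (\<lambda>y. s y / c y * ((a y)\<^sup>2 + (b y)\<^sup>2)) x u0 = dird (\<lambda>y. c y / s y * ((b y)\<^sup>2 + (d y)\<^sup>2)) x u0"
        by (rule dird_cong_open[OF open_U x T_relations(1)])
      then have "2 * a x * dird a x u0 + 2 * b x * dird b x u0 = 2 * b x * dird b x u0 + 2 * d x * dird d x u0"
        unfolding dird_mult[OF td(1) sq(1)] dird_mult[OF td(2) sq(2)] td(3,4)
          t_def[symmetric] t'_def[symmetric] t1
        using ad bd dd by (simp add: dird_add dird_power2 differentiable_power)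
      then have "dird a x u0 * (a x + d x) = 0" unfolding dtrace[OF x] by (simp add: algebra_simps)
      then show False using a0 False trace2[OF x] by (simp add: H_def)
    qed
  qed
  then show ?thesis using branch_of_stationary[OF x u(1-3) _ False] by simp
qed simp

text \<open>The derivatives of \<open>branch\<close> and of the determinant are two linear equations
  for those of \<open>a\<close> and \<open>b\<close>. By \<open>disc_nz\<close> exactly one of
  \<open>b\<close> and \<open>a - d\<close> vanishes, and the equations decouple.\<close>

theorem coefficients_stationary:
  assumes x: "x \<in> U"
  shows "dird a x v = 0" "dird b x v = 0" "dird d x v = 0"
proof -
  have "dird (\<lambda>y. b y * (a y - d y)) x v = 0" by (rule dird_eq_0_of_zero_on[OF open_U x branch])
  then have 1: "dird b x v * (a x - d x) + 2 * b x * dird a x v = 0"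
    using coef_diff[OF x] dtrace[OF x, of v] by (simp add: dird_mult dird_diff algebra_simps)
  have 2: "dird a x v * (d x - a x) = 2 * b x * dird b x v" by (rule ddet[OF x])
  consider "b x = 0" "a x \<noteq> d x" | "a x = d x" "b x \<noteq> 0" using branch[OF x] disc_nz[OF x] by auto
  then show "dird a x v = 0" "dird b x v = 0" using 1 2 by (cases; simp)+
  then show "dird d x v = 0" using dtrace[OF x] by simp
qed

text \<open>With vanishing derivatives the Riccati equations are algebraic. They decouple for
  \<open>b = 0\<close>; otherwise the off-diagonal one forces \<open>s / c = c / s\<close>.\<close>

theorem branch_values:
  assumes x: "x \<in> U"
  shows "b x = 0 \<and> (a x)\<^sup>2 = (c x)\<^sup>2 \<and> (d x)\<^sup>2 = (s x)\<^sup>2 \<or>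
    b x \<noteq> 0 \<and> a x = d x \<and> c x = s x \<and> (a x)\<^sup>2 - (b x)\<^sup>2 = 1 / 2"
proof -
  obtain u0 u1 u2 where u: "\<eta>0 x u0 = 1" "\<eta>1 x u0 = 0" "\<eta>2 x u0 = 0"
    "\<eta>0 x u1 = 0" "\<eta>1 x u1 = 1" "\<eta>2 x u1 = 0" "\<eta>0 x u2 = 0" "\<eta>1 x u2 = 0" "\<eta>2 x u2 = 1"
    by (rule dual_basis[OF x])
  note cod = codazzi_T[OF x u, unfolded coefficients_stationary[OF x]]
  define t where "t = s x / c x"
  define t' where "t' = c x / s x"
  have pos: "t > 0" "t' > 0" "c x * s x > 0" using cs_pos[OF x] by (simp_all add: t_def t'_def)
  have t_eqs: "t * c x = s x" "t' * s x = c x" using cs_pos[OF x] by (simp_all add: t_def t'_def)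
  have 1: "t * (a x)\<^sup>2 - t' * (b x)\<^sup>2 = c x * s x" and 2: "t * (a x * b x) = t' * (b x * d x)"
    and 3: "t * (b x)\<^sup>2 - t' * (d x)\<^sup>2 = - (c x * s x)"
    using cod(1-3) by (simp_all add: t_def t'_def)
  show ?thesis
  proof (cases "b x = 0")
    case True
    have "s x * ((a x)\<^sup>2 - (c x)\<^sup>2) = 0" "c x * ((d x)\<^sup>2 - (s x)\<^sup>2) = 0"
      using 1 3 t_eqs True by algebra+
    then show ?thesis using True cs_pos[OF x] by simp
  next
    case False
    then have ad: "a x = d x" using branch[OF x] by simp
    have "a x \<noteq> 0"
    proof
      assume "a x = 0"
      then have "t' * (b x)\<^sup>2 = - (c x * s x)" using 1 by simp
      moreover have "t' * (b x)\<^sup>2 \<ge> 0" using pos by simp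
      ultimately show False using pos by linarith
    qed
    then have "t = t'" using 2 False ad by simp
    then have cs: "c x = s x" unfolding t_def t'_def using ratio_eq cs_pos[OF x] by blast
    then have "c x * s x = 1 / 2" "t = 1" "t' = 1" using cs_1[OF x] cs_pos[OF x] by (simp_all add: power2_eq_square t_def t'_def)
    then show ?thesis using 1 False ad cs by simp
  qed
qed

end

section \<open>Adapted charts of a hypersurface\<close>

lemma kernel_imp_det_zero:
  fixes A B1 B2 a b d k :: real
  assumes "A * y0 + B1 * y1 + B2 * y2 = k * y0" "B1 * y0 + a * y1 + b * y2 = k * y1"
    "B2 * y0 + b * y1 + d * y2 = k * y2" and nz: "y0 \<noteq> 0 \<or> y1 \<noteq> 0 \<or> y2 \<noteq> 0"
  shows "(A - k) * (a - k) * (d - k) + 2 * B1 * B2 * b - (A - k) * b\<^sup>2 - (a - k) * B2\<^sup>2 - (d - k) * B1\<^sup>2 = 0"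
    (is "?D = 0")
proof -
  have "?D * y0 = 0" "?D * y1 = 0" "?D * y2 = 0" using assms(1-3) by algebra+
  then show ?thesis using nz by auto
qed

lemma vieta_cubic:
  fixes k1 k2 k3 :: real
  assumes distinct: "k1 \<noteq> k2" "k1 \<noteq> k3" "k2 \<noteq> k3"
    and root: "\<And>k. k \<in> {k1, k2, k3} \<Longrightarrow> k ^ 3 - t * k\<^sup>2 + m * k - D = 0"
  shows "t = k1 + k2 + k3" "m = k1 * k2 + k1 * k3 + k2 * k3" "D = k1 * k2 * k3"
proof -
  have r: "k1 ^ 3 - t * k1\<^sup>2 + m * k1 - D = 0" "k2 ^ 3 - t * k2\<^sup>2 + m * k2 - D = 0" "k3 ^ 3 - t * k3\<^sup>2 + m * k3 - D = 0"
    using root by auto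
  have "(k1 - k2) * (k1\<^sup>2 + k1 * k2 + k2\<^sup>2 - t * (k1 + k2) + m) = 0"
    "(k1 - k3) * (k1\<^sup>2 + k1 * k3 + k3\<^sup>2 - t * (k1 + k3) + m) = 0"
    using r by algebra+
  then have q: "k1\<^sup>2 + k1 * k2 + k2\<^sup>2 - t * (k1 + k2) + m = 0" "k1\<^sup>2 + k1 * k3 + k3\<^sup>2 - t * (k1 + k3) + m = 0"
    using distinct by auto
  then have "(k2 - k3) * (k1 + k2 + k3 - t) = 0" by algebra
  then show t: "t = k1 + k2 + k3" using distinct by auto
  show m: "m = k1 * k2 + k1 * k3 + k2 * k3" using q(1) unfolding t by algebra
  show "D = k1 * k2 * k3" using r(1) unfolding t m by algebra
qed

text \<open>The first basis vector times \<open>w\<close> is \<open>p + q\<close>, a sum of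
  eigenvectors for \<open>k\<close> and \<open>l\<close>, so the product of the matrix minus
  \<open>k\<close> and the matrix minus \<open>l\<close> annihilates it. The three equations are the
  components of this.\<close>

lemma two_eigenvectors:
  fixes A B1 B2 a b d k l w :: real
  assumes "w \<noteq> 0" "p0 + q0 = w" "p1 + q1 = 0" "p2 + q2 = 0"
    and "A * p0 + B1 * p1 + B2 * p2 = k * p0" "B1 * p0 + a * p1 + b * p2 = k * p1" "B2 * p0 + b * p1 + d * p2 = k * p2"
    and "A * q0 + B1 * q1 + B2 * q2 = l * q0" "B1 * q0 + a * q1 + b * q2 = l * q1" "B2 * q0 + b * q1 + d * q2 = l * q2"
  shows "A\<^sup>2 + B1\<^sup>2 + B2\<^sup>2 - (k + l) * A + k * l = 0"
    "A * B1 + B1 * a + B2 * b = (k + l) * B1" "A * B2 + B1 * b + B2 * d = (k + l) * B2"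
proof -
  have 1: "w * A = k * p0 + l * q0" "w * B1 = k * p1 + l * q1" "w * B2 = k * p2 + l * q2"
  proof -
    have q: "q1 = - p1" "q2 = - p2" "w = p0 + q0" using assms(2-4) by auto
    show "w * A = k * p0 + l * q0" "w * B1 = k * p1 + l * q1" "w * B2 = k * p2 + l * q2"
      using assms(5-10) unfolding q by (simp_all add: algebra_simps)
  qed
  have 2: "A * (k * p0 + l * q0) + B1 * (k * p1 + l * q1) + B2 * (k * p2 + l * q2) = k * (k * p0) + l * (l * q0)"
    "B1 * (k * p0 + l * q0) + a * (k * p1 + l * q1) + b * (k * p2 + l * q2) = k * (k * p1) + l * (l * q1)"
    "B2 * (k * p0 + l * q0) + b * (k * p1 + l * q1) + d * (k * p2 + l * q2) = k * (k * p2) + l * (l * q2)"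
  proof -
    have "A * (k * p0 + l * q0) + B1 * (k * p1 + l * q1) + B2 * (k * p2 + l * q2)
        = k * (A * p0 + B1 * p1 + B2 * p2) + l * (A * q0 + B1 * q1 + B2 * q2)" by algebra
    then show "A * (k * p0 + l * q0) + B1 * (k * p1 + l * q1) + B2 * (k * p2 + l * q2) = k * (k * p0) + l * (l * q0)"
      by (simp only: assms(5,8))
    have "B1 * (k * p0 + l * q0) + a * (k * p1 + l * q1) + b * (k * p2 + l * q2)
        = k * (B1 * p0 + a * p1 + b * p2) + l * (B1 * q0 + a * q1 + b * q2)" by algebra
    then show "B1 * (k * p0 + l * q0) + a * (k * p1 + l * q1) + b * (k * p2 + l * q2) = k * (k * p1) + l * (l * q1)"
      by (simp only: assms(6,9))
    have "B2 * (k * p0 + l * q0) + b * (k * p1 + l * q1) + d * (k * p2 + l * q2)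
        = k * (B2 * p0 + b * p1 + d * p2) + l * (B2 * q0 + b * q1 + d * q2)" by algebra
    then show "B2 * (k * p0 + l * q0) + b * (k * p1 + l * q1) + d * (k * p2 + l * q2) = k * (k * p2) + l * (l * q2)"
      by (simp only: assms(7,10))
  qed
  have "w * (A\<^sup>2 + B1\<^sup>2 + B2\<^sup>2 - (k + l) * A + k * l) = A * (w * A) + B1 * (w * B1) + B2 * (w * B2) - (k + l) * (w * A) + k * l * w"
    by algebra
  also have "\<dots> = 0" unfolding 1 2 by (simp add: assms(2)[symmetric] algebra_simps)
  finally show "A\<^sup>2 + B1\<^sup>2 + B2\<^sup>2 - (k + l) * A + k * l = 0" using assms(1) by simp
  have "w * (A * B1 + B1 * a + B2 * b - (k + l) * B1) = B1 * (w * A) + a * (w * B1) + b * (w * B2) - (k + l) * (w * B1)"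
    by algebra
  also have "\<dots> = 0" unfolding 1 2 using assms(3) by algebra
  finally show "A * B1 + B1 * a + B2 * b = (k + l) * B1" using assms(1) by simp
  have "w * (A * B2 + B1 * b + B2 * d - (k + l) * B2) = B2 * (w * A) + b * (w * B1) + d * (w * B2) - (k + l) * (w * B2)"
    by algebra
  also have "\<dots> = 0" unfolding 1 2 using assms(4) by algebra
  finally show "A * B2 + B1 * b + B2 * d = (k + l) * B2" using assms(1) by simp
qed

section \<open>A chart of the hypersurface seen in both factors\<close>

locale adapted_chart = F: factor_chart U P \<mu> + G: factor_chart U Q \<nu>
  for U :: "R3 set" and P Q \<mu> \<nu> :: "R3 \<Rightarrow> R3" +
  assumes unit: "x \<in> U \<Longrightarrow> lor (\<mu> x) (\<mu> x) + lor (\<nu> x) (\<nu> x) = 1"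
    and tang: "x \<in> U \<Longrightarrow> lor (\<mu> x) (dird P x u) + lor (\<nu> x) (dird Q x u) = 0"
    and imm: "x \<in> U \<Longrightarrow> dird P x u = 0 \<Longrightarrow> dird Q x u = 0 \<Longrightarrow> u = 0"
begin

definition "\<eta> x u = G.r x * F.\<alpha> x u - F.r x * G.\<alpha> x u"
text \<open>\<open>K\<close> is the differential of \<open>r\<close>, so for
  \<open>F.r = cos \<theta>\<close> and \<open>G.r = sin \<theta>\<close> this form is the
  differential of \<theta>.\<close>

definition "\<kappa> x u = F.r x * G.K x u - G.r x * F.K x u"

lemma r_sq_sum: "x \<in> U \<Longrightarrow> (F.r x)\<^sup>2 + (G.r x)\<^sup>2 = 1"
  by (simp add: F.r_sq G.r_sq unit)

lemma \<alpha>_eq: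
  assumes x: "x \<in> U"
  shows "F.\<alpha> x u = G.r x * \<eta> x u" "G.\<alpha> x u = - F.r x * \<eta> x u"
proof -
  have "F.r x * F.\<alpha> x u + G.r x * G.\<alpha> x u = 0"
    using tang[OF x, of u] F.mu_eq[OF x] G.mu_eq[OF x]
    by (simp add: F.\<alpha>_def G.\<alpha>_def lor_simps lor_sym[of "dird P x u"] lor_sym[of "dird Q x u"])
  then show "F.\<alpha> x u = G.r x * \<eta> x u" "G.\<alpha> x u = - F.r x * \<eta> x u"
    using r_sq_sum[OF x] unfolding \<eta>_def by algebra+
qed

lemma K_eq:
  assumes x: "x \<in> U"
  shows "F.K x u = - G.r x * \<kappa> x u" "G.K x u = F.r x * \<kappa> x u"
proof -
  have "dird (\<lambda>y. lor (\<mu> y) (\<mu> y) + lor (\<nu> y) (\<nu> y)) x u = 0"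
    by (rule dird_eq_0_of_zero_on[OF F.open_U x unit])
  then have "lor (dird \<mu> x u) (\<mu> x) + lor (\<mu> x) (dird \<mu> x u) + (lor (dird \<nu> x u) (\<nu> x) + lor (\<nu> x) (dird \<nu> x u)) = 0"
    unfolding dird_add[OF F.dird_lor(2)[OF F.dmu F.dmu, OF x x] G.dird_lor(2)[OF G.dmu G.dmu, OF x x]]
      F.dird_lor(1)[OF F.dmu F.dmu, OF x x] G.dird_lor(1)[OF G.dmu G.dmu, OF x x] .
  then have "lor (dird \<mu> x u) (\<mu> x) + lor (dird \<nu> x u) (\<nu> x) = 0"
    by (simp add: lor_sym[of "\<mu> x"] lor_sym[of "\<nu> x"])
  then have "F.r x * F.K x u + G.r x * G.K x u = 0"
    using F.mu_eq[OF x] G.mu_eq[OF x] by (simp add: F.K_def G.K_def lor_simps)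
  then show "F.K x u = - G.r x * \<kappa> x u" "G.K x u = F.r x * \<kappa> x u"
    using r_sq_sum[OF x] unfolding \<kappa>_def by algebra+
qed

lemma dP_frame: "x \<in> U \<Longrightarrow> dird P x u = (G.r x * \<eta> x u) *\<^sub>R F.n x + F.\<beta> x u *\<^sub>R F.m x"
  and dQ_frame: "x \<in> U \<Longrightarrow> dird Q x u = (- F.r x * \<eta> x u) *\<^sub>R G.n x + G.\<beta> x u *\<^sub>R G.m x"
  by (simp_all add: F.dP_eq G.dP_eq \<alpha>_eq)

text \<open>Self-adjointness of the shape operator: \<open>tang\<close> is differentiated once more,
  and the second derivatives of \<open>P\<close> and \<open>Q\<close> are symmetric.\<close>

lemma symmetric_forms:
  assumes x: "x \<in> U"
  shows "wedge \<kappa> \<eta> x v u + wedge F.Z F.\<beta> x v u + wedge G.Z G.\<beta> x v u = 0"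
proof -
  have *: "lor (dird \<mu> x v) (dird P x u) + lor (\<mu> x) (dird (\<lambda>y. dird P y u) x v)
    + (lor (dird \<nu> x v) (dird Q x u) + lor (\<nu> x) (dird (\<lambda>y. dird Q y u) x v)) = 0" for u v
  proof -
    have "dird (\<lambda>y. lor (\<mu> y) (dird P y u) + lor (\<nu> y) (dird Q y u)) x v = 0"
      by (rule dird_eq_0_of_zero_on[OF F.open_U x tang])
    then show ?thesis
      unfolding dird_add[OF F.dird_lor(2)[OF F.dmu F.ddP, OF x x] G.dird_lor(2)[OF G.dmu G.ddP, OF x x]]
        F.dird_lor(1)[OF F.dmu F.ddP, OF x x] G.dird_lor(1)[OF G.dmu G.ddP, OF x x] .
  qed
  have f: "lor (dird \<mu> x v) (dird P x u) = F.K x v * F.\<alpha> x u - F.Z x v * F.\<beta> x u" for u v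
    by (simp add: F.dmu_eq[OF x] F.dP_eq[OF x] lor_simps F.PP[OF x] F.nn[OF x] F.nP[OF x] F.mm[OF x] F.mP F.mn F.frame'(1)[OF x] F.frame'(2,3) algebra_simps)
  have g: "lor (dird \<nu> x v) (dird Q x u) = G.K x v * G.\<alpha> x u - G.Z x v * G.\<beta> x u" for u v
    by (simp add: G.dmu_eq[OF x] G.dP_eq[OF x] lor_simps G.PP[OF x] G.nn[OF x] G.nP[OF x] G.mm[OF x] G.mP G.mn G.frame'(1)[OF x] G.frame'(2,3) algebra_simps)
  have "F.K x v * F.\<alpha> x u - F.Z x v * F.\<beta> x u + (G.K x v * G.\<alpha> x u - G.Z x v * G.\<beta> x u)
    = F.K x u * F.\<alpha> x v - F.Z x u * F.\<beta> x v + (G.K x u * G.\<alpha> x v - G.Z x u * G.\<beta> x v)"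
    using *[of v u] *[of u v] F.commP[OF x, of u v] G.commP[OF x, of u v] unfolding f g by simp
  then show ?thesis using r_sq_sum[OF x] unfolding \<alpha>_eq[OF x] K_eq[OF x] wedge_def by algebra
qed

lemma ext_\<eta>:
  assumes x: "x \<in> U"
  shows "ext \<eta> x v u = - (G.r x / F.r x) * wedge F.Z F.\<beta> x v u + (F.r x / G.r x) * wedge G.Z G.\<beta> x v u"
proof -
  have "ext \<eta> x v u = ext (\<lambda>y u. G.r y * F.\<alpha> y u + (- F.r y) * G.\<alpha> y u) x v u"
    by (simp add: \<eta>_def[abs_def])
  also have "\<dots> = (dird G.r x v * F.\<alpha> x u - dird G.r x u * F.\<alpha> x v + G.r x * ext F.\<alpha> x v u)
     + (dird (\<lambda>y. - F.r y) x v * G.\<alpha> x u - dird (\<lambda>y. - F.r y) x u * G.\<alpha> x v + (- F.r x) * ext G.\<alpha> x v u)"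
    by (subst ext_add; (subst ext_scale)?; (subst ext_scale)?;
      (intro differentiable_mult differentiable_minus F.form_diff G.form_diff F.dr(1) G.dr(1) x)?; (rule refl)?)
  also have "\<dots> = G.r x * (wedge F.\<beta> F.Z x v u / F.r x) - F.r x * (wedge G.\<beta> G.Z x v u / G.r x)"
    unfolding dird_minus[OF F.dr(1)[OF x]] F.dr(2)[OF x] G.dr(2)[OF x] \<alpha>_eq[OF x] K_eq[OF x]
      F.structure_equations[OF x] G.structure_equations[OF x] by (simp add: algebra_simps)
  finally show ?thesis unfolding wedge_def by (simp add: algebra_simps diff_divide_distrib)
qed

lemma ext_\<kappa>:
  assumes x: "x \<in> U" shows "ext \<kappa> x v u = 0"
proof -
  have "ext \<kappa> x v u = ext (\<lambda>y u. F.r y * G.K y u + (- G.r y) * F.K y u) x v u"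
    by (simp add: \<kappa>_def[abs_def])
  also have "\<dots> = (dird F.r x v * G.K x u - dird F.r x u * G.K x v + F.r x * ext G.K x v u)
     + (dird (\<lambda>y. - G.r y) x v * F.K x u - dird (\<lambda>y. - G.r y) x u * F.K x v + (- G.r x) * ext F.K x v u)"
    by (subst ext_add; (subst ext_scale)?; (subst ext_scale)?;
      (intro differentiable_mult differentiable_minus F.form_diff G.form_diff F.dr(1) G.dr(1) x)?; (rule refl)?)
  also have "\<dots> = 0"
    unfolding dird_minus[OF G.dr(1)[OF x]] F.dr(2)[OF x] G.dr(2)[OF x] K_eq[OF x]
      F.structure_equations[OF x] G.structure_equations[OF x] by (simp add: algebra_simps)
  finally show ?thesis .
qed

sublocale structure_eqs U F.r G.r \<eta> F.\<beta> G.\<beta> \<kappa> F.Z G.Z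
proof (rule structure_eqs.intro)
  show "open U" by (rule F.open_U)
  fix x u v assume x: "x \<in> U"
  note rp = F.r_pos[OF x] G.r_pos[OF x]
  show "linear (\<eta> x)" "linear (\<kappa> x)"
    using F.form_linear[OF x] G.form_linear[OF x]
    by (auto simp: \<eta>_def[abs_def] \<kappa>_def[abs_def] linear_iff algebra_simps)
  show "linear (F.\<beta> x)" "linear (G.\<beta> x)" "linear (F.Z x)" "linear (G.Z x)"
    using F.form_linear[OF x] G.form_linear[OF x] by auto
  show "(\<lambda>y. \<eta> y u) differentiable (at x)" "(\<lambda>y. \<kappa> y u) differentiable (at x)"
    unfolding \<eta>_def \<kappa>_def
    by (intro differentiable_diff differentiable_mult F.form_diff G.form_diff F.dr G.dr x)+
  show "(\<lambda>y. F.\<beta> y u) differentiable (at x)" "(\<lambda>y. G.\<beta> y u) differentiable (at x)"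
    "(\<lambda>y. F.Z y u) differentiable (at x)" "(\<lambda>y. G.Z y u) differentiable (at x)"
    "F.r differentiable (at x)" "G.r differentiable (at x)"
    by (intro F.form_diff G.form_diff F.dr G.dr x)+
  show "0 < F.r x" "0 < G.r x" by fact+
  show "(F.r x)\<^sup>2 + (G.r x)\<^sup>2 = 1" by (rule r_sq_sum[OF x])
  show "dird F.r x v = - G.r x * \<kappa> x v" "dird G.r x v = F.r x * \<kappa> x v"
    by (simp_all add: F.dr(2)[OF x] G.dr(2)[OF x] K_eq[OF x])
  show "ext \<eta> x v u = - (G.r x / F.r x) * wedge F.Z F.\<beta> x v u + (F.r x / G.r x) * wedge G.Z G.\<beta> x v u"
    by (rule ext_\<eta>[OF x])
  show "ext F.\<beta> x v u = - (G.r x / F.r x) * wedge \<eta> F.Z x v u"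
    unfolding F.structure_equations[OF x] wedge_def \<alpha>_eq[OF x] by (simp add: algebra_simps diff_divide_distrib)
  show "ext G.\<beta> x v u = (F.r x / G.r x) * wedge \<eta> G.Z x v u"
    unfolding G.structure_equations[OF x] wedge_def \<alpha>_eq[OF x] by (simp add: algebra_simps diff_divide_distrib)
  show "ext \<kappa> x v u = 0" by (rule ext_\<kappa>[OF x])
  show "ext F.Z x v u = - (G.r x / F.r x) * wedge \<kappa> F.Z x v u - F.r x * G.r x * wedge \<eta> F.\<beta> x v u"
    unfolding F.structure_equations[OF x] wedge_def \<alpha>_eq[OF x] K_eq[OF x] by (simp add: algebra_simps diff_divide_distrib)
  show "ext G.Z x v u = (F.r x / G.r x) * wedge \<kappa> G.Z x v u + F.r x * G.r x * wedge \<eta> G.\<beta> x v u"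
    unfolding G.structure_equations[OF x] wedge_def \<alpha>_eq[OF x] K_eq[OF x] by (simp add: algebra_simps diff_divide_distrib)
  show "wedge \<kappa> \<eta> x v u + wedge F.Z F.\<beta> x v u + wedge G.Z G.\<beta> x v u = 0"
    by (rule symmetric_forms[OF x])
  assume "\<eta> x u = 0" "F.\<beta> x u = 0" "G.\<beta> x u = 0"
  then show "u = 0" using imm[OF x, of u] dP_frame[OF x, of u] dQ_frame[OF x, of u] by simp
qed

end

text \<open>The factor \<open>(p$1)\<^sup>2\<close> allows \<open>w$1\<close> to be eliminated
  through orthogonality to \<open>p\<close>, after which \<open>lor w w\<close> becomes a sum of
  squares.\<close>

lemma lor_spacelike:
  assumes "lor p p = -1" "lor w p = 0"
  shows "lor w w \<ge> 0" "lor w w = 0 \<Longrightarrow> w = 0"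
proof -
  have id: "(p$1)\<^sup>2 * lor w w = (w$2)\<^sup>2 + (w$3)\<^sup>2 + (w$2 * p$3 - w$3 * p$2)\<^sup>2"
    using assms unfolding lor_def by algebra
  have p1: "(p$1)\<^sup>2 = 1 + (p$2)\<^sup>2 + (p$3)\<^sup>2" using assms(1) unfolding lor_def by algebra
  then have pos: "(p$1)\<^sup>2 > 0" by (smt (verit) zero_le_power2)
  have "(p$1)\<^sup>2 * lor w w \<ge> 0" unfolding id by simp
  then show "lor w w \<ge> 0" using pos by (simp add: zero_le_mult_iff)
  assume "lor w w = 0"
  then have "(w$2)\<^sup>2 + (w$3)\<^sup>2 + (w$2 * p$3 - w$3 * p$2)\<^sup>2 = 0" using id by simp
  then have w: "w$2 = 0" "w$3 = 0" by (smt (verit) zero_le_power2 power2_eq_iff_nonneg power_zero_numeral zero_eq_power2)+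
  then have "w$1 * p$1 = 0" using assms(2) unfolding lor_def by simp
  then have "w$1 = 0" using pos by auto
  then show "w = 0" using w by (simp add: vec_eq_iff forall_3)
qed

lemma smooth_on_C2:
  assumes "smooth_on f S" "x \<in> S"
  shows "f differentiable (at x)" "(\<lambda>y. dird f y v) differentiable (at x)"
proof -
  have "Ck_on (Suc (Suc 0)) f S" using assms(1) unfolding smooth_on_def by blast
  then show "f differentiable (at x)" "(\<lambda>y. dird f y v) differentiable (at x)" using assms(2) by auto
qed

lemma smooth_on_open: "smooth_on f S \<Longrightarrow> open S"
  by (simp add: smooth_on_def)

text \<open>In the chain rule the direction \<open>dird f y u\<close> varies with \<open>y\<close>.
  Expanding it in a basis reduces the second derivative to products of differentiable
  functions.\<close>

lemma C2_compose:
  fixes f :: "'a::real_normed_vector \<Rightarrow> 'b::euclidean_space" and g :: "'b \<Rightarrow> 'c::real_normed_vector"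
  assumes U: "open U" "x \<in> U" and f: "\<And>y. y \<in> U \<Longrightarrow> f differentiable (at y)" "(\<lambda>y. dird f y u) differentiable (at x)"
    and g: "\<And>y. y \<in> U \<Longrightarrow> g differentiable (at (f y))" "\<And>v. (\<lambda>z. dird g z v) differentiable (at (f x))"
  shows "dird (\<lambda>y. g (f y)) x u = dird g (f x) (dird f x u)"
    "(\<lambda>y. g (f y)) differentiable (at x)" "(\<lambda>y. dird (\<lambda>y. g (f y)) y u) differentiable (at x)"
proof -
  have c: "((\<lambda>y. g (f y)) has_derivative (\<lambda>u. dird g (f y) (dird f y u))) (at y)" if "y \<in> U" for y
    using has_derivative_compose[OF has_derivative_dird[OF f(1)] has_derivative_dird[OF g(1)], OF that that] .
  show "dird (\<lambda>y. g (f y)) x u = dird g (f x) (dird f x u)" using dird_eq[OF c[OF U(2)]] .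
  show "(\<lambda>y. g (f y)) differentiable (at x)" using c[OF U(2)] unfolding differentiable_def by blast
  show "(\<lambda>y. dird (\<lambda>y. g (f y)) y u) differentiable (at x)"
  proof (rule differentiable_cong_open[OF U])
    fix y assume y: "y \<in> U"
    have "dird (\<lambda>y. g (f y)) y u = dird g (f y) (dird f y u)" using dird_eq[OF c[OF y]] .
    also have "\<dots> = dird g (f y) (\<Sum>b\<in>Basis. (dird f y u \<bullet> b) *\<^sub>R b)" by (simp add: euclidean_representation)
    also have "\<dots> = (\<Sum>b\<in>Basis. (dird f y u \<bullet> b) *\<^sub>R dird g (f y) b)"
      using linear_dird[OF g(1)[OF y]] by (simp add: linear_sum linear_scale o_def)
    finally show "(\<Sum>b\<in>Basis. (dird f y u \<bullet> b) *\<^sub>R dird g (f y) b) = dird (\<lambda>y. g (f y)) y u" by simp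
  next
    have 1: "(\<lambda>y. dird f y u \<bullet> b) differentiable (at x)" for b
      using has_derivative_inner_left[OF has_derivative_dird[OF f(2)]] unfolding differentiable_def by blast
    have 2: "(\<lambda>y. dird g (f y) b) differentiable (at x)" for b
      using has_derivative_compose[OF has_derivative_dird[OF f(1)[OF U(2)]] has_derivative_dird[OF g(2)]]
      unfolding differentiable_def by blast
    show "(\<lambda>y. \<Sum>b\<in>Basis. (dird f y u \<bullet> b) *\<^sub>R dird g (f y) b) differentiable (at x)"
      by (intro differentiable_sum ballI finite_Basis dird_scaleR(2) 1 2)
  qed
qed

section \<open>Curves in the hypersurface, extensions of the normal, charts\<close>

lemma curve_through_eventually:
  assumes "curve_through M p X \<gamma>" "open W" "p \<in> W"
  shows "\<forall>\<^sub>F t in at 0. \<gamma> t \<in> M \<inter> W"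
proof -
  obtain e where e: "e > 0" "\<gamma> ` ball 0 e \<subseteq> M" and \<gamma>: "\<gamma> 0 = p" "(\<gamma> has_vector_derivative X) (at 0)"
    using assms(1) unfolding curve_through_def by blast
  have "isCont \<gamma> 0" using has_vector_derivative_continuous[OF \<gamma>(2)] .
  then have "\<forall>\<^sub>F t in at 0. \<gamma> t \<in> W" using assms(2,3) \<gamma>(1) unfolding isCont_def tendsto_def by auto
  moreover have "\<forall>\<^sub>F t in at 0. \<gamma> t \<in> M"
    unfolding eventually_at using e by (auto intro!: exI[of _ e] simp: dist_commute)
  ultimately show ?thesis by eventually_elim auto
qed

lemma curve_derivative:
  fixes g :: "R6 \<Rightarrow> 'b::real_normed_vector"
  assumes "curve_through M p X \<gamma>" "g differentiable (at p)"
  shows "((\<lambda>t. g (\<gamma> t)) has_vector_derivative dird g p X) (at 0)"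
proof -
  have \<gamma>: "\<gamma> 0 = p" "(\<gamma> has_derivative (\<lambda>h. h *\<^sub>R X)) (at 0)"
    using assms(1) unfolding curve_through_def has_vector_derivative_def by auto
  have "(g has_derivative dird g p) (at (\<gamma> 0))" using has_derivative_dird[OF assms(2)] \<gamma>(1) by simp
  from has_derivative_compose[OF \<gamma>(2) this] show ?thesis
    unfolding has_vector_derivative_def using linear_dird[OF assms(2)] by (simp add: linear_scale)
qed

text \<open>A field such as \<open>N\<close> is controlled only on \<open>M\<close>. Its derivative
  along a curve is taken through a local extension \<open>g\<close>, with which it agrees because
  the curve stays in \<open>M\<close> and in \<open>W\<close> near 0.\<close>

lemma curve_derivative_along:
  fixes g h :: "R6 \<Rightarrow> 'b::real_normed_vector"
  assumes c: "curve_through M p X \<gamma>" and g: "g differentiable (at p)" and W: "open W" "p \<in> W" and p: "p \<in> M"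
    and eq: "\<And>q. q \<in> M \<inter> W \<Longrightarrow> h q = g q"
  shows "((\<lambda>t. h (\<gamma> t)) has_vector_derivative dird g p X) (at 0)"
proof -
  have \<gamma>0: "\<gamma> 0 = p" using c unfolding curve_through_def by blast
  have ev: "\<forall>\<^sub>F t in at 0. g (\<gamma> t) = h (\<gamma> t)"
    using curve_through_eventually[OF c W] by eventually_elim (use eq in auto)
  show ?thesis
    using has_derivative_transform_eventually[OF curve_derivative[OF c g, unfolded has_vector_derivative_def] ev]
      eq[of p] p W(2) \<gamma>0 unfolding has_vector_derivative_def by simp
qed

lemma dird_zero_along:
  fixes g :: "R6 \<Rightarrow> 'b::real_normed_vector"
  assumes X: "X \<in> tangent_space M p" and g: "g differentiable (at p)" and W: "open W" "p \<in> W" and p: "p \<in> M"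
    and eq: "\<And>q. q \<in> M \<inter> W \<Longrightarrow> g q = k"
  shows "dird g p X = 0"
proof -
  obtain \<gamma> where c: "curve_through M p X \<gamma>" using X unfolding tangent_space_def by blast
  have "((\<lambda>t. k) has_vector_derivative dird g p X) (at 0)"
    by (rule curve_derivative_along[OF c g W p]) (simp add: eq)
  then show ?thesis using has_vector_derivative_const vector_derivative_unique_at by blast
qed

text \<open>Removes the arbitrary choice of a curve: every curve with velocity \<open>X\<close>
  gives the derivative of the extension in the direction \<open>X\<close>.\<close>

lemma shape_op_extension:
  assumes "p \<in> M" "p \<in> W" "smooth_on Ne W" "\<And>x. x \<in> M \<inter> W \<Longrightarrow> Ne x = N x" and X: "X \<in> tangent_space M p"
  shows "shape_op M N p X = - amb_proj p (dird Ne p X)"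
proof -
  define \<gamma> where "\<gamma> = (SOME \<gamma>. curve_through M p X \<gamma>)"
  obtain \<gamma>' where "curve_through M p X \<gamma>'" using X unfolding tangent_space_def by blast
  then have c: "curve_through M p X \<gamma>" unfolding \<gamma>_def by (rule someI[of "curve_through M p X"])
  have "((\<lambda>t. N (\<gamma> t)) has_vector_derivative dird Ne p X) (at 0)"
    by (rule curve_derivative_along[OF c smooth_on_C2(1)[OF assms(3,2)] smooth_on_open[OF assms(3)] assms(2,1)])
      (simp add: assms(4))
  then have "vector_derivative (N \<circ> \<gamma>) (at 0) = dird Ne p X"
    by (simp add: vector_derivative_at o_def)
  then show ?thesis unfolding shape_op_def \<gamma>_def by simp
qed

lemma amb_proj_linear: "linear (amb_proj p)"
  by (auto simp: linear_iff amb_proj_def lor_simps algebra_simps)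

text \<open>Keeps what the moving frame needs: two derivatives of \<phi> and of
  \<open>N \<circ> \<phi>\<close>, and the shape operator as a derivative of
  \<open>N \<circ> \<phi>\<close>. Openness of images carries local statements from the chart back
  to \<open>M\<close>.\<close>

definition is_chart :: "R6 set \<Rightarrow> (R6 \<Rightarrow> R6) \<Rightarrow> R3 set \<Rightarrow> (R3 \<Rightarrow> R6) \<Rightarrow> bool" where
  "is_chart M N U \<phi> \<longleftrightarrow> open U \<and> \<phi> ` U \<subseteq> M \<and> inj_on \<phi> U \<and> continuous_on U \<phi> \<and>
    (\<forall>V. open V \<longrightarrow> V \<subseteq> U \<longrightarrow> openin (top_of_set M) (\<phi> ` V)) \<and>
    (\<forall>x\<in>U. \<phi> differentiable (at x) \<and> (\<forall>u. (\<lambda>y. dird \<phi> y u) differentiable (at x)) \<and>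
      (\<lambda>y. N (\<phi> y)) differentiable (at x) \<and> (\<forall>u. (\<lambda>y. dird (\<lambda>y. N (\<phi> y)) y u) differentiable (at x)) \<and>
      inj (dird \<phi> x) \<and> (\<forall>u. dird \<phi> x u \<in> tangent_space M (\<phi> x) \<and>
        shape_op M N (\<phi> x) (dird \<phi> x u) = - amb_proj (\<phi> x) (dird (\<lambda>y. N (\<phi> y)) x u)))"

lemma chart_exists:
  assumes "hypersurface M" "smooth_along M N" "p \<in> M"
  obtains U \<phi> x where "is_chart M N U \<phi>" "x \<in> U" "\<phi> x = p"
proof -
  obtain U W \<psi> and \<phi> :: "R3 \<Rightarrow> R6" where W: "open W" "p \<in> W" and \<phi>: "smooth_on \<phi> U" and hom: "homeomorphism U (M \<inter> W) \<phi> \<psi>"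
    and inj: "\<forall>u\<in>U. inj (dird \<phi> u)"
    using assms(1)[unfolded hypersurface_def, THEN conjunct2, THEN bspec, OF assms(3)]
    by (elim exE conjE) (rule that)
  obtain W2 Ne where W2: "p \<in> W2" "smooth_on Ne W2" "\<forall>x\<in>M \<inter> W2. Ne x = N x"
    using assms(2)[unfolded smooth_along_def, THEN bspec, OF assms(3)] by (elim exE conjE) (rule that)
  note oW2 = smooth_on_open[OF W2(2)] and oU = smooth_on_open[OF \<phi>]
  have cont: "continuous_on U \<phi>" and im: "\<phi> ` U = M \<inter> W" and inv: "\<And>x. x \<in> U \<Longrightarrow> \<psi> (\<phi> x) = x"
    using hom unfolding homeomorphism_def by auto
  \<comment> \<open>The chart is shrunk to where the normal has a smooth extension.\<close>
  define V where "V = \<phi> -` W2 \<inter> U"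
  have "open V" unfolding V_def using continuous_on_open_vimage[OF oU, of \<phi>] cont oW2 by blast
  then have V: "open V" "V \<subseteq> U" unfolding V_def by blast+
  have "p \<in> \<phi> ` U" unfolding im using assms(3) W(2) by simp
  then obtain x where x: "x \<in> U" "\<phi> x = p" by (elim imageE) simp
  then have xV: "x \<in> V" using W2(1) by (simp add: V_def)
  have in_W2: "\<phi> y \<in> M \<inter> W2" if "y \<in> V" for y using that im by (auto simp: V_def)
  have "is_chart M N V \<phi>"
    unfolding is_chart_def
  proof (intro conjI allI impI ballI)
    show "open V" by fact
    show "\<phi> ` V \<subseteq> M" using im V by blast
    show "inj_on \<phi> V" using inv V by (metis inj_onI subsetD)
    show "continuous_on V \<phi>" using cont V continuous_on_subset by blast
    fix T assume T: "open T" "T \<subseteq> V"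
    have "openin (top_of_set U) T" using T V by (meson open_subset order_trans)
    then have "openin (top_of_set (M \<inter> W)) (\<phi> ` T)" using homeomorphism_imp_open_map[OF hom] by blast
    then show "openin (top_of_set M) (\<phi> ` T)"
      using openin_trans openin_open_Int[OF W(1)] by blast
  next
    fix y assume y: "y \<in> V"
    then have yU: "y \<in> U" using V by blast
    show "\<phi> differentiable (at y)" by (rule smooth_on_C2(1)[OF \<phi> yU])
    show "inj (dird \<phi> y)" using inj yU by blast
    fix u
    show d2: "(\<lambda>y. dird \<phi> y u) differentiable (at y)" for u by (rule smooth_on_C2(2)[OF \<phi> yU])
    have C: "dird (\<lambda>y. Ne (\<phi> y)) z u = dird Ne (\<phi> z) (dird \<phi> z u)"
      "(\<lambda>y. Ne (\<phi> y)) differentiable (at z)" "(\<lambda>y. dird (\<lambda>y. Ne (\<phi> y)) y u) differentiable (at z)"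
      if z: "z \<in> V" for z u
      using C2_compose[OF V(1) z, of \<phi> u Ne] smooth_on_C2[OF \<phi>] smooth_on_C2[OF W2(2)] in_W2 V(2) z
      by (auto simp: subset_iff)
    have eq: "Ne (\<phi> z) = N (\<phi> z)" if "z \<in> V" for z using in_W2[OF that] W2(3) by blast
    have deq: "dird (\<lambda>y. Ne (\<phi> y)) z w = dird (\<lambda>y. N (\<phi> y)) z w" if z: "z \<in> V" for z w
      by (rule dird_cong_open[OF V(1) z]) (rule eq)
    show "(\<lambda>y. N (\<phi> y)) differentiable (at y)"
      by (rule differentiable_cong_open[OF V(1) y _ C(2)[OF y]]) (rule eq)
    show "(\<lambda>y. dird (\<lambda>y. N (\<phi> y)) y u) differentiable (at y)"
      by (rule differentiable_cong_open[OF V(1) y _ C(3)[OF y]]) (rule deq)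
    show tan: "dird \<phi> y u \<in> tangent_space M (\<phi> y)"
    proof -
      obtain d where d: "d > 0" "ball y d \<subseteq> U" using oU yU openE by blast
      \<comment> \<open>Small enough for the segment to stay in the ball; the added 1 covers
        \<open>u = 0\<close>.\<close>
      define e where "e = d / (norm u + 1)"
      have e: "e > 0" using d by (simp add: e_def add_nonneg_pos)
      have n1: "norm u + 1 > 0" by (simp add: add_nonneg_pos)
      have "y + t *\<^sub>R u \<in> U" if "t \<in> ball 0 e" for t
      proof -
        have t: "\<bar>t\<bar> < e" using that by simp
        have "norm (t *\<^sub>R u) \<le> \<bar>t\<bar> * (norm u + 1)" by (simp add: algebra_simps)
        also have "\<dots> < e * (norm u + 1)" using t n1 by (rule mult_strict_right_mono)
        also have "\<dots> = d" using n1 by (simp add: e_def)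
        finally show ?thesis using d(2) by (auto simp: dist_norm)
      qed
      then have "(\<lambda>t. \<phi> (y + t *\<^sub>R u)) ` ball 0 e \<subseteq> M" using im by blast
      moreover have "((\<lambda>t. \<phi> (y + t *\<^sub>R u)) has_vector_derivative dird \<phi> y u) (at 0)"
      proof -
        have 1: "((\<lambda>t. y + t *\<^sub>R u) has_derivative (\<lambda>h. h *\<^sub>R u)) (at 0)"
          by (auto intro!: derivative_eq_intros)
        have 2: "(\<phi> has_derivative dird \<phi> y) (at (y + 0 *\<^sub>R u))"
          using has_derivative_dird[OF smooth_on_C2(1)[OF \<phi> yU]] by simp
        show ?thesis using has_derivative_compose[OF 1 2] linear_dird[OF smooth_on_C2(1)[OF \<phi> yU]]
          unfolding has_vector_derivative_def by (simp add: linear_scale)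
      qed
      ultimately show ?thesis unfolding tangent_space_def curve_through_def using e by (auto intro!: exI[of _ "\<lambda>t. \<phi> (y + t *\<^sub>R u)"])
    qed
    have "shape_op M N (\<phi> y) (dird \<phi> y u) = - amb_proj (\<phi> y) (dird Ne (\<phi> y) (dird \<phi> y u))"
      using shape_op_extension[OF _ _ W2(2) _ tan] in_W2[OF y] W2(3) by blast
    then show "shape_op M N (\<phi> y) (dird \<phi> y u) = - amb_proj (\<phi> y) (dird (\<lambda>y. N (\<phi> y)) y u)"
      using C(1)[OF y] deq[OF y] by simp
  qed
  then show ?thesis using that xV x(2) by blast
qed

section \<open>Constancy of the invariants\<close>

lemma is_chart_subset:
  assumes c: "is_chart M N U \<phi>" and V: "open V" "V \<subseteq> U"
  shows "is_chart M N V \<phi>"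
  unfolding is_chart_def
proof (intro conjI)
  note c = c[unfolded is_chart_def]
  show "open V" by fact
  show "\<phi> ` V \<subseteq> M" using image_mono[OF V(2)] conjunct1[OF conjunct2[OF c]] by (rule order_trans)
  show "inj_on \<phi> V" using conjunct1[OF conjunct2[OF conjunct2[OF c]]] V(2) by (rule inj_on_subset)
  show "continuous_on V \<phi>"
    using conjunct1[OF conjunct2[OF conjunct2[OF conjunct2[OF c]]]] V(2) by (rule continuous_on_subset)
  note c' = conjunct2[OF conjunct2[OF conjunct2[OF conjunct2[OF c]]]]
  show "\<forall>T. open T \<longrightarrow> T \<subseteq> V \<longrightarrow> openin (top_of_set M) (\<phi> ` T)"
    using conjunct1[OF c'] V(2) by (meson order_trans)
  show "\<forall>x\<in>V. \<phi> differentiable (at x) \<and> (\<forall>u. (\<lambda>y. dird \<phi> y u) differentiable (at x)) \<and>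
      (\<lambda>y. N (\<phi> y)) differentiable (at x) \<and> (\<forall>u. (\<lambda>y. dird (\<lambda>y. N (\<phi> y)) y u) differentiable (at x)) \<and>
      inj (dird \<phi> x) \<and> (\<forall>u. dird \<phi> x u \<in> tangent_space M (\<phi> x) \<and>
        shape_op M N (\<phi> x) (dird \<phi> x u) = - amb_proj (\<phi> x) (dird (\<lambda>y. N (\<phi> y)) x u))"
    by (rule ballI) (rule bspec[OF conjunct2[OF c'] subsetD[OF V(2)]])
qed

lemma parallel_eigenvectors:
  fixes L :: "'a::real_vector \<Rightarrow> 'a"
  assumes "linear L" "L X = k *\<^sub>R X" "L X' = k' *\<^sub>R X'" "X = y *\<^sub>R Z" "X' = y' *\<^sub>R Z" "X \<noteq> 0" "X' \<noteq> 0"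
  shows "k = k'"
proof -
  have nz: "y \<noteq> 0" "y' \<noteq> 0" "Z \<noteq> 0" using assms(4-7) by auto
  have "y *\<^sub>R L Z = y *\<^sub>R (k *\<^sub>R Z)" "y' *\<^sub>R L Z = y' *\<^sub>R (k' *\<^sub>R Z)"
    using assms(1-5) by (simp_all add: linear_scale mult.commute)
  then have "L Z = k *\<^sub>R Z" "L Z = k' *\<^sub>R Z" using nz by (simp_all only: scaleR_cancel_left simp_thms)
  then show ?thesis using nz by simp
qed

lemma dird_fst: "f differentiable (at x) \<Longrightarrow> dird (\<lambda>y. fst (f y)) x v = fst (dird f x v)"
  "f differentiable (at x) \<Longrightarrow> (\<lambda>y. fst (f y)) differentiable (at x)"
  and dird_snd: "f differentiable (at x) \<Longrightarrow> dird (\<lambda>y. snd (f y)) x v = snd (dird f x v)"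
  "f differentiable (at x) \<Longrightarrow> (\<lambda>y. snd (f y)) differentiable (at x)"
  using dird_linear_compose[OF bounded_linear_fst] dird_linear_compose[OF bounded_linear_snd] by blast+

text \<open>This and the next five definitions give the chart frame as functions of the point
  through \<open>N\<close> alone, so overlapping charts agree automatically.\<close>

definition cN :: "(R6 \<Rightarrow> R6) \<Rightarrow> R6 \<Rightarrow> real" where "cN N p = sqrt (lor (fst (N p)) (fst (N p)))"
definition sN :: "(R6 \<Rightarrow> R6) \<Rightarrow> R6 \<Rightarrow> real" where "sN N p = sqrt (lor (snd (N p)) (snd (N p)))"
definition n1 :: "(R6 \<Rightarrow> R6) \<Rightarrow> R6 \<Rightarrow> R3" where "n1 N p = (1 / cN N p) *\<^sub>R fst (N p)"
definition n2 :: "(R6 \<Rightarrow> R6) \<Rightarrow> R6 \<Rightarrow> R3" where "n2 N p = (1 / sN N p) *\<^sub>R snd (N p)"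
definition m1 :: "(R6 \<Rightarrow> R6) \<Rightarrow> R6 \<Rightarrow> R3" where "m1 N p = lcross (fst p) (n1 N p)"
definition m2 :: "(R6 \<Rightarrow> R6) \<Rightarrow> R6 \<Rightarrow> R3" where "m2 N p = lcross (snd p) (n2 N p)"

locale hyper_setting =
  fixes M :: "R6 set" and N :: "R6 \<Rightarrow> R6" and k1 k2 k3 :: real
  assumes hyp: "hypersurface M" and conn: "connected M" and ne: "M \<noteq> {}"
    and normal: "unit_normal M N"
    and dist: "k1 \<noteq> k2" "k1 \<noteq> k3" "k2 \<noteq> k3"
    and const_pc: "\<forall>p\<in>M. principal_curvatures M N p = {k1, k2, k3}"
    and GK_zero: "k1 * k2 * k3 = 0"
    and V_two: "\<forall>p\<in>M. \<exists>X1 X2 X3. X1 \<in> eigenspace M N p k1 \<and> X2 \<in> eigenspace M N p k2 \<and>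
                   X3 \<in> eigenspace M N p k3 \<and> Vfield N p = X1 + X2 + X3 \<and>
                   (X1 = 0 \<or> X2 = 0 \<or> X3 = 0)"
begin

lemma along: "smooth_along M N"
  using normal unfolding unit_normal_def by blast

lemma on_M:
  assumes p: "p \<in> M"
  shows "lor (fst p) (fst p) = -1" "lor (snd p) (snd p) = -1" "fst p $ 1 > 0" "snd p $ 1 > 0"
    "lor (fst (N p)) (fst p) = 0" "lor (snd (N p)) (snd p) = 0"
    "lor (fst (N p)) (fst (N p)) + lor (snd (N p)) (snd (N p)) = 1"
    "X \<in> tangent_space M p \<Longrightarrow> lor (fst (N p)) (fst X) + lor (snd (N p)) (snd X) = 0"
proof -
  have "p \<in> H2xH2" using hyp p unfolding hypersurface_def by blast
  then show "lor (fst p) (fst p) = -1" "lor (snd p) (snd p) = -1" "fst p $ 1 > 0" "snd p $ 1 > 0"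
    by (auto simp: H2xH2_def H2_def)
  have n: "N p \<in> amb_tangent p" "gprod (N p) (N p) = 1" "\<forall>X\<in>tangent_space M p. gprod (N p) X = 0"
    using normal p unfolding unit_normal_def by blast+
  then show "lor (fst (N p)) (fst p) = 0" "lor (snd (N p)) (snd p) = 0"
    "lor (fst (N p)) (fst (N p)) + lor (snd (N p)) (snd (N p)) = 1"
    "X \<in> tangent_space M p \<Longrightarrow> lor (fst (N p)) (fst X) + lor (snd (N p)) (snd X) = 0"
    by (auto simp: amb_tangent_def gprod_def)
qed

lemma tangent_ambient:
  assumes p: "p \<in> M" and X: "X \<in> tangent_space M p"
  shows "lor (fst X) (fst p) = 0" "lor (snd X) (snd p) = 0"
proof -
  have id: "(\<lambda>q::R6. q) differentiable (at p)" "dird (\<lambda>q::R6. q) p X = X" by simp_all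
  note f = dird_fst[OF id(1)] and s = dird_snd[OF id(1)]
  note lf = dird_bilinear[OF bounded_bilinear_lor f(2) f(2)] and ls = dird_bilinear[OF bounded_bilinear_lor s(2) s(2)]
  have "dird (\<lambda>q. lor (fst q) (fst q)) p X = 0"
    by (rule dird_zero_along[OF X lf(2) open_UNIV UNIV_I p]) (use on_M(1) in auto)
  then show "lor (fst X) (fst p) = 0" unfolding lf(1) f(1) id(2) by (simp add: lor_sym[of "fst p"])
  have "dird (\<lambda>q. lor (snd q) (snd q)) p X = 0"
    by (rule dird_zero_along[OF X ls(2) open_UNIV UNIV_I p]) (use on_M(2) in auto)
  then show "lor (snd X) (snd p) = 0" unfolding ls(1) s(1) id(2) by (simp add: lor_sym[of "snd p"])
qed

lemma eigenvector_exists: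
  assumes "p \<in> M" "k \<in> {k1, k2, k3}"
  obtains X where "X \<in> tangent_space M p" "X \<noteq> 0" "shape_op M N p X = k *\<^sub>R X"
  using const_pc assms unfolding principal_curvatures_def by blast

lemma two_nonzero_curvatures:
  obtains k k' where "k \<in> {k1, k2, k3}" "k' \<in> {k1, k2, k3}" "k \<noteq> k'" "k \<noteq> 0" "k' \<noteq> 0"
  using dist by (metis insertCI)

lemma extension:
  assumes "p \<in> M"
  obtains W Ne where "p \<in> W" "smooth_on Ne W" "\<forall>x\<in>M \<inter> W. Ne x = N x"
  using along[unfolded smooth_along_def, THEN bspec, OF assms] by (elim exE conjE) (rule that)

text \<open>If \<open>N\<close> lies in one factor on an open piece, an eigenvector of nonzero
  curvature has no component in the other factor, and orthogonality to \<open>N\<close> leaves it a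
  single direction. Two different nonzero curvatures would share that direction. The pair
  \<open>(pr, pr')\<close> treats both factors at once.\<close>

lemma not_flat:
  fixes pr pr' :: "R6 \<Rightarrow> R3"
  assumes pr: "(pr, pr') = (fst, snd) \<or> (pr, pr') = (snd, fst)"
    and T: "openin (top_of_set M) T" "p \<in> T" and 0: "\<And>q. q \<in> T \<Longrightarrow> pr' (N q) = 0"
  shows False
proof -
  obtain W' where W': "open W'" "T = M \<inter> W'" using T(1) openin_open by blast
  have p: "p \<in> M" "p \<in> W'" using T(2) W' by auto
  obtain W Ne where W0: "p \<in> W" "smooth_on Ne W" "\<forall>x\<in>M \<inter> W. Ne x = N x" by (rule extension[OF p(1)])
  note W = W0(1,2) bspec[OF W0(3)]
  \<comment> \<open>This formula is linear on all of \<open>R6\<close>, so it can be applied to the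
    common direction without first showing that direction tangent.\<close>
  define L where "L X = - amb_proj p (dird Ne p X)" for X
  note dNe = smooth_on_C2(1)[OF W(2,1)]
  have L: "linear L" unfolding L_def
    using linear_compose_neg[OF linear_compose[OF linear_dird[OF dNe] amb_proj_linear[of p]]] by (simp add: o_def)
  have sh: "shape_op M N p X = L X" if "X \<in> tangent_space M p" for X
    unfolding L_def by (rule shape_op_extension[OF p(1) W(1,2,3) that])
  define E where "E w = (if pr = fst then (w, 0) else (0, w))" for w :: R3
  have neq: "(fst :: R6 \<Rightarrow> R3) \<noteq> snd" by (metis fst_conv snd_conv zero_neq_one)
  have E: "X = y *\<^sub>R E w" if "pr' X = 0" "pr X = y *\<^sub>R w" for X y w
    using pr that neq by (auto simp: E_def prod_eq_iff)
  have pr_dird: "dird (\<lambda>q. pr' (Ne q)) p X = pr' (dird Ne p X)" "(\<lambda>q. pr' (Ne q)) differentiable (at p)" for X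
    using pr by (auto simp: dird_fst[OF dNe] dird_snd[OF dNe])
  have pr_facts: "lor (pr p) (pr p) = -1" "lor (pr (N p)) (pr p) = 0"
    "lor (pr (N p)) (pr (N p)) + lor (pr' (N p)) (pr' (N p)) = 1"
    using pr on_M(1,2,5,6,7)[OF p(1)] by auto
  have par: "\<exists>y. X = y *\<^sub>R E (lcross (pr p) (pr (N p)))"
    if X: "X \<in> tangent_space M p" and k: "shape_op M N p X = k *\<^sub>R X" "k \<noteq> 0" for X k
  proof -
    have "dird (\<lambda>q. pr' (Ne q)) p X = 0"
      by (rule dird_zero_along[OF X pr_dird(2), of "W \<inter> W'"])
        (use smooth_on_open[OF W(2)] W' W p 0 in auto)
    then have "pr' (L X) = 0" unfolding L_def pr_dird(1) using pr by (auto simp: amb_proj_def lor_simps)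
    then have "pr' (k *\<^sub>R X) = 0" using sh[OF X] k(1) by metis
    then have s0: "pr' X = 0" using k(2) pr by auto
    have "lor (pr (N p)) (pr X) + lor (pr' (N p)) (pr' X) = 0" "lor (pr X) (pr p) = 0"
      using pr on_M(8)[OF p(1) X] tangent_ambient[OF p(1) X] by auto
    then have n: "lor (pr X) (pr (N p)) = 0" "lor (pr X) (pr p) = 0" using s0 lor_sym[of "pr X"] by (simp_all add: lor_simps)
    have "lor (pr (N p)) (pr (N p)) = 1" using pr_facts(3) 0[OF T(2)] by (simp add: lor_simps)
    from lor_expand[OF pr_facts(1) this pr_facts(2), of "pr X"]
    have "pr X = lor (pr X) (lcross (pr p) (pr (N p))) *\<^sub>R lcross (pr p) (pr (N p))" using n by simp
    then show ?thesis using E[OF s0] by blast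
  qed
  obtain k k' where k: "k \<in> {k1, k2, k3}" "k' \<in> {k1, k2, k3}" "k \<noteq> k'" "k \<noteq> 0" "k' \<noteq> 0"
    by (rule two_nonzero_curvatures)
  obtain X where X: "X \<in> tangent_space M p" "X \<noteq> 0" "shape_op M N p X = k *\<^sub>R X" by (rule eigenvector_exists[OF p(1) k(1)])
  obtain X' where X': "X' \<in> tangent_space M p" "X' \<noteq> 0" "shape_op M N p X' = k' *\<^sub>R X'" by (rule eigenvector_exists[OF p(1) k(2)])
  obtain y y' where y: "X = y *\<^sub>R E (lcross (pr p) (pr (N p)))" "X' = y' *\<^sub>R E (lcross (pr p) (pr (N p)))"
    using par[OF X(1,3) k(4)] par[OF X'(1,3) k(5)] by blast
  have "L X = k *\<^sub>R X" "L X' = k' *\<^sub>R X'" using X X' sh by metis+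
  from parallel_eigenvectors[OF L this y X(2) X'(2)] show False using k(3) by simp
qed

definition "Mstar = {p \<in> M. lor (fst (N p)) (fst (N p)) \<noteq> 0 \<and> lor (snd (N p)) (snd (N p)) \<noteq> 0}"

lemma N_continuous: "continuous_on M N"
  unfolding continuous_on_def
proof
  fix p assume p: "p \<in> M"
  obtain W Ne where W0: "p \<in> W" "smooth_on Ne W" "\<forall>x\<in>M \<inter> W. Ne x = N x" by (rule extension[OF p])
  note W = W0(1,2) bspec[OF W0(3)]
  have "(Ne \<longlongrightarrow> Ne p) (at p within M)"
    using differentiable_imp_continuous_within[OF smooth_on_C2(1)[OF W(2,1)]] unfolding continuous_at
    by (rule tendsto_within_subset) simp
  moreover have "\<forall>\<^sub>F x in at p within M. Ne x = N x"
    unfolding eventually_at_topological using smooth_on_open[OF W(2)] W by blast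
  ultimately show "(N \<longlongrightarrow> N p) (at p within M)"
    using W(3)[of p] p W(1) by (simp add: tendsto_cong)
qed

lemma norm_continuous:
  "continuous_on M (\<lambda>p. lor (fst (N p)) (fst (N p)))" "continuous_on M (\<lambda>p. lor (snd (N p)) (snd (N p)))"
  by (intro bounded_bilinear.continuous_on[OF bounded_bilinear_lor] continuous_on_fst continuous_on_snd N_continuous)+

lemma openin_nonzero:
  fixes g :: "R6 \<Rightarrow> real"
  assumes "continuous_on M g"
  shows "openin (top_of_set M) {p \<in> M. g p \<noteq> 0}"
proof -
  have "openin (top_of_set M) (M \<inter> g -` (- {0}))"
    by (rule continuous_openin_preimage_gen[OF assms]) auto
  moreover have "M \<inter> g -` (- {0}) = {p \<in> M. g p \<noteq> 0}" by auto
  ultimately show ?thesis by simp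
qed

lemma Mstar_open: "openin (top_of_set M) Mstar"
proof -
  have "Mstar = {p \<in> M. lor (fst (N p)) (fst (N p)) \<noteq> 0} \<inter> {p \<in> M. lor (snd (N p)) (snd (N p)) \<noteq> 0}"
    by (auto simp: Mstar_def)
  then show ?thesis using openin_nonzero[OF norm_continuous(1)] openin_nonzero[OF norm_continuous(2)] by auto
qed

text \<open>If \<open>Mstar\<close> were empty, the second component of \<open>N\<close> would
  vanish on the open set where the first does not; if that set is empty too, the first component
  vanishes on all of \<open>M\<close>. Both contradict \<open>not_flat\<close>.\<close>

lemma Mstar_ne: "Mstar \<noteq> {}"
proof
  assume 0: "Mstar = {}"
  let ?T = "{p \<in> M. lor (fst (N p)) (fst (N p)) \<noteq> 0}"
  have s0: "snd (N q) = 0" if "q \<in> ?T" for q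
    using that 0 lor_spacelike(2)[OF on_M(2) on_M(6)] unfolding Mstar_def by blast
  show False
  proof (cases "?T = {}")
    case True
    then have f0: "fst (N q) = 0" if "q \<in> M" for q
      using that lor_spacelike(2)[OF on_M(1) on_M(5)] by blast
    obtain p where "p \<in> M" using ne by blast
    then show False using not_flat[of snd fst M p] f0 by simp
  next
    case False
    then obtain p where "p \<in> ?T" by blast
    then show False using not_flat[OF disjI1[OF refl] openin_nonzero[OF norm_continuous(1)] _ s0] by blast
  qed
qed

lemma Mstar_pos:
  assumes "p \<in> Mstar"
  shows "p \<in> M" "lor (fst (N p)) (fst (N p)) > 0" "lor (snd (N p)) (snd (N p)) > 0"
proof -
  show p: "p \<in> M" using assms by (simp add: Mstar_def)
  show "lor (fst (N p)) (fst (N p)) > 0" "lor (snd (N p)) (snd (N p)) > 0"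
    using assms lor_spacelike(1)[OF on_M(1) on_M(5), OF p p] lor_spacelike(1)[OF on_M(2) on_M(6), OF p p]
    by (auto simp: Mstar_def)
qed

lemma constant_on_M:
  assumes "\<And>p. p \<in> M \<Longrightarrow> \<exists>T. openin (top_of_set M) T \<and> p \<in> T \<and> (\<forall>q\<in>T. f q = f p)"
  obtains k where "\<And>p. p \<in> M \<Longrightarrow> f p = k"
proof -
  obtain p0 where p0: "p0 \<in> M" using ne by blast
  have "\<forall>a\<in>M. \<forall>\<^sub>F b in at a within M. f a = f b"
  proof
    fix a assume a: "a \<in> M"
    obtain T where T: "openin (top_of_set M) T" "a \<in> T" "\<forall>q\<in>T. f q = f a" using assms[OF a] by blast
    obtain W where "open W" "T = M \<inter> W" using T(1) openin_open by blast
    then show "\<forall>\<^sub>F b in at a within M. f a = f b"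
      unfolding eventually_at_topological using T(2,3) by (metis IntD2 IntI)
  qed
  then have "f p = f p0" if "p \<in> M" for p using connected_local_const[OF conn that p0] by blast
  then show ?thesis using that by blast
qed

end

lemma is_chartD:
  assumes "is_chart M N U \<phi>"
  shows "open U" "\<phi> ` U \<subseteq> M" "inj_on \<phi> U" "continuous_on U \<phi>"
proof -
  note c = assms[unfolded is_chart_def]
  show "open U" by (rule conjunct1[OF c])
  show "\<phi> ` U \<subseteq> M" by (rule conjunct1[OF conjunct2[OF c]])
  show "inj_on \<phi> U" by (rule conjunct1[OF conjunct2[OF conjunct2[OF c]]])
  show "continuous_on U \<phi>" by (rule conjunct1[OF conjunct2[OF conjunct2[OF conjunct2[OF c]]]])
qed

lemma is_chart_openin:
  assumes "is_chart M N U \<phi>" "open T" "T \<subseteq> U"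
  shows "openin (top_of_set M) (\<phi> ` T)"
  using assms(1)[unfolded is_chart_def, THEN conjunct2, THEN conjunct2, THEN conjunct2, THEN conjunct2, THEN conjunct1, rule_format, OF assms(2,3)] .

lemma is_chart_pointwise:
  assumes "is_chart M N U \<phi>" "x \<in> U"
  shows "\<phi> differentiable (at x)" "(\<lambda>y. dird \<phi> y u) differentiable (at x)"
    "(\<lambda>y. N (\<phi> y)) differentiable (at x)" "(\<lambda>y. dird (\<lambda>y. N (\<phi> y)) y u) differentiable (at x)"
    "inj (dird \<phi> x)" "dird \<phi> x u \<in> tangent_space M (\<phi> x)"
    "shape_op M N (\<phi> x) (dird \<phi> x u) = - amb_proj (\<phi> x) (dird (\<lambda>y. N (\<phi> y)) x u)"
proof -
  note c = assms(1)[unfolded is_chart_def, THEN conjunct2, THEN conjunct2, THEN conjunct2, THEN conjunct2, THEN conjunct2, THEN bspec, OF assms(2)]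
  note c2 = conjunct2[OF c] and c3 = conjunct2[OF conjunct2[OF c]] and c4 = conjunct2[OF conjunct2[OF conjunct2[OF c]]]
  show "\<phi> differentiable (at x)" by (rule conjunct1[OF c])
  show "(\<lambda>y. dird \<phi> y u) differentiable (at x)" by (rule spec[OF conjunct1[OF c2]])
  show "(\<lambda>y. N (\<phi> y)) differentiable (at x)" by (rule conjunct1[OF c3])
  show "(\<lambda>y. dird (\<lambda>y. N (\<phi> y)) y u) differentiable (at x)" by (rule spec[OF conjunct1[OF c4]])
  show "inj (dird \<phi> x)" by (rule conjunct1[OF conjunct2[OF c4]])
  show "dird \<phi> x u \<in> tangent_space M (\<phi> x)" by (rule conjunct1[OF spec[OF conjunct2[OF conjunct2[OF c4]]]])
  show "shape_op M N (\<phi> x) (dird \<phi> x u) = - amb_proj (\<phi> x) (dird (\<lambda>y. N (\<phi> y)) x u)"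
    by (rule conjunct2[OF spec[OF conjunct2[OF conjunct2[OF c4]]]])
qed

section \<open>Charts on which both components of the normal are nonzero\<close>

locale hyper_chart = hyper_setting +
  fixes V :: "R3 set" and \<phi> :: "R3 \<Rightarrow> R6"
  assumes chart: "is_chart M N V \<phi>" and star: "\<phi> ` V \<subseteq> Mstar"
begin

lemma V_open: "open V" and V_M: "x \<in> V \<Longrightarrow> \<phi> x \<in> M" and V_star: "x \<in> V \<Longrightarrow> \<phi> x \<in> Mstar"
  using is_chartD(1,2)[OF chart] star by auto

lemma chart_pointwise:
  assumes "x \<in> V"
  shows "\<phi> differentiable (at x)" "(\<lambda>y. dird \<phi> y u) differentiable (at x)"
    "(\<lambda>y. N (\<phi> y)) differentiable (at x)" "(\<lambda>y. dird (\<lambda>y. N (\<phi> y)) y u) differentiable (at x)"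
    "inj (dird \<phi> x)" "dird \<phi> x u \<in> tangent_space M (\<phi> x)"
    "shape_op M N (\<phi> x) (dird \<phi> x u) = - amb_proj (\<phi> x) (dird (\<lambda>y. N (\<phi> y)) x u)"
  by (rule is_chart_pointwise[OF chart assms])+

lemma dird_component:
  assumes "x \<in> V" and f: "\<And>y. y \<in> V \<Longrightarrow> f differentiable (at y)" "\<And>y u. y \<in> V \<Longrightarrow> (\<lambda>y. dird f y u) differentiable (at y)"
  shows "(\<lambda>y. dird (\<lambda>y. fst (f y)) y u) differentiable (at x)" "(\<lambda>y. dird (\<lambda>y. snd (f y)) y u) differentiable (at x)"
proof -
  show "(\<lambda>y. dird (\<lambda>y. fst (f y)) y u) differentiable (at x)"
    by (rule differentiable_cong_open[OF V_open assms(1) _ dird_fst(2)[OF f(2)[OF assms(1)]]])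
      (simp add: dird_fst(1)[OF f(1)])
  show "(\<lambda>y. dird (\<lambda>y. snd (f y)) y u) differentiable (at x)"
    by (rule differentiable_cong_open[OF V_open assms(1) _ dird_snd(2)[OF f(2)[OF assms(1)]]])
      (simp add: dird_snd(1)[OF f(1)])
qed

sublocale adapted_chart V "\<lambda>y. fst (\<phi> y)" "\<lambda>y. snd (\<phi> y)" "\<lambda>y. fst (N (\<phi> y))" "\<lambda>y. snd (N (\<phi> y))"
proof
  show "open V" by (rule V_open)
  fix x u assume x: "x \<in> V"
  note c = chart_pointwise[OF x]
  show "(\<lambda>y. fst (\<phi> y)) differentiable (at x)" "(\<lambda>y. snd (\<phi> y)) differentiable (at x)"
    "(\<lambda>y. fst (N (\<phi> y))) differentiable (at x)" "(\<lambda>y. snd (N (\<phi> y))) differentiable (at x)"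
    by (intro dird_fst(2) dird_snd(2) c)+
  show "(\<lambda>y. dird (\<lambda>y. fst (\<phi> y)) y u) differentiable (at x)" "(\<lambda>y. dird (\<lambda>y. snd (\<phi> y)) y u) differentiable (at x)"
    "(\<lambda>y. dird (\<lambda>y. fst (N (\<phi> y))) y u) differentiable (at x)" "(\<lambda>y. dird (\<lambda>y. snd (N (\<phi> y))) y u) differentiable (at x)"
    by (intro dird_component x chart_pointwise; assumption)+
  show "lor (fst (\<phi> x)) (fst (\<phi> x)) = - 1" "lor (snd (\<phi> x)) (snd (\<phi> x)) = - 1"
    "lor (fst (N (\<phi> x))) (fst (\<phi> x)) = 0" "lor (snd (N (\<phi> x))) (snd (\<phi> x)) = 0"
    "lor (fst (N (\<phi> x))) (fst (N (\<phi> x))) + lor (snd (N (\<phi> x))) (snd (N (\<phi> x))) = 1"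
    by (rule on_M[OF V_M[OF x]])+
  show "0 < lor (fst (N (\<phi> x))) (fst (N (\<phi> x)))" "0 < lor (snd (N (\<phi> x))) (snd (N (\<phi> x)))"
    by (rule Mstar_pos[OF V_star[OF x]])+
  show "lor (fst (N (\<phi> x))) (dird (\<lambda>y. fst (\<phi> y)) x u) + lor (snd (N (\<phi> x))) (dird (\<lambda>y. snd (\<phi> y)) x u) = 0"
    unfolding dird_fst(1)[OF c(1)] dird_snd(1)[OF c(1)] by (rule on_M(8)[OF V_M[OF x] c(6)])
  assume "dird (\<lambda>y. fst (\<phi> y)) x u = 0" "dird (\<lambda>y. snd (\<phi> y)) x u = 0"
  then have "dird \<phi> x u = 0" unfolding dird_fst(1)[OF c(1)] dird_snd(1)[OF c(1)] by (simp add: prod_eq_iff)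
  then have "dird \<phi> x u = dird \<phi> x 0" using linear_0[OF linear_dird[OF c(1)]] by simp
  then show "u = 0" using c(5) by (simp add: inj_eq)
qed

lemma d\<phi>_frame:
  assumes x: "x \<in> V"
  shows "dird \<phi> x u = ((G.r x * \<eta> x u) *\<^sub>R F.n x + F.\<beta> x u *\<^sub>R F.m x, (- F.r x * \<eta> x u) *\<^sub>R G.n x + G.\<beta> x u *\<^sub>R G.m x)"
  using dP_frame[OF x, of u] dQ_frame[OF x, of u] dird_fst(1)[OF chart_pointwise(1)[OF x]] dird_snd(1)[OF chart_pointwise(1)[OF x]]
  by (simp add: prod_eq_iff)

text \<open>The projection removes the components along the positions. The result has the form of
  \<open>d\<phi>_frame\<close> with the coframe replaced by \<kappa>, \<open>F.Z\<close>,
  \<open>G.Z\<close>, which identifies these forms as the rows of the shape operator.\<close>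

lemma shape_frame:
  assumes x: "x \<in> V"
  shows "shape_op M N (\<phi> x) (dird \<phi> x u) = ((G.r x * \<kappa> x u) *\<^sub>R F.n x + F.Z x u *\<^sub>R F.m x, (- F.r x * \<kappa> x u) *\<^sub>R G.n x + G.Z x u *\<^sub>R G.m x)"
proof -
  have f: "dird (\<lambda>y. fst (N (\<phi> y))) x u + lor (dird (\<lambda>y. fst (N (\<phi> y))) x u) (fst (\<phi> x)) *\<^sub>R fst (\<phi> x)
    = (- G.r x * \<kappa> x u) *\<^sub>R F.n x - F.Z x u *\<^sub>R F.m x"
    unfolding F.dmu_eq[OF x] K_eq[OF x] by (simp add: lor_simps F.PP[OF x] F.nP[OF x] F.mP)
  have g: "dird (\<lambda>y. snd (N (\<phi> y))) x u + lor (dird (\<lambda>y. snd (N (\<phi> y))) x u) (snd (\<phi> x)) *\<^sub>R snd (\<phi> x)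
    = (F.r x * \<kappa> x u) *\<^sub>R G.n x - G.Z x u *\<^sub>R G.m x"
    unfolding G.dmu_eq[OF x] K_eq[OF x] by (simp add: lor_simps G.PP[OF x] G.nP[OF x] G.mP)
  show ?thesis
    using f g unfolding chart_pointwise(7)[OF x] amb_proj_def dird_fst(1)[OF chart_pointwise(3)[OF x]] dird_snd(1)[OF chart_pointwise(3)[OF x]]
    by simp
qed

lemma frame_coefficients:
  assumes x: "x \<in> V" and eq: "((G.r x * k) *\<^sub>R F.n x + i *\<^sub>R F.m x, (- F.r x * k) *\<^sub>R G.n x + j *\<^sub>R G.m x)
    = ((G.r x * k') *\<^sub>R F.n x + i' *\<^sub>R F.m x, (- F.r x * k') *\<^sub>R G.n x + j' *\<^sub>R G.m x)"
  shows "k = k'" "i = i'" "j = j'"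
proof -
  have e1: "(G.r x * k) *\<^sub>R F.n x + i *\<^sub>R F.m x = (G.r x * k') *\<^sub>R F.n x + i' *\<^sub>R F.m x"
    and e2: "(- F.r x * k) *\<^sub>R G.n x + j *\<^sub>R G.m x = (- F.r x * k') *\<^sub>R G.n x + j' *\<^sub>R G.m x"
    using eq by auto
  show "k = k'" using arg_cong[OF e1, of "\<lambda>z. lor z (F.n x)"] G.r_pos[OF x]
    by (simp add: lor_simps F.nn[OF x] F.mn)
  show "i = i'" using arg_cong[OF e1, of "\<lambda>z. lor z (F.m x)"]
    by (simp add: lor_simps F.mm[OF x] F.frame'(3))
  show "j = j'" using arg_cong[OF e2, of "\<lambda>z. lor z (G.m x)"]
    by (simp add: lor_simps G.mm[OF x] G.frame'(3))
qed

lemma eigen_coordinates: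
  assumes x: "x \<in> V" and e: "shape_op M N (\<phi> x) (dird \<phi> x u) = k *\<^sub>R dird \<phi> x u"
  shows "\<kappa> x u = k * \<eta> x u" "F.Z x u = k * F.\<beta> x u" "G.Z x u = k * G.\<beta> x u"
proof -
  have "((G.r x * \<kappa> x u) *\<^sub>R F.n x + F.Z x u *\<^sub>R F.m x, (- F.r x * \<kappa> x u) *\<^sub>R G.n x + G.Z x u *\<^sub>R G.m x)
    = ((G.r x * (k * \<eta> x u)) *\<^sub>R F.n x + (k * F.\<beta> x u) *\<^sub>R F.m x, (- F.r x * (k * \<eta> x u)) *\<^sub>R G.n x + (k * G.\<beta> x u) *\<^sub>R G.m x)"
    using e unfolding shape_frame[OF x] unfolding d\<phi>_frame[OF x] by (simp add: scaleR_add_right scaleR_diff_right mult.left_commute)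
  from frame_coefficients[OF x this]
  show "\<kappa> x u = k * \<eta> x u" "F.Z x u = k * F.\<beta> x u" "G.Z x u = k * G.\<beta> x u" .
qed

text \<open>Orthogonality to \<open>N\<close> makes the components \<open>(i, j)\<close> along
  \<open>n1, n2\<close> a multiple of \<open>(G.r, - F.r)\<close>, so three numbers describe
  \<open>X\<close>, and the dual vectors realize every such triple.\<close>

lemma tangent_coordinates:
  assumes x: "x \<in> V" and X: "X \<in> tangent_space M (\<phi> x)"
  obtains u where "dird \<phi> x u = X"
proof -
  note tan = tangent_ambient[OF V_M[OF x] X]
  define i where "i = lor (fst X) (F.n x)"
  define j where "j = lor (snd X) (G.n x)"
  have n: "F.r x * i + G.r x * j = 0"
    using on_M(8)[OF V_M[OF x] X] F.mu_eq[OF x] G.mu_eq[OF x]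
    by (simp add: lor_simps i_def j_def lor_sym[of "fst X"] lor_sym[of "snd X"])
  obtain u where u: "\<eta> x u = G.r x * i - F.r x * j" "F.\<beta> x u = lor (fst X) (F.m x)" "G.\<beta> x u = lor (snd X) (G.m x)"
    by (rule dual_vector[OF x])
  have c: "G.r x * (G.r x * i - F.r x * j) = i" "- F.r x * (G.r x * i - F.r x * j) = j"
    using n r_sq_sum[OF x] by algebra+
  have "fst X = i *\<^sub>R F.n x + lor (fst X) (F.m x) *\<^sub>R F.m x" "snd X = j *\<^sub>R G.n x + lor (snd X) (G.m x) *\<^sub>R G.m x"
    using F.expand[OF x, of "fst X"] G.expand[OF x, of "snd X"] tan by (simp_all add: i_def j_def)
  then have "dird \<phi> x u = X" unfolding d\<phi>_frame[OF x] u c by (simp add: prod_eq_iff)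
  then show ?thesis using that by blast
qed

text \<open>Each constant curvature is a root of the characteristic polynomial of the frame matrix,
  and three distinct roots determine a monic cubic.\<close>

lemma char_poly:
  assumes x: "x \<in> V"
  shows "A x + a x + d x = k1 + k2 + k3"
    "A x * a x + A x * d x + a x * d x - (B1 x)\<^sup>2 - (B2 x)\<^sup>2 - (b x)\<^sup>2 = k1 * k2 + k1 * k3 + k2 * k3"
    "A x * a x * d x + 2 * B1 x * B2 x * b x - A x * (b x)\<^sup>2 - a x * (B2 x)\<^sup>2 - d x * (B1 x)\<^sup>2 = k1 * k2 * k3"
proof -
  have root: "k ^ 3 - (A x + a x + d x) * k\<^sup>2 + (A x * a x + A x * d x + a x * d x - (B1 x)\<^sup>2 - (B2 x)\<^sup>2 - (b x)\<^sup>2) * k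
     - (A x * a x * d x + 2 * B1 x * B2 x * b x - A x * (b x)\<^sup>2 - a x * (B2 x)\<^sup>2 - d x * (B1 x)\<^sup>2) = 0"
    if k: "k \<in> {k1, k2, k3}" for k
  proof -
    obtain X where X: "X \<in> tangent_space M (\<phi> x)" "X \<noteq> 0" "shape_op M N (\<phi> x) X = k *\<^sub>R X"
      by (rule eigenvector_exists[OF V_M[OF x] k])
    obtain u where u: "dird \<phi> x u = X" by (rule tangent_coordinates[OF x X(1)])
    note e = eigen_coordinates[OF x, of u k, unfolded u, OF X(3), unfolded forms_eq[OF x]]
    have "\<eta> x u \<noteq> 0 \<or> F.\<beta> x u \<noteq> 0 \<or> G.\<beta> x u \<noteq> 0"
    proof (rule ccontr)
      assume "\<not> ?thesis"
      then have "dird \<phi> x u = 0" unfolding d\<phi>_frame[OF x] by (simp add: zero_prod_def)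
      then show False using u X(2) by simp
    qed
    from kernel_imp_det_zero[OF e this] show ?thesis by algebra
  qed
  show "A x + a x + d x = k1 + k2 + k3"
    "A x * a x + A x * d x + a x * d x - (B1 x)\<^sup>2 - (B2 x)\<^sup>2 - (b x)\<^sup>2 = k1 * k2 + k1 * k3 + k2 * k3"
    "A x * a x * d x + 2 * B1 x * B2 x * b x - A x * (b x)\<^sup>2 - a x * (B2 x)\<^sup>2 - d x * (B1 x)\<^sup>2 = k1 * k2 * k3"
    by (rule vieta_cubic[OF dist root]; assumption)+
qed

lemma V_coordinates:
  assumes x: "x \<in> V" and u: "dird \<phi> x u = Vfield N (\<phi> x)"
  shows "\<eta> x u = 2 * F.r x * G.r x" "F.\<beta> x u = 0" "G.\<beta> x u = 0"
proof -
  define C where "C = (F.r x)\<^sup>2 - (G.r x)\<^sup>2"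
  have C: "gprod (Pstr (N (\<phi> x))) (N (\<phi> x)) = C"
    by (simp add: C_def gprod_def Pstr_def lor_simps F.r_sq[OF x] G.r_sq[OF x])
  have C': "(1 - C) * F.r x = G.r x * (2 * F.r x * G.r x)" "- (1 + C) * G.r x = - F.r x * (2 * F.r x * G.r x)"
    using r_sq_sum[OF x] unfolding C_def by algebra+
  have "Vfield N (\<phi> x) = (((1 - C) * F.r x) *\<^sub>R F.n x, (- (1 + C) * G.r x) *\<^sub>R G.n x)"
    unfolding Vfield_def C unfolding Pstr_def using F.mu_eq[OF x] G.mu_eq[OF x]
    by (simp add: prod_eq_iff algebra_simps)
  then have "((G.r x * \<eta> x u) *\<^sub>R F.n x + F.\<beta> x u *\<^sub>R F.m x, (- F.r x * \<eta> x u) *\<^sub>R G.n x + G.\<beta> x u *\<^sub>R G.m x)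
    = ((G.r x * (2 * F.r x * G.r x)) *\<^sub>R F.n x + 0 *\<^sub>R F.m x, (- F.r x * (2 * F.r x * G.r x)) *\<^sub>R G.n x + 0 *\<^sub>R G.m x)"
    using u unfolding d\<phi>_frame[OF x] C' by simp
  from frame_coefficients[OF x this]
  show "\<eta> x u = 2 * F.r x * G.r x" "F.\<beta> x u = 0" "G.\<beta> x u = 0" .
qed

lemma two_eigen_condition:
  assumes x: "x \<in> V"
    and X1: "X1 \<in> eigenspace M N (\<phi> x) k" and X2: "X2 \<in> eigenspace M N (\<phi> x) l" and V: "Vfield N (\<phi> x) = X1 + X2"
  shows "(A x)\<^sup>2 + (B1 x)\<^sup>2 + (B2 x)\<^sup>2 - (k + l) * A x + k * l = 0 \<and>
        A x * B1 x + B1 x * a x + B2 x * b x = (k + l) * B1 x \<and> A x * B2 x + B1 x * b x + B2 x * d x = (k + l) * B2 x"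
proof -
  obtain u1 where u1: "dird \<phi> x u1 = X1" using tangent_coordinates[OF x] X1 unfolding eigenspace_def by blast
  obtain u2 where u2: "dird \<phi> x u2 = X2" using tangent_coordinates[OF x] X2 unfolding eigenspace_def by blast
  have e1: "shape_op M N (\<phi> x) (dird \<phi> x u1) = k *\<^sub>R dird \<phi> x u1" using X1 u1 unfolding eigenspace_def by simp
  have e2: "shape_op M N (\<phi> x) (dird \<phi> x u2) = l *\<^sub>R dird \<phi> x u2" using X2 u2 unfolding eigenspace_def by simp
  have "dird \<phi> x (u1 + u2) = Vfield N (\<phi> x)"
    using linear_add[OF linear_dird[OF chart_pointwise(1)[OF x]]] u1 u2 V by simp
  note s = V_coordinates[OF x this, unfolded linear_add[OF lin(1)[OF x]] linear_add[OF lin(2)[OF x]] linear_add[OF lin(3)[OF x]]]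
  have "2 * F.r x * G.r x \<noteq> 0" using cs_pos[OF x] by simp
  from two_eigenvectors[OF this s eigen_coordinates[OF x e1, unfolded forms_eq[OF x]] eigen_coordinates[OF x e2, unfolded forms_eq[OF x]]]
  show ?thesis by blast
qed

sublocale principal V F.r G.r \<eta> F.\<beta> G.\<beta> \<kappa> F.Z G.Z k1 k2 k3
proof
  show "k1 \<noteq> k2" "k1 \<noteq> k3" "k2 \<noteq> k3" "k1 * k2 * k3 = 0" by (rule dist GK_zero)+
  fix x assume x: "x \<in> V"
  show "A x + a x + d x = k1 + k2 + k3"
    "A x * a x + A x * d x + a x * d x - (B1 x)\<^sup>2 - (B2 x)\<^sup>2 - (b x)\<^sup>2 = k1 * k2 + k1 * k3 + k2 * k3"
    "A x * a x * d x + 2 * B1 x * B2 x * b x - A x * (b x)\<^sup>2 - a x * (B2 x)\<^sup>2 - d x * (B1 x)\<^sup>2 = k1 * k2 * k3"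
    by (rule char_poly[OF x])+
  obtain X1 X2 X3 where X: "X1 \<in> eigenspace M N (\<phi> x) k1" "X2 \<in> eigenspace M N (\<phi> x) k2" "X3 \<in> eigenspace M N (\<phi> x) k3"
    "Vfield N (\<phi> x) = X1 + X2 + X3" "X1 = 0 \<or> X2 = 0 \<or> X3 = 0"
    using V_two V_M[OF x] by blast
  show "\<exists>(S, R) \<in> {(k1 + k2, k1 * k2), (k1 + k3, k1 * k3), (k2 + k3, k2 * k3)}.
        (A x)\<^sup>2 + (B1 x)\<^sup>2 + (B2 x)\<^sup>2 - S * A x + R = 0 \<and>
        A x * B1 x + B1 x * a x + B2 x * b x = S * B1 x \<and> A x * B2 x + B1 x * b x + B2 x * d x = S * B2 x"
    using X(5)
  proof (elim disjE)
    assume "X1 = 0"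
    then show ?thesis using two_eigen_condition[OF x X(2,3)] X(4) by simp
  next
    assume "X2 = 0"
    then show ?thesis using two_eigen_condition[OF x X(1,3)] X(4) by simp
  next
    assume "X3 = 0"
    then show ?thesis using two_eigen_condition[OF x X(1,2)] X(4) by simp
  qed
qed

lemma locally_constant:
  fixes h :: "R6 \<Rightarrow> 'b::real_normed_vector"
  assumes x: "x \<in> V" and d: "\<And>y. y \<in> V \<Longrightarrow> (\<lambda>y. h (\<phi> y)) differentiable (at y)"
    and 0: "\<And>y v. y \<in> V \<Longrightarrow> dird (\<lambda>y. h (\<phi> y)) y v = 0"
  shows "\<exists>T. openin (top_of_set M) T \<and> \<phi> x \<in> T \<and> (\<forall>q\<in>T. h q = h (\<phi> x))"
proof -
  obtain e where e: "e > 0" "ball x e \<subseteq> V" using openE[OF V_open x] by blast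
  have "((\<lambda>y. h (\<phi> y)) has_derivative (\<lambda>v. 0)) (at y within ball x e)" if "y \<in> ball x e" for y
  proof -
    have yV: "y \<in> V" using that e by blast
    have "dird (\<lambda>y. h (\<phi> y)) y = (\<lambda>v. 0)" using 0[OF yV] by blast
    then show ?thesis using has_derivative_dird[OF d[OF yV]] by (simp add: has_derivative_at_withinI)
  qed
  then obtain k where k: "\<forall>y\<in>ball x e. h (\<phi> y) = k"
    using has_derivative_zero_constant[OF convex_ball, of x e "\<lambda>y. h (\<phi> y)"] by blast
  have "openin (top_of_set M) (\<phi> ` ball x e)"
    by (rule is_chart_openin[OF chart open_ball e(2)])
  then show ?thesis using k e(1) by (intro exI[of _ "\<phi> ` ball x e"]) auto
qed

end

text \<open>The entries \<open>a\<close>, \<open>b\<close>, \<open>d\<close> of the block as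
  functions on \<open>M\<close>, so that their local constancy in charts can be made global.\<close>

definition shape_coef1 :: "R6 set \<Rightarrow> (R6 \<Rightarrow> R6) \<Rightarrow> R6 \<Rightarrow> real" where
  "shape_coef1 M N p = gprod (shape_op M N p (m1 N p, 0)) (m1 N p, 0)"
definition shape_coef12 :: "R6 set \<Rightarrow> (R6 \<Rightarrow> R6) \<Rightarrow> R6 \<Rightarrow> real" where
  "shape_coef12 M N p = gprod (shape_op M N p (m1 N p, 0)) (0, m2 N p)"
definition shape_coef2 :: "R6 set \<Rightarrow> (R6 \<Rightarrow> R6) \<Rightarrow> R6 \<Rightarrow> real" where
  "shape_coef2 M N p = gprod (shape_op M N p (0, m2 N p)) (0, m2 N p)"

context hyper_chart
begin

lemma invariants:
  "F.r x = cN N (\<phi> x)" "G.r x = sN N (\<phi> x)" "F.n x = n1 N (\<phi> x)" "G.n x = n2 N (\<phi> x)"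
  "F.m x = m1 N (\<phi> x)" "G.m x = m2 N (\<phi> x)"
  unfolding F.r_def G.r_def cN_def sN_def F.n_def G.n_def n1_def n2_def F.m_def G.m_def m1_def m2_def by simp_all

lemma coefficient_invariants:
  assumes x: "x \<in> V"
  shows "a x = shape_coef1 M N (\<phi> x)" "b x = shape_coef12 M N (\<phi> x)" "d x = shape_coef2 M N (\<phi> x)"
proof -
  obtain u0 u1 u2 where u: "\<eta> x u0 = 1" "F.\<beta> x u0 = 0" "G.\<beta> x u0 = 0"
    "\<eta> x u1 = 0" "F.\<beta> x u1 = 1" "G.\<beta> x u1 = 0" "\<eta> x u2 = 0" "F.\<beta> x u2 = 0" "G.\<beta> x u2 = 1"
    by (rule dual_basis[OF x])
  have "dird \<phi> x u1 = (m1 N (\<phi> x), 0)" "dird \<phi> x u2 = (0, m2 N (\<phi> x))"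
    unfolding d\<phi>_frame[OF x] invariants[symmetric] by (simp_all add: u)
  then have s: "shape_op M N (\<phi> x) (m1 N (\<phi> x), 0) = (F.Z x u1 *\<^sub>R F.m x, G.Z x u1 *\<^sub>R G.m x)"
    "shape_op M N (\<phi> x) (0, m2 N (\<phi> x)) = (F.Z x u2 *\<^sub>R F.m x, G.Z x u2 *\<^sub>R G.m x)"
    using shape_frame[OF x, of u1] shape_frame[OF x, of u2] by (simp_all add: \<kappa>_zero[OF x])
  show "a x = shape_coef1 M N (\<phi> x)" "b x = shape_coef12 M N (\<phi> x)" "d x = shape_coef2 M N (\<phi> x)"
    unfolding shape_coef1_def shape_coef12_def shape_coef2_def s unfolding invariants[symmetric]
    by (simp_all add: gprod_def lor_simps F.mm[OF x] G.mm[OF x] \<zeta>_eq[OF x] u)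
qed

end

context hyper_setting
begin

lemma star_chart:
  assumes p: "p \<in> Mstar"
  obtains V \<phi> x where "hyper_chart M N k1 k2 k3 V \<phi>" "x \<in> V" "\<phi> x = p"
proof -
  obtain U \<phi> x where c: "is_chart M N U \<phi>" "x \<in> U" "\<phi> x = p"
    by (rule chart_exists[OF hyp along Mstar_pos(1)[OF p]])
  obtain W where W: "open W" "Mstar = M \<inter> W" using Mstar_open openin_open by blast
  define V where "V = \<phi> -` W \<inter> U"
  have oU: "open U" and cont: "continuous_on U \<phi>" and im: "\<phi> ` U \<subseteq> M" using is_chartD[OF c(1)] by auto
  have V: "open V" "V \<subseteq> U"
    unfolding V_def using continuous_on_open_vimage[OF oU, of \<phi>] cont W(1) by blast+
  have "hyper_chart M N k1 k2 k3 V \<phi>"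
  proof
    show "is_chart M N V \<phi>" by (rule is_chart_subset[OF c(1) V])
    show "\<phi> ` V \<subseteq> Mstar" using im unfolding V_def W(2) by blast
  qed
  moreover have "x \<in> V" using c(2,3) p unfolding V_def W(2) by simp
  ultimately show ?thesis using that c(3) by blast
qed

lemma Mstar_locally_constant:
  assumes p: "p \<in> Mstar" and h: "h \<in> {cN N, sN N, shape_coef1 M N, shape_coef12 M N, shape_coef2 M N}"
  shows "\<exists>T. openin (top_of_set M) T \<and> p \<in> T \<and> (\<forall>q\<in>T. h q = h p)"
proof -
  obtain V \<phi> x where c: "hyper_chart M N k1 k2 k3 V \<phi>" "x \<in> V" "\<phi> x = p" by (rule star_chart[OF p])
  interpret hyper_chart M N k1 k2 k3 V \<phi> by fact
  have "\<exists>T. openin (top_of_set M) T \<and> \<phi> x \<in> T \<and> (\<forall>q\<in>T. h q = h (\<phi> x))"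
  proof (rule locally_constant[OF c(2)])
    fix y v assume y: "y \<in> V"
    note inv = invariants(1,2)[symmetric] coefficient_invariants[symmetric]
    obtain g where g: "\<And>z. z \<in> V \<Longrightarrow> g z = h (\<phi> z)" "g differentiable (at y)" "\<And>v. dird g y v = 0"
      using h coef_diff[OF y] cs_diff[OF y] dc_zero[OF y] ds_zero[OF y] coefficients_stationary[OF y] inv
      by (elim insertE emptyE; metis)
    show "(\<lambda>y. h (\<phi> y)) differentiable (at y)"
      by (rule differentiable_cong_open[OF V_open y g(1,2)])
    show "dird (\<lambda>y. h (\<phi> y)) y v = 0"
      using dird_cong_open[OF V_open y g(1)] g(3) by simp
  qed
  then show ?thesis using c(3) by simp
qed

text \<open>A level of \<open>g\<close> strictly between 0 and 1 keeps both components of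
  \<open>N\<close> nonzero, so the level set lies in \<open>Mstar\<close>, where \<open>cN\<close>
  is locally constant. Hence it is open as well as closed, and connectedness makes it all of
  \<open>M\<close>.\<close>

lemma Mstar_eq: "Mstar = M"
proof -
  obtain p0 where p0: "p0 \<in> Mstar" using Mstar_ne by blast
  define g where "g p = lor (fst (N p)) (fst (N p))" for p
  have gc: "g p = (cN N p)\<^sup>2" if "p \<in> M" for p
    using lor_spacelike(1)[OF on_M(1) on_M(5), OF that that] by (simp add: g_def cN_def)
  have g0: "g p0 > 0" "g p0 < 1"
    using Mstar_pos[OF p0] on_M(7)[OF Mstar_pos(1)[OF p0]] by (auto simp: g_def)
  define E where "E = {p \<in> M. g p = g p0}"
  have ES: "E \<subseteq> Mstar"
    using g0 on_M(7) unfolding E_def Mstar_def g_def by fastforce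
  have "closedin (top_of_set M) (M \<inter> g -` {g p0})"
    using norm_continuous(1) unfolding g_def[abs_def, symmetric] by (rule continuous_closedin_preimage) simp
  moreover have "M \<inter> g -` {g p0} = E" by (auto simp: E_def)
  ultimately have cl: "closedin (top_of_set M) E" by simp
  have op: "openin (top_of_set M) E"
  proof (subst openin_subopen, intro ballI)
    fix p assume p: "p \<in> E"
    then have "p \<in> Mstar" using ES by blast
    then obtain T where T: "openin (top_of_set M) T" "p \<in> T" "\<forall>q\<in>T. cN N q = cN N p"
      using Mstar_locally_constant[of p "cN N"] by blast
    have "T \<subseteq> E"
    proof
      fix q assume q: "q \<in> T"
      then have "q \<in> M" using T(1) openin_imp_subset by blast
      then show "q \<in> E" using gc[of q] gc[of p] T(3) q p unfolding E_def by simp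
    qed
    then show "\<exists>T. openin (top_of_set M) T \<and> p \<in> T \<and> T \<subseteq> E" using T by blast
  qed
  have "p0 \<in> E" using Mstar_pos(1)[OF p0] by (simp add: E_def)
  then have "E = M" using conn cl op unfolding connected_clopen by blast
  then show ?thesis using ES Mstar_def by auto
qed

lemma constants:
  obtains c s a b d where
    "\<forall>p\<in>M. cN N p = c" "\<forall>p\<in>M. sN N p = s" "\<forall>p\<in>M. shape_coef1 M N p = a"
    "\<forall>p\<in>M. shape_coef12 M N p = b" "\<forall>p\<in>M. shape_coef2 M N p = d"
proof -
  note l = Mstar_locally_constant[unfolded Mstar_eq]
  obtain c where 1: "\<And>p. p \<in> M \<Longrightarrow> cN N p = c" by (rule constant_on_M[of "cN N"]) (use l in auto)
  obtain s where 2: "\<And>p. p \<in> M \<Longrightarrow> sN N p = s" by (rule constant_on_M[of "sN N"]) (use l in auto)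
  obtain a where 3: "\<And>p. p \<in> M \<Longrightarrow> shape_coef1 M N p = a" by (rule constant_on_M[of "shape_coef1 M N"]) (use l in auto)
  obtain b where 4: "\<And>p. p \<in> M \<Longrightarrow> shape_coef12 M N p = b" by (rule constant_on_M[of "shape_coef12 M N"]) (use l in auto)
  obtain d where 5: "\<And>p. p \<in> M \<Longrightarrow> shape_coef2 M N p = d" by (rule constant_on_M[of "shape_coef2 M N"]) (use l in auto)
  show ?thesis by (rule that; rule ballI) (rule 1 2 3 4 5; assumption)+
qed

end

section \<open>Lorentz maps and the models\<close>

lemma H2_D: "z \<in> H2 \<Longrightarrow> lor z z = -1" "z \<in> H2 \<Longrightarrow> z$1 > 0"
  by (simp_all add: H2_def)

lemma H2_sq: "z \<in> H2 \<Longrightarrow> (z$1)\<^sup>2 = 1 + (z$2)\<^sup>2 + (z$3)\<^sup>2"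
  by (simp add: H2_def lor_def power2_eq_square)

text \<open>Reverse Cauchy-Schwarz: the squared time term exceeds the squared space term by 1 plus a
  sum of squares.\<close>

lemma H2_lor_neg:
  assumes "z \<in> H2" "h \<in> H2" shows "lor z h < 0"
proof -
  have aux: "b < a" if "a - b = 1 + i + j + k + l + m" "0 \<le> i" "0 \<le> j" "0 \<le> k" "0 \<le> l" "0 \<le> m"
    for a b i j k l m :: real using that by linarith
  have "(z$1 * h$1)\<^sup>2 - (z$2 * h$2 + z$3 * h$3)\<^sup>2 = 1 + (z$2)\<^sup>2 + (z$3)\<^sup>2 + (h$2)\<^sup>2 + (h$3)\<^sup>2 + (z$2 * h$3 - z$3 * h$2)\<^sup>2"
    using H2_sq[OF assms(1)] H2_sq[OF assms(2)] by algebra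
  from aux[OF this] have "(z$2 * h$2 + z$3 * h$3)\<^sup>2 < (z$1 * h$1)\<^sup>2" by simp
  then have "z$2 * h$2 + z$3 * h$3 < z$1 * h$1"
    by (rule power2_less_imp_less) (use H2_D(2)[OF assms(1)] H2_D(2)[OF assms(2)] in simp)
  then show ?thesis by (simp add: lor_def)
qed

lemma H2_or_uminus:
  assumes "lor w w = -1" shows "w \<in> H2 \<or> - w \<in> H2"
proof -
  have "(w$1)\<^sup>2 = 1 + (w$2)\<^sup>2 + (w$3)\<^sup>2" using assms by (simp add: lor_def power2_eq_square)
  then have "(w$1)\<^sup>2 > 0" by (smt (verit) zero_le_power2)
  then have "w$1 \<noteq> 0" by simp
  then show ?thesis using assms by (auto simp: H2_def lor_simps)
qed

lemma H2_uminus: "w \<in> H2 \<Longrightarrow> - w \<notin> H2"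
  by (simp add: H2_def)

text \<open>The last clause selects the maps that preserve the upper sheet. One point is enough to
  test this, since points of the same sheet have a negative product and points of opposite sheets a
  positive one.\<close>

definition lorentz :: "(R3 \<Rightarrow> R3) \<Rightarrow> bool" where
  "lorentz L \<longleftrightarrow> linear L \<and> (\<forall>x y. lor (L x) (L y) = lor x y) \<and> (\<exists>h\<in>H2. L h \<in> H2)"

lemma lorentz_D: "lorentz L \<Longrightarrow> linear L" "lorentz L \<Longrightarrow> lor (L x) (L y) = lor x y"
  by (auto simp: lorentz_def)

lemma lorentz_H2:
  assumes L: "lorentz L" and z: "z \<in> H2" shows "L z \<in> H2"
proof (rule ccontr)
  assume n: "L z \<notin> H2"
  have "lor (L z) (L z) = -1" using L H2_D(1)[OF z] by (simp add: lorentz_D)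
  then have m: "- L z \<in> H2" using n H2_or_uminus by blast
  obtain h where h: "h \<in> H2" "L h \<in> H2" using L unfolding lorentz_def by blast
  have "lor (- L z) (L h) < 0" by (rule H2_lor_neg[OF m h(2)])
  moreover have "lor (L z) (L h) < 0" using H2_lor_neg[OF z h(1)] L by (simp add: lorentz_D)
  ultimately show False by (simp add: lor_simps)
qed

lemma lorentz_inj: assumes "lorentz L" shows "inj L"
proof -
  have "x = 0" if "L x = 0" for x
  proof (rule lor_nondegenerate)
    fix z show "lor x z = 0" using lorentz_D(2)[OF assms, of x z] that by (simp add: lor_simps)
  qed
  then show ?thesis using linear_injective_0[OF lorentz_D(1)[OF assms]] by blast
qed

lemma lorentz_image: assumes L: "lorentz L" shows "L ` H2 = H2"
proof
  show "L ` H2 \<subseteq> H2" using lorentz_H2[OF L] by blast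
  show "H2 \<subseteq> L ` H2"
  proof
    fix z assume z: "z \<in> H2"
    obtain w where w: "z = L w"
      using linear_injective_imp_surjective[OF lorentz_D(1)[OF L] lorentz_inj[OF L]] by (auto elim: surjE)
    have "lor w w = -1" using lorentz_D(2)[OF L, of w w] H2_D(1)[OF z] w by simp
    then consider "w \<in> H2" | "- w \<in> H2" using H2_or_uminus by blast
    then show "z \<in> L ` H2"
    proof cases
      case 2
      then have "- z \<in> H2" using lorentz_H2[OF L, of "- w"] w lorentz_D(1)[OF L] by (simp add: linear_neg)
      then show ?thesis using H2_uminus z by blast
    qed (use w in blast)
  qed
qed

lemma isometry_product:
  assumes "lorentz L" "lorentz L'"
  shows "isometry_H2xH2 (\<lambda>x. (L (fst x), L' (snd x)))"
proof -
  have "(\<lambda>x. (L (fst x), L' (snd x))) ` (H2 \<times> H2) = (L ` H2) \<times> (L' ` H2)" by (auto simp: image_iff)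
  then show ?thesis
    unfolding isometry_H2xH2_def H2xH2_def lorentz_image[OF assms(1)] lorentz_image[OF assms(2)]
    by (simp add: dprod_def dH_def lorentz_D[OF assms(1)] lorentz_D[OF assms(2)])
qed

lemma lorentz_id: "lorentz (\<lambda>x. x)"
proof -
  have "(vector [1, 0, 0] :: R3) \<in> H2" by (simp add: H2_def lor_def)
  then show ?thesis unfolding lorentz_def by (auto intro: linear_id[unfolded id_def])
qed

text \<open>A rotation of the last two coordinates turns the direction of \<open>w\<close> into (1,
  0, 1), and a boost preserving this null line adjusts the length.\<close>

lemma null_normalize:
  assumes null: "lor w w = 0" "w$1 > 0" and r: "r > 0"
  obtains L where "lorentz L" "L w = r *\<^sub>R vector [1, 0, 1]"
proof -
  define C where "C = w$3 / w$1"
  define S where "S = w$2 / w$1"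
  \<comment> \<open>The required stretch: \<open>i\<close> and \<open>j\<close> below are cosh and
    sinh of \<open>ln k\<close>, and the boost multiplies (1, 0, 1) by
    \<open>i + j = k\<close>.\<close>
  define k where "k = r / w$1"
  define k' where "k' = w$1 / r"
  have k: "k * k' = 1" "k > 0" "k' > 0" "k * w$1 = r" using null(2) r by (simp_all add: k_def k'_def)
  have l: "w$3 = C * w$1" "w$2 = S * w$1" using null(2) by (simp_all add: C_def S_def)
  have "(w$1)\<^sup>2 * (C\<^sup>2 + S\<^sup>2 - 1) = 0" using null(1) unfolding lor_def l by algebra
  then have CS: "C\<^sup>2 + S\<^sup>2 = 1" using null(2) by simp
  define i where "i = (k + k') / 2"
  define j where "j = (k - k') / 2"
  have ij: "i\<^sup>2 - j\<^sup>2 = 1" "i + j = k" "i > 0"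
    using k by (simp_all add: i_def j_def power2_eq_square field_simps)
  define L where "L z = (vector [i * z$1 + j * (S * z$2 + C * z$3), C * z$2 - S * z$3,
    j * z$1 + i * (S * z$2 + C * z$3)] :: R3)" for z :: R3
  have "linear L" by (simp add: linear_iff L_def vec_eq_iff forall_3 algebra_simps)
  moreover have "lor (L x) (L y) = lor x y" for x y
  proof -
    have "lor (L x) (L y) = (i\<^sup>2 - j\<^sup>2) * ((S * x$2 + C * x$3) * (S * y$2 + C * y$3) - x$1 * y$1)
      + (C * x$2 - S * x$3) * (C * y$2 - S * y$3)"
      by (simp add: lor_def L_def power2_eq_square algebra_simps)
    also have "\<dots> = - (x$1 * y$1) + (C\<^sup>2 + S\<^sup>2) * (x$2 * y$2 + x$3 * y$3)" unfolding ij(1) by algebra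
    finally show ?thesis by (simp add: CS lor_def)
  qed
  moreover have "(vector [1, 0, 0] :: R3) \<in> H2" by (simp add: H2_def lor_def)
  moreover have "L (vector [1, 0, 0]) \<in> H2"
  proof -
    have "lor (L (vector [1, 0, 0])) (L (vector [1, 0, 0])) = -1"
      using \<open>\<And>x y. lor (L x) (L y) = lor x y\<close> by (simp add: lor_def)
    moreover have "L (vector [1, 0, 0]) $ 1 > 0" using ij(3) by (simp add: L_def)
    ultimately show ?thesis by (simp add: H2_def)
  qed
  ultimately have "lorentz L" unfolding lorentz_def by blast
  moreover have "L w = r *\<^sub>R vector [1, 0, 1]"
  proof -
    have "S * (S * w$1) + C * (C * w$1) = w$1" using CS by algebra
    moreover have "i * w$1 + j * w$1 = r" "j * w$1 + i * w$1 = r" using k(4) ij(2) by (auto simp: algebra_simps)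
    ultimately show ?thesis by (simp add: vec_eq_iff forall_3 L_def l)
  qed
  ultimately show ?thesis using that by blast
qed

text \<open>\<open>h \<circ> g\<close> is a continuous injection of an open set of \<open>R3\<close>
  into \<open>R3\<close>, hence open. This is pulled back to \<open>X\<close> along
  \<open>h\<close>.\<close>

lemma openin_by_invariance_of_domain:
  fixes X S :: "R6 set"
  assumes sub: "S \<subseteq> X"
    and par: "\<And>y. y \<in> S \<Longrightarrow> \<exists>U (g :: R3 \<Rightarrow> R6). open U \<and> continuous_on U g \<and> inj_on g U \<and> g ` U \<subseteq> S \<and> y \<in> g ` U"
    and inj: "\<And>y. y \<in> X \<Longrightarrow> \<exists>W (h :: R6 \<Rightarrow> R3). open W \<and> y \<in> W \<and> continuous_on (X \<inter> W) h \<and> inj_on h (X \<inter> W)"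
  shows "openin (top_of_set X) S"
proof (subst openin_subopen, intro ballI)
  fix y assume y: "y \<in> S"
  obtain U g where U: "open U" and g: "continuous_on U (g :: R3 \<Rightarrow> R6)" "inj_on g U" "g ` U \<subseteq> S" and yU: "y \<in> g ` U"
    using par[OF y] by blast
  obtain W h where W: "open W" "y \<in> W" and h: "continuous_on (X \<inter> W) (h :: R6 \<Rightarrow> R3)" "inj_on h (X \<inter> W)"
    using inj sub y by blast
  define U' where "U' = g -` W \<inter> U"
  have U': "open U'" "U' \<subseteq> U"
    unfolding U'_def using continuous_on_open_vimage[OF U, of g] g(1) W(1) by blast+
  have gW: "g ` U' \<subseteq> X \<inter> W" using g(3) sub by (auto simp: U'_def)
  have "continuous_on U' (h \<circ> g)"
    by (rule continuous_on_compose) (use g(1) U'(2) h(1) gW continuous_on_subset in blast)+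
  moreover have "inj_on (h \<circ> g) U'"
    by (rule comp_inj_on) (use g(2) U'(2) h(2) gW inj_on_subset in blast)+
  ultimately have op: "open ((h \<circ> g) ` U')" using invariance_of_domain U'(1) by blast
  have "openin (top_of_set (X \<inter> W)) ((X \<inter> W) \<inter> h -` ((h \<circ> g) ` U'))"
    by (rule continuous_openin_preimage_gen[OF h(1) op])
  \<comment> \<open>Injectivity of \<open>h\<close> leaves no further points of \<open>X\<close> in
    the preimage.\<close>
  moreover have "(X \<inter> W) \<inter> h -` ((h \<circ> g) ` U') = g ` U'"
  proof
    show "g ` U' \<subseteq> (X \<inter> W) \<inter> h -` ((h \<circ> g) ` U')" using gW by auto
    show "(X \<inter> W) \<inter> h -` ((h \<circ> g) ` U') \<subseteq> g ` U'"
    proof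
      fix z assume z: "z \<in> (X \<inter> W) \<inter> h -` ((h \<circ> g) ` U')"
      then obtain u where u: "u \<in> U'" "h z = h (g u)" by auto
      then have "z = g u" using z gW inj_onD[OF h(2), of z "g u"] by blast
      then show "z \<in> g ` U'" using u(1) by blast
    qed
  qed
  ultimately have "openin (top_of_set (X \<inter> W)) (g ` U')" by simp
  then have "openin (top_of_set X) (g ` U')" using openin_trans openin_open_Int[OF W(1)] by blast
  moreover have "y \<in> g ` U'" using yU W(2) by (auto simp: U'_def)
  moreover have "g ` U' \<subseteq> S" using g(3) U'(2) by blast
  ultimately show "\<exists>T. openin (top_of_set X) T \<and> y \<in> T \<and> T \<subseteq> S" by blast
qed

text \<open>Horospherical coordinates centred at the null direction (1, 0, 1): curves of constant
  \<open>t\<close> are horocycles and curves of constant \<open>r\<close> are geodesics tending to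
  that direction.\<close>

definition horo :: "real \<Rightarrow> real \<Rightarrow> R3" where
  "horo t r = cosh t *\<^sub>R gam r + sinh t *\<^sub>R Ngam r"

lemma horo_components:
  "horo t r $ 1 = cosh t + r\<^sup>2 / 2 * exp (- t)" "horo t r $ 2 = r * exp (- t)" "horo t r $ 3 = sinh t + r\<^sup>2 / 2 * exp (- t)"
  by (simp_all add: horo_def gam_def Ngam_def cosh_def sinh_def field_simps)

lemma horo_diff: "horo t r $ 1 - horo t r $ 3 = exp (- t)"
  by (simp add: horo_components cosh_def sinh_def field_simps)

lemma horo_H2: "horo t r \<in> H2"
proof -
  have e: "exp t * exp (- t) = 1" by (simp add: exp_minus)
  have "lor (horo t r) (horo t r) = (horo t r $ 2)\<^sup>2 - (horo t r $ 1 - horo t r $ 3) * (horo t r $ 1 + horo t r $ 3)"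
    unfolding lor_def by algebra
  also have "horo t r $ 1 + horo t r $ 3 = exp t + r\<^sup>2 * exp (- t)"
    by (simp add: horo_components cosh_def sinh_def field_simps)
  finally have "lor (horo t r) (horo t r) = -1"
    unfolding horo_diff horo_components(2) using e by algebra
  moreover have "horo t r $ 1 > 0" unfolding horo_components by (intro add_pos_nonneg) auto
  ultimately show ?thesis by (simp add: H2_def)
qed

lemma H2_diff_pos: assumes "p \<in> H2" shows "p$1 - p$3 > 0" "p$1 + p$3 > 0"
proof -
  have "(p$3)\<^sup>2 < (p$1)\<^sup>2" unfolding H2_sq[OF assms] by (smt (verit) zero_le_power2)
  then have "\<bar>p$3\<bar> < p$1" using H2_D(2)[OF assms] power2_less_imp_less[of "\<bar>p$3\<bar>" "p$1"] by simp
  then show "p$1 - p$3 > 0" "p$1 + p$3 > 0" using H2_D(2)[OF assms] by auto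
qed

lemma H2_product: "p \<in> H2 \<Longrightarrow> (p$1 - p$3) * (p$1 + p$3) = 1 + (p$2)\<^sup>2"
  using H2_sq[of p] by (simp add: power2_eq_square algebra_simps)

text \<open>By \<open>H2_product\<close>, \<open>p$1 - p$3\<close> and \<open>p$2\<close> determine
  \<open>p$1 + p$3\<close>.\<close>

lemma H2_eq_horo_coordinates:
  assumes "p \<in> H2" "p' \<in> H2" "p$1 - p$3 = p'$1 - p'$3" "p$2 = p'$2"
  shows "p = p'"
proof -
  have "(p$1 - p$3) * (p$1 + p$3) = (p$1 - p$3) * (p'$1 + p'$3)"
    using H2_product[OF assms(1)] H2_product[OF assms(2)] assms(3,4) by simp
  then have "p$1 + p$3 = p'$1 + p'$3" using H2_diff_pos[OF assms(1)] by simp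
  then show ?thesis using assms(3,4) by (simp add: vec_eq_iff forall_3)
qed

lemma H2_horo:
  assumes "p \<in> H2"
  shows "p = horo (- ln (p$1 - p$3)) (p$2 / (p$1 - p$3))"
proof (rule H2_eq_horo_coordinates[OF assms horo_H2])
  show "p $ 1 - p $ 3 = horo (- ln (p$1 - p$3)) (p$2 / (p$1 - p$3)) $ 1 - horo (- ln (p$1 - p$3)) (p$2 / (p$1 - p$3)) $ 3"
    unfolding horo_diff using H2_diff_pos[OF assms] by simp
  show "p $ 2 = horo (- ln (p$1 - p$3)) (p$2 / (p$1 - p$3)) $ 2"
    unfolding horo_components using H2_diff_pos[OF assms] by simp
qed

text \<open>On \<open>H2\<close>, \<open>- ln (p$1 - p$3)\<close> is the coordinate \<open>t\<close>
  of \<open>horo\<close>, a Busemann function. A linear relation between the Busemann functions of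
  the two factors replaces the common parameter \<open>t\<close> of the models.\<close>

definition "horo_set \<alpha> \<beta> = {x \<in> H2xH2. \<alpha> * ln (fst x $ 1 - fst x $ 3) = \<beta> * ln (snd x $ 1 - snd x $ 3)}"

text \<open>\<open>Ntilde_m\<close> is minus \<open>Ngam\<close>, so the models differ by reversing
  \<open>t\<close> in the second factor.\<close>

lemma horo_minus: "cosh t *\<^sub>R gam r + sinh t *\<^sub>R Ntilde_m r = horo (- t) r"
  by (simp add: vec_eq_iff forall_3 horo_def gam_def Ngam_def Ntilde_m_def field_simps)

lemma horo_image:
  assumes "\<alpha> \<noteq> 0"
  shows "{(horo (\<alpha> * t) r, horo (\<beta> * t) s) | t r s. True} = horo_set \<beta> \<alpha>"
proof
  show "{(horo (\<alpha> * t) r, horo (\<beta> * t) s) | t r s. True} \<subseteq> horo_set \<beta> \<alpha>"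
    by (auto simp: horo_set_def H2xH2_def horo_H2 horo_diff)
  show "horo_set \<beta> \<alpha> \<subseteq> {(horo (\<alpha> * t) r, horo (\<beta> * t) s) | t r s. True}"
  proof
    fix x assume x: "x \<in> horo_set \<beta> \<alpha>"
    define t where "t = - ln (fst x $ 1 - fst x $ 3) / \<alpha>"
    have H: "fst x \<in> H2" "snd x \<in> H2" using x by (auto simp: horo_set_def H2xH2_def)
    have t: "\<alpha> * t = - ln (fst x $ 1 - fst x $ 3)" using assms by (simp add: t_def)
    have "\<alpha> * (\<beta> * t) = \<beta> * (\<alpha> * t)" by simp
    also have "\<dots> = \<alpha> * (- ln (snd x $ 1 - snd x $ 3))" unfolding t using x by (simp add: horo_set_def)
    finally have t': "\<beta> * t = - ln (snd x $ 1 - snd x $ 3)" using iffD1[OF mult_left_cancel[OF assms]] by blast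
    have "x = (horo (\<alpha> * t) (fst x $ 2 / (fst x $ 1 - fst x $ 3)), horo (\<beta> * t) (snd x $ 2 / (snd x $ 1 - snd x $ 3)))"
      unfolding t t' using H2_horo[OF H(1)] H2_horo[OF H(2)] by (simp add: prod_eq_iff)
    then show "x \<in> {(horo (\<alpha> * t) r, horo (\<beta> * t) s) | t r s. True}" by blast
  qed
qed

lemma M11_eq: assumes "0 < c" "c < 1" shows "M11 c = horo_set (sqrt (1 - c)) (sqrt c)"
  using horo_image[of "sqrt c" "sqrt (1 - c)"] assms
  unfolding M11_def model_param_def horo_def[symmetric] by simp

lemma M1m1_eq: assumes "0 < c" "c < 1" shows "M1m1 c = horo_set (sqrt (1 - c)) (- sqrt c)"
proof -
  have "M1m1 c = horo_set (- sqrt (1 - c)) (sqrt c)"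
    using horo_image[of "sqrt c" "- sqrt (1 - c)"] assms
    unfolding M1m1_def model_param_def horo_minus horo_def[symmetric] by simp
  also have "\<dots> = horo_set (sqrt (1 - c)) (- sqrt c)" by (auto simp: horo_set_def)
  finally show ?thesis .
qed

lemma H2_eq_23: "p \<in> H2 \<Longrightarrow> p' \<in> H2 \<Longrightarrow> p$2 = p'$2 \<Longrightarrow> p$3 = p'$3 \<Longrightarrow> p = p'"
proof -
  assume H: "p \<in> H2" "p' \<in> H2" and e: "p$2 = p'$2" "p$3 = p'$3"
  have "(p$1)\<^sup>2 = (p'$1)\<^sup>2" using H2_sq[OF H(1)] H2_sq[OF H(2)] e by simp
  then have "p$1 = p'$1" using H2_D(2)[OF H(1)] H2_D(2)[OF H(2)] by (simp add: power2_eq_iff_nonneg)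
  then show "p = p'" using e by (simp add: vec_eq_iff forall_3)
qed

lemma continuous_on_vector3:
  fixes f g h :: "'a::topological_space \<Rightarrow> real"
  assumes "continuous_on S f" "continuous_on S g" "continuous_on S h"
  shows "continuous_on S (\<lambda>x. vector [f x, g x, h x] :: R3)"
proof -
  have 1: "(\<lambda>x. vector [f x, g x, h x] :: R3) = (\<lambda>x. \<chi> i::3. if i = 1 then f x else if i = 2 then g x else h x)"
    by (simp add: fun_eq_iff vec_eq_iff forall_3)
  show ?thesis
    unfolding 1
  proof (rule continuous_on_vec_lambda)
    fix i :: 3
    show "continuous_on S (\<lambda>x. if i = 1 then f x else if i = 2 then g x else h x)"
      using assms by (cases "i = 1"; cases "i = 2") simp_all
  qed
qed

text \<open>Two coordinates determine the point of the first factor; the defining equation, with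
  \<beta> nonzero, then gives \<open>x$1 - x$3\<close> in the second factor, so one further
  coordinate is enough. These coordinates are global.\<close>

lemma horo_set_local_coordinates:
  assumes "\<beta> \<noteq> 0" "y \<in> horo_set \<alpha> \<beta>"
  shows "\<exists>W (h :: R6 \<Rightarrow> R3). open W \<and> y \<in> W \<and> continuous_on (horo_set \<alpha> \<beta> \<inter> W) h \<and> inj_on h (horo_set \<alpha> \<beta> \<inter> W)"
proof -
  let ?h = "\<lambda>x::R6. vector [fst x $ 2, fst x $ 3, snd x $ 2] :: R3"
  have "continuous_on (horo_set \<alpha> \<beta> \<inter> UNIV) ?h"
    by (intro continuous_on_vector3 continuous_intros)
  moreover have "inj_on ?h (horo_set \<alpha> \<beta> \<inter> UNIV)"
  proof (rule inj_onI)
    fix x x' assume x: "x \<in> horo_set \<alpha> \<beta> \<inter> UNIV" and x': "x' \<in> horo_set \<alpha> \<beta> \<inter> UNIV" and e: "?h x = ?h x'"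
    have H: "fst x \<in> H2" "snd x \<in> H2" "fst x' \<in> H2" "snd x' \<in> H2"
      using x x' by (auto simp: horo_set_def H2xH2_def)
    have e: "fst x $ 2 = fst x' $ 2" "fst x $ 3 = fst x' $ 3" "snd x $ 2 = snd x' $ 2"
      using e by (auto simp: vec_eq_iff forall_3)
    have p: "fst x = fst x'" by (rule H2_eq_23[OF H(1,3) e(1,2)])
    then have "\<beta> * ln (snd x $ 1 - snd x $ 3) = \<beta> * ln (snd x' $ 1 - snd x' $ 3)"
      using x x' unfolding horo_set_def by auto
    then have "snd x $ 1 - snd x $ 3 = snd x' $ 1 - snd x' $ 3"
      using assms(1) H2_diff_pos[OF H(2)] H2_diff_pos[OF H(4)] by simp
    then have "snd x = snd x'" using H2_eq_horo_coordinates[OF H(2,4)] e(3) by blast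
    then show "x = x'" using p by (simp add: prod_eq_iff)
  qed
  ultimately show ?thesis by (intro exI[of _ UNIV] exI[of _ ?h]) auto
qed

text \<open>For a fixed first point \<open>p\<close> the second point runs over a circle about
  \<open>p\<close>. Its component transverse to the direction from \<open>p\<close> to
  \<open>q0\<close> is injective on the half circle facing \<open>q0\<close>, which is singled out
  by \<open>g > 0\<close>.\<close>

lemma Mtau_local_coordinates:
  assumes \<tau>: "\<tau> < -1" and y: "y \<in> Mtau \<tau>"
  shows "\<exists>W (h :: R6 \<Rightarrow> R3). open W \<and> y \<in> W \<and> continuous_on (Mtau \<tau> \<inter> W) h \<and> inj_on h (Mtau \<tau> \<inter> W)"
proof -
  define q0 where "q0 = snd y"
  define h where "h x = (vector [fst x $ 2, fst x $ 3, lor (lcross (fst x) q0) (snd x)] :: R3)" for x :: R6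
  define g where "g x = lor q0 (snd x) + lor (fst x) q0 * lor (fst x) (snd x)" for x :: R6
  define W where "W = {x. g x > 0}"
  have cl: "continuous_on S (\<lambda>x. lor (f1 x) (f2 x))" if "continuous_on S f1" "continuous_on S f2" for S and f1 f2 :: "R6 \<Rightarrow> R3"
    by (rule bounded_bilinear.continuous_on[OF bounded_bilinear_lor that])
  have cc: "continuous_on S (\<lambda>x. lcross (f1 x) (f2 x))" if "continuous_on S f1" "continuous_on S f2" for S and f1 f2 :: "R6 \<Rightarrow> R3"
    by (rule bounded_bilinear.continuous_on[OF bounded_bilinear_lcross that])
  have "open W" unfolding W_def g_def
    by (intro open_Collect_less continuous_intros cl)
  moreover have "y \<in> W"
  proof -
    have yy: "lor (fst y) q0 = \<tau>" "lor q0 q0 = -1" using y by (auto simp: Mtau_def H2xH2_def H2_def q0_def)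
    \<comment> \<open>\<open>g\<close> has the value \<open>\<tau> * \<tau> - 1\<close> at
      \<open>y\<close>; the condition on \<tau> keeps the circle from degenerating to a
      point.\<close>
    have "\<tau> * \<tau> > 1" using \<tau> mult_strict_mono'[of 1 "-\<tau>" 1 "-\<tau>"] by simp
    then show ?thesis unfolding W_def g_def using yy by (simp add: q0_def)
  qed
  moreover have "continuous_on (Mtau \<tau> \<inter> W) h"
    unfolding h_def by (intro continuous_on_vector3 continuous_intros cl cc)
  moreover have "inj_on h (Mtau \<tau> \<inter> W)"
  proof (rule inj_onI)
    fix x x' assume x: "x \<in> Mtau \<tau> \<inter> W" and x': "x' \<in> Mtau \<tau> \<inter> W" and e: "h x = h x'"
    have H: "fst x \<in> H2" "snd x \<in> H2" "fst x' \<in> H2" "snd x' \<in> H2"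
      and t: "lor (fst x) (snd x) = \<tau>" "lor (fst x') (snd x') = \<tau>" and gp: "g x > 0" "g x' > 0"
      using x x' by (auto simp: Mtau_def H2xH2_def W_def)
    have e: "fst x $ 2 = fst x' $ 2" "fst x $ 3 = fst x' $ 3"
      "lor (lcross (fst x) q0) (snd x) = lor (lcross (fst x') q0) (snd x')"
      using e by (auto simp: vec_eq_iff forall_3 h_def)
    have px: "fst x' = fst x" using H2_eq_23[OF H(1,3) e(1,2)] by simp
    define p where "p = fst x"
    define u where "u = q0 + lor p q0 *\<^sub>R p"
    define v where "v = snd x - snd x'"
    have pp: "lor p p = -1" using H(1) by (simp add: p_def H2_D)
    have up: "lor u p = 0" by (simp add: u_def lor_simps pp lor_sym[of q0])
    have ug: "lor u (snd x) > 0" "lor u (snd x') > 0" using gp by (simp_all add: u_def g_def lor_simps p_def px)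
    have "u \<noteq> 0" using ug by (auto simp: lor_simps)
    then have uu: "lor u u > 0" using lor_spacelike[OF pp up] by (metis order_le_less)
    define n where "n = (1 / sqrt (lor u u)) *\<^sub>R u"
    have nn: "lor n n = 1" using uu by (simp add: n_def lor_simps)
    have np: "lor n p = 0" by (simp add: n_def lor_simps up)
    have vp: "lor v p = 0" using t px by (simp add: v_def p_def lor_simps lor_sym)
    have "lcross p u = lcross p q0"
      by (simp add: u_def bounded_bilinear.add_right[OF bounded_bilinear_lcross] bounded_bilinear.scaleR_right[OF bounded_bilinear_lcross] lcross_self)
    then have "lor v (lcross p n) = 0"
      using e(3) by (simp add: n_def bounded_bilinear.scaleR_right[OF bounded_bilinear_lcross] lor_simps v_def px p_def lor_sym)
    then have vn: "v = lor v n *\<^sub>R n" using lor_expand[OF pp nn np, of v] vp by simp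
    \<comment> \<open>Both points have the same Lorentzian square, so their difference is orthogonal
      to their sum; as a multiple of \<open>n\<close>, which has a positive product with the sum, it
      must vanish.\<close>
    have "lor v (snd x + snd x') = 0"
      using H2_D(1)[OF H(2)] H2_D(1)[OF H(4)] by (simp add: v_def lor_simps lor_sym)
    then have "lor (lor v n *\<^sub>R n) (snd x + snd x') = 0" using vn by simp
    then have "lor v n * lor n (snd x + snd x') = 0" unfolding lor_simps(5) .
    moreover have "lor n (snd x + snd x') > 0"
      using ug uu by (simp add: n_def lor_simps add_pos_pos)
    ultimately have "lor v n = 0" by simp
    then have "v = 0" using vn by simp
    then show "x = x'" using px by (simp add: v_def prod_eq_iff)
  qed
  ultimately show ?thesis by blast
qed

section \<open>The classification\<close>

text \<open>If the derivative of \<open>L\<close> is a multiple of \<open>L\<close>, its ray is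
  fixed: dividing by the first coordinate exhibits the ray, and the logarithm of that coordinate
  integrates the multiplier.\<close>

lemma normalized_eigencurve:
  fixes L :: "'a::real_normed_vector \<Rightarrow> R3"
  assumes L: "L differentiable (at x)" "\<And>v. dird L x v = lam v *\<^sub>R L x" and pos: "L x $ 1 > 0"
  shows "(\<lambda>y. ln (L y $ 1)) differentiable (at x)" "dird (\<lambda>y. ln (L y $ 1)) x v = lam v"
    "(\<lambda>y. inverse (L y $ 1) *\<^sub>R L y) differentiable (at x)" "dird (\<lambda>y. inverse (L y $ 1) *\<^sub>R L y) x v = 0"
proof -
  note nth = dird_linear_compose[OF bounded_linear_vec_nth L(1), of 1]
  have "dird (\<lambda>y. L y $ 1) x = (\<lambda>v. lam v * L x $ 1)" using nth(1) L(2) by (simp add: fun_eq_iff)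
  then have h: "((\<lambda>y. L y $ 1) has_derivative (\<lambda>v. lam v * L x $ 1)) (at x)"
    using has_derivative_dird[OF nth(2)] by simp
  have "((\<lambda>y. ln (L y $ 1)) has_derivative (\<lambda>v. lam v * L x $ 1 * inverse (L x $ 1))) (at x)"
    by (rule DERIV_compose_FDERIV[where f = ln and g = "\<lambda>y. L y $ 1", OF DERIV_ln[OF pos] h])
  then have l: "((\<lambda>y. ln (L y $ 1)) has_derivative lam) (at x)" using pos by (simp add: mult.assoc)
  show "(\<lambda>y. ln (L y $ 1)) differentiable (at x)" using l unfolding differentiable_def by blast
  show "dird (\<lambda>y. ln (L y $ 1)) x v = lam v" using dird_eq[OF l] .
  have "((\<lambda>y. inverse (L y $ 1)) has_derivative (\<lambda>v. - (inverse (L x $ 1) * (lam v * L x $ 1) * inverse (L x $ 1)))) (at x)"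
    using Deriv.has_derivative_inverse[OF _ h] pos by simp
  then have i: "((\<lambda>y. inverse (L y $ 1)) has_derivative (\<lambda>v. - lam v * inverse (L x $ 1))) (at x)"
    using pos by (simp add: field_simps)
  then have id: "(\<lambda>y. inverse (L y $ 1)) differentiable (at x)" unfolding differentiable_def by blast
  show "(\<lambda>y. inverse (L y $ 1) *\<^sub>R L y) differentiable (at x)" by (rule dird_scaleR(2)[OF id L(1)])
  show "dird (\<lambda>y. inverse (L y $ 1) *\<^sub>R L y) x v = 0"
    unfolding dird_scaleR(1)[OF id L(1)] L(2) dird_eq[OF i] by (simp add: algebra_simps)
qed

text \<open>Expanding the time axis in the frame \<open>p, n, m\<close> with
  \<open>m = lcross p n\<close> gives
  \<open>(p$1)\<^sup>2 - (n$1)\<^sup>2 = 1 + (m$1)\<^sup>2\<close>. The bound places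
  \<open>p + n\<close> and \<open>p - n\<close> on the future light cone.\<close>

lemma normal_component_bound:
  assumes p: "p \<in> H2" and n: "lor n n = 1" "lor n p = 0"
  shows "\<bar>n$1\<bar> < p$1"
proof -
  have n1: "(n$2)\<^sup>2 + (n$3)\<^sup>2 = 1 + (n$1)\<^sup>2" using n(1) by (simp add: lor_def power2_eq_square)
  have "(n$1)\<^sup>2 * (p$1)\<^sup>2 + (n$2 * p$3 - n$3 * p$2)\<^sup>2 = ((n$2)\<^sup>2 + (n$3)\<^sup>2) * ((p$2)\<^sup>2 + (p$3)\<^sup>2)"
    using n(2) unfolding lor_def by algebra
  also have "\<dots> = (1 + (n$1)\<^sup>2) * ((p$1)\<^sup>2 - 1)" using n1 H2_sq[OF p] by simp
  finally have eq: "(p$1)\<^sup>2 - (n$1)\<^sup>2 = 1 + (n$2 * p$3 - n$3 * p$2)\<^sup>2" by algebra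
  have "(p$1)\<^sup>2 - (n$1)\<^sup>2 > 0" unfolding eq by (rule add_pos_nonneg) simp_all
  then have "\<bar>n$1\<bar>\<^sup>2 < (p$1)\<^sup>2" by simp
  then show ?thesis by (rule power2_less_imp_less) (use H2_D(2)[OF p] in simp)
qed

context hyper_chart
begin

lemma horospheric_sections:
  assumes x: "x \<in> V" and b: "b x = 0" and a: "a x = \<epsilon> * F.r x" and d: "d x = \<delta> * G.r x"
    and sq: "\<epsilon> * \<epsilon> = 1" "\<delta> * \<delta> = 1"
  shows "(\<lambda>y. fst (\<phi> y) + \<epsilon> *\<^sub>R n1 N (\<phi> y)) differentiable (at x)"
    "dird (\<lambda>y. fst (\<phi> y) + \<epsilon> *\<^sub>R n1 N (\<phi> y)) x v = (\<epsilon> * (G.r x * \<eta> x v)) *\<^sub>R (fst (\<phi> x) + \<epsilon> *\<^sub>R n1 N (\<phi> x))"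
    "(\<lambda>y. snd (\<phi> y) + \<delta> *\<^sub>R n2 N (\<phi> y)) differentiable (at x)"
    "dird (\<lambda>y. snd (\<phi> y) + \<delta> *\<^sub>R n2 N (\<phi> y)) x v = (\<delta> * (- F.r x * \<eta> x v)) *\<^sub>R (snd (\<phi> x) + \<delta> *\<^sub>R n2 N (\<phi> x))"
proof -
  have Z: "F.Z x v = \<epsilon> * F.r x * F.\<beta> x v" "G.Z x v = \<delta> * G.r x * G.\<beta> x v" for v
    by (simp_all add: \<zeta>_eq[OF x] a b d)
  show "(\<lambda>y. fst (\<phi> y) + \<epsilon> *\<^sub>R n1 N (\<phi> y)) differentiable (at x)"
    "dird (\<lambda>y. fst (\<phi> y) + \<epsilon> *\<^sub>R n1 N (\<phi> y)) x v = (\<epsilon> * (G.r x * \<eta> x v)) *\<^sub>R (fst (\<phi> x) + \<epsilon> *\<^sub>R n1 N (\<phi> x))"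
    using F.null_section[OF x Z(1) sq(1)] unfolding invariants \<alpha>_eq[OF x] .
  show "(\<lambda>y. snd (\<phi> y) + \<delta> *\<^sub>R n2 N (\<phi> y)) differentiable (at x)"
    "dird (\<lambda>y. snd (\<phi> y) + \<delta> *\<^sub>R n2 N (\<phi> y)) x v = (\<delta> * (- F.r x * \<eta> x v)) *\<^sub>R (snd (\<phi> x) + \<delta> *\<^sub>R n2 N (\<phi> x))"
    using G.null_section[OF x Z(2) sq(2)] unfolding invariants \<alpha>_eq[OF x] .
qed

end

text \<open>The linear map taking the frame \<open>(q, n2, m2)\<close> of the second factor to a frame built from the
  frame of the first; on \<open>Mtau\<close> it is constant along the hypersurface.\<close>

definition transfer :: "(R6 \<Rightarrow> R6) \<Rightarrow> real \<Rightarrow> real \<Rightarrow> real \<Rightarrow> R3 \<Rightarrow> R6 \<Rightarrow> R3" where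
  "transfer N X Y \<sigma> z p = (- lor z (snd p)) *\<^sub>R (X *\<^sub>R fst p + Y *\<^sub>R n1 N p)
    + lor z (n2 N p) *\<^sub>R (- Y *\<^sub>R fst p + - X *\<^sub>R n1 N p) + lor z (m2 N p) *\<^sub>R (\<sigma> *\<^sub>R m1 N p)"

context hyper_chart
begin

text \<open>\<open>X\<close>, \<open>Y\<close>, \<sigma> are such that the combined frame
  \<open>q', n', m'\<close> satisfies the same linear structure equations as
  \<open>Q, G.n, G.m\<close>, so the derivatives of components and of frame vectors cancel in pairs.
  \<open>i\<close> stands for \<open>1 / c0\<close>.\<close>

lemma transfer_stationary:
  assumes x: "x \<in> V" and cs: "F.r x = c0" "G.r x = c0" and ab: "a x = a0" "d x = a0" "b x = b0"
    and i: "i * c0 = 1" "i * i = 2" and ab2: "2 * a0\<^sup>2 = 1 + 2 * b0\<^sup>2" and X: "X = a0 * Y * i" and \<sigma>: "\<sigma> = - b0 * Y * i"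
  shows "(\<lambda>y. transfer N X Y \<sigma> z (\<phi> y)) differentiable (at x)" "dird (\<lambda>y. transfer N X Y \<sigma> z (\<phi> y)) x v = 0"
proof -
  define P where "P = (\<lambda>y. fst (\<phi> y))"
  define Q where "Q = (\<lambda>y. snd (\<phi> y))"
  note dP = F.dP[OF x, folded P_def] and dQ = G.dP[OF x, folded Q_def]
  define q' where "q' y = X *\<^sub>R P y + Y *\<^sub>R F.n y" for y
  define n' where "n' y = - Y *\<^sub>R P y + - X *\<^sub>R F.n y" for y
  define m' where "m' y = \<sigma> *\<^sub>R F.m y" for y
  define h where "h = c0 * \<eta> x v"
  define \<beta> where "\<beta> = F.\<beta> x v"
  define \<beta>' where "\<beta>' = G.\<beta> x v"
  define w where "w = (b0 * \<beta> + a0 * \<beta>') * i"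
  define u where "u = (a0 * \<beta> + b0 * \<beta>') * i"
  have c0: "c0 \<noteq> 0" using i(1) by auto
  have div: "y / c0 = y * i" for y using i(1) c0 by (simp add: field_simps)
  have Z: "F.Z x v / F.r x = u" "G.Z x v / G.r x = w"
    unfolding \<zeta>_eq[OF x] cs ab div u_def w_def \<beta>_def \<beta>'_def by (simp_all add: algebra_simps)
  have d1: "dird P x v = h *\<^sub>R F.n x + \<beta> *\<^sub>R F.m x" "dird F.n x v = h *\<^sub>R P x - u *\<^sub>R F.m x"
    "dird F.m x v = u *\<^sub>R F.n x + \<beta> *\<^sub>R P x"
    using dP_frame[OF x, of v] F.dn(2)[OF x, of v] F.dm(2)[OF x, of v]
    unfolding \<alpha>_eq[OF x] Z unfolding cs P_def h_def \<beta>_def by simp_all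
  have d2: "dird Q x v = (- h) *\<^sub>R G.n x + \<beta>' *\<^sub>R G.m x" "dird G.n x v = (- h) *\<^sub>R Q x - w *\<^sub>R G.m x"
    "dird G.m x v = w *\<^sub>R G.n x + \<beta>' *\<^sub>R Q x"
    using dQ_frame[OF x, of v] G.dn(2)[OF x, of v] G.dm(2)[OF x, of v]
    unfolding \<alpha>_eq[OF x] Z unfolding cs Q_def h_def \<beta>'_def by simp_all
  note sc = dird_linear_compose[OF bounded_linear_scaleR_right]
  note sP = sc[OF dP] and sn = sc[OF F.dn(1)[OF x]] and sm = sc[OF F.dm(1)[OF x]]
  have D: "q' differentiable (at x)" "n' differentiable (at x)" "m' differentiable (at x)"
    unfolding q'_def[abs_def] n'_def[abs_def] m'_def[abs_def] by (intro differentiable_add sP(2) sn(2) sm(2))+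
  \<comment> \<open>The identities \<open>e1\<close> to \<open>e4\<close> match the coefficients of
    the two systems; \<open>e2\<close> and \<open>e4\<close> rest on \<open>z0\<close>, which
    restates the relation between \<open>a0\<close> and \<open>b0\<close>.\<close>
  have e1: "X * \<beta> - Y * u = \<sigma> * \<beta>'" unfolding X \<sigma> u_def by algebra
  have z0: "1 - a0\<^sup>2 * (i * i) + b0\<^sup>2 * (i * i) = 0" using ab2 by (simp add: i(2))
  have "Y * \<beta> - X * u - w * \<sigma> = Y * \<beta> * (1 - a0\<^sup>2 * (i * i) + b0\<^sup>2 * (i * i))" unfolding X \<sigma> u_def w_def by algebra
  then have e2: "Y * \<beta> - X * u = w * \<sigma>" using z0 by simp
  have e3: "\<sigma> * \<beta> = \<beta>' * X - w * Y" unfolding X \<sigma> w_def by algebra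
  have "\<sigma> * u - (\<beta>' * Y - w * X) = - Y * \<beta>' * (1 - a0\<^sup>2 * (i * i) + b0\<^sup>2 * (i * i))" unfolding X \<sigma> u_def w_def by algebra
  then have e4: "\<sigma> * u = \<beta>' * Y - w * X" using z0 by simp
  have q': "dird q' x v = (- h) *\<^sub>R n' x + \<beta>' *\<^sub>R m' x"
  proof -
    have "dird q' x v = (h * Y) *\<^sub>R P x + (h * X) *\<^sub>R F.n x + (X * \<beta> - Y * u) *\<^sub>R F.m x"
      unfolding q'_def[abs_def] dird_add[OF sP(2) sn(2)] sP(1) sn(1) d1 by (simp add: algebra_simps)
    then show ?thesis unfolding e1 n'_def m'_def by (simp add: algebra_simps)
  qed
  have n': "dird n' x v = (- h) *\<^sub>R q' x - w *\<^sub>R m' x"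
  proof -
    have "dird n' x v = (- h * X) *\<^sub>R P x + (- h * Y) *\<^sub>R F.n x - (Y * \<beta> - X * u) *\<^sub>R F.m x"
      unfolding n'_def[abs_def] dird_add[OF sP(2) sn(2)] sP(1) sn(1) d1 by (simp add: algebra_simps)
    then show ?thesis unfolding e2 q'_def m'_def by (simp add: algebra_simps)
  qed
  have m': "dird m' x v = w *\<^sub>R n' x + \<beta>' *\<^sub>R q' x"
  proof -
    have "dird m' x v = (\<sigma> * \<beta>) *\<^sub>R P x + (\<sigma> * u) *\<^sub>R F.n x"
      unfolding m'_def[abs_def] sm(1) d1 by (simp add: algebra_simps)
    then show ?thesis unfolding e3 e4 q'_def n'_def by (simp add: algebra_simps)
  qed
  have T: "(\<lambda>y. transfer N X Y \<sigma> z (\<phi> y)) = (\<lambda>y. (- lor z (Q y)) *\<^sub>R q' y + lor z (G.n y) *\<^sub>R n' y + lor z (G.m y) *\<^sub>R m' y)"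
    unfolding transfer_def q'_def n'_def m'_def P_def Q_def invariants ..
  have zc: "(\<lambda>y. z) differentiable (at x)" "dird (\<lambda>y. z) x v = 0" by simp_all
  note zQ = F.dird_lor[OF zc(1) dQ] and zn = F.dird_lor[OF zc(1) G.dn(1)[OF x]] and zm = F.dird_lor[OF zc(1) G.dm(1)[OF x]]
  have zQm: "(\<lambda>y. - lor z (Q y)) differentiable (at x)" "dird (\<lambda>y. - lor z (Q y)) x v = - lor z (dird Q x v)"
    using zQ by (simp_all add: dird_minus differentiable_minus lor_simps)
  note t1 = dird_scaleR[OF zQm(1) D(1)] and t2 = dird_scaleR[OF zn(2) D(2)] and t3 = dird_scaleR[OF zm(2) D(3)]
  show "(\<lambda>y. transfer N X Y \<sigma> z (\<phi> y)) differentiable (at x)"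
    unfolding T by (intro differentiable_add t1(2) t2(2) t3(2))
  have "dird (\<lambda>y. transfer N X Y \<sigma> z (\<phi> y)) x v
     = ((- lor z (dird Q x v)) *\<^sub>R q' x + (- lor z (Q x)) *\<^sub>R dird q' x v)
     + (lor z (dird G.n x v) *\<^sub>R n' x + lor z (G.n x) *\<^sub>R dird n' x v)
     + (lor z (dird G.m x v) *\<^sub>R m' x + lor z (G.m x) *\<^sub>R dird m' x v)"
    unfolding T dird_add[OF differentiable_add[OF t1(2) t2(2)] t3(2)] dird_add[OF t1(2) t2(2)] t1(1) t2(1) t3(1)
      zn(1) zm(1) zQm(2) zc(2) by (simp add: lor_simps)
  also have "\<dots> = 0" unfolding q' n' m' d2 by (simp add: lor_simps algebra_simps)
  finally show "dird (\<lambda>y. transfer N X Y \<sigma> z (\<phi> y)) x v = 0" .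
qed

end

section \<open>From charts to the whole hypersurface\<close>

context hyper_setting
begin

lemma chart_at:
  assumes "p \<in> M"
  obtains V \<phi> x where "hyper_chart M N k1 k2 k3 V \<phi>" "x \<in> V" "\<phi> x = p"
  using star_chart Mstar_eq assms by metis

lemma constant_by_charts:
  fixes h :: "R6 \<Rightarrow> 'b::real_normed_vector"
  assumes "\<And>V \<phi> y. hyper_chart M N k1 k2 k3 V \<phi> \<Longrightarrow> y \<in> V \<Longrightarrow> (\<lambda>y. h (\<phi> y)) differentiable (at y)"
    "\<And>V \<phi> y v. hyper_chart M N k1 k2 k3 V \<phi> \<Longrightarrow> y \<in> V \<Longrightarrow> dird (\<lambda>y. h (\<phi> y)) y v = 0"
  obtains k where "\<forall>p\<in>M. h p = k"
proof (rule constant_on_M[of h])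
  fix p assume "p \<in> M"
  then obtain V \<phi> x where c: "hyper_chart M N k1 k2 k3 V \<phi>" "x \<in> V" "\<phi> x = p" by (rule chart_at)
  interpret hyper_chart M N k1 k2 k3 V \<phi> by fact
  show "\<exists>T. openin (top_of_set M) T \<and> p \<in> T \<and> (\<forall>q\<in>T. h q = h p)"
    using locally_constant[OF c(2), of h] assms[OF c(1)] c(3) by blast
qed (use that in blast)

lemma frame_on_M:
  assumes p: "p \<in> M"
  shows "lor (n1 N p) (n1 N p) = 1" "lor (n1 N p) (fst p) = 0" "lor (n2 N p) (n2 N p) = 1" "lor (n2 N p) (snd p) = 0"
    "fst p \<in> H2" "snd p \<in> H2"
proof -
  obtain V \<phi> x where c: "hyper_chart M N k1 k2 k3 V \<phi>" "x \<in> V" "\<phi> x = p" by (rule chart_at[OF p])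
  interpret hyper_chart M N k1 k2 k3 V \<phi> by fact
  show "lor (n1 N p) (n1 N p) = 1" "lor (n1 N p) (fst p) = 0" "lor (n2 N p) (n2 N p) = 1" "lor (n2 N p) (snd p) = 0"
    using F.nn[OF c(2)] F.nP[OF c(2)] G.nn[OF c(2)] G.nP[OF c(2)] unfolding invariants c(3) .
  show "fst p \<in> H2" "snd p \<in> H2" using on_M(1-4)[OF p] by (auto simp: H2_def)
qed

lemma open_part_of_image:
  assumes L: "lorentz L" "lorentz L'" and F: "F = (\<lambda>x. (L (fst x), L' (snd x)))" and sub: "F ` M \<subseteq> X"
    and coord: "\<And>y. y \<in> X \<Longrightarrow> \<exists>W (h :: R6 \<Rightarrow> R3). open W \<and> y \<in> W \<and> continuous_on (X \<inter> W) h \<and> inj_on h (X \<inter> W)"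
  shows "open_part_of (F ` M) X"
  unfolding open_part_of_def
proof (intro conjI sub openin_by_invariance_of_domain coord)
  have cont: "continuous_on S F" for S
    unfolding F
    by (rule continuous_on_Pair[OF linear_continuous_on_compose[OF continuous_on_fst[OF continuous_on_id] lorentz_D(1)[OF L(1)]]
      linear_continuous_on_compose[OF continuous_on_snd[OF continuous_on_id] lorentz_D(1)[OF L(2)]]])
  have "inj F"
  proof (rule injI)
    fix x y assume "F x = F y"
    then have "L (fst x) = L (fst y)" "L' (snd x) = L' (snd y)" unfolding F by simp_all
    then have "fst x = fst y" "snd x = snd y"
      using injD[OF lorentz_inj[OF L(1)]] injD[OF lorentz_inj[OF L(2)]] by blast+
    then show "x = y" by (rule prod_eqI)
  qed
  fix y assume "y \<in> F ` M"
  then obtain p where p: "p \<in> M" "y = F p" by blast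
  obtain U \<phi> x where c: "is_chart M N U \<phi>" "x \<in> U" "\<phi> x = p" by (rule chart_exists[OF hyp along p(1)])
  note c' = is_chartD[OF c(1)]
  have "continuous_on U (F \<circ> \<phi>)" by (rule continuous_on_compose[OF c'(4) cont])
  moreover have "inj_on (F \<circ> \<phi>) U" by (rule comp_inj_on[OF c'(3) inj_on_subset[OF \<open>inj F\<close> subset_UNIV]])
  moreover have "(F \<circ> \<phi>) ` U \<subseteq> F ` M" "y \<in> (F \<circ> \<phi>) ` U" using c'(2) c(2,3) p(2) by auto
  ultimately show "\<exists>U (g :: R3 \<Rightarrow> R6). open U \<and> continuous_on U g \<and> inj_on g U \<and> g ` U \<subseteq> F ` M \<and> y \<in> g ` U"
    using c'(1) by blast
qed

lemma constant_data:
  obtains c s a b d where "c > 0" "s > 0" "c\<^sup>2 + s\<^sup>2 = 1" "(a - d)\<^sup>2 + 4 * b\<^sup>2 \<noteq> 0"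
    "b = 0 \<and> a\<^sup>2 = c\<^sup>2 \<and> d\<^sup>2 = s\<^sup>2 \<or> b \<noteq> 0 \<and> a = d \<and> c = s \<and> a\<^sup>2 - b\<^sup>2 = 1 / 2"
    "\<forall>p\<in>M. cN N p = c" "\<forall>p\<in>M. sN N p = s" "\<forall>p\<in>M. shape_coef1 M N p = a"
    "\<forall>p\<in>M. shape_coef12 M N p = b" "\<forall>p\<in>M. shape_coef2 M N p = d"
proof -
  obtain c s a b d where k: "\<forall>p\<in>M. cN N p = c" "\<forall>p\<in>M. sN N p = s" "\<forall>p\<in>M. shape_coef1 M N p = a"
    "\<forall>p\<in>M. shape_coef12 M N p = b" "\<forall>p\<in>M. shape_coef2 M N p = d"
    by (rule constants)
  obtain p where p: "p \<in> M" using ne by blast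
  obtain V \<phi> x where ch: "hyper_chart M N k1 k2 k3 V \<phi>" "x \<in> V" "\<phi> x = p" by (rule chart_at[OF p])
  interpret C: hyper_chart M N k1 k2 k3 V \<phi> by fact
  have eq: "C.F.r x = c" "C.G.r x = s" "C.a x = a" "C.b x = b" "C.d x = d"
    using C.invariants(1,2)[of x] C.coefficient_invariants[OF ch(2)] k p ch(3) by simp_all
  show ?thesis
    by (rule that[OF _ _ _ _ _ k])
      (use C.cs_pos[OF ch(2)] C.cs_1[OF ch(2)] C.disc_nz[OF ch(2)] C.branch_values[OF ch(2)] eq in auto)
qed

lemma Mtau_case:
  assumes c: "c > 0" "c\<^sup>2 + c\<^sup>2 = 1" and ab: "b0 \<noteq> 0" "a0\<^sup>2 - b0\<^sup>2 = 1 / 2"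
    and k: "\<forall>p\<in>M. cN N p = c" "\<forall>p\<in>M. sN N p = c" "\<forall>p\<in>M. shape_coef1 M N p = a0"
      "\<forall>p\<in>M. shape_coef12 M N p = b0" "\<forall>p\<in>M. shape_coef2 M N p = a0"
  shows "\<exists>F \<tau>. isometry_H2xH2 F \<and> \<tau> < -1 \<and> open_part_of (F ` M) (Mtau \<tau>)"
proof -
  define i where "i = 1 / c"
  \<comment> \<open>The modulus gives \<open>\<sigma>\<^sup>2 = 1\<close> and
    \<open>X\<^sup>2 = 1 + Y\<^sup>2\<close>; the sign makes \<open>X\<close> positive, namely the
    quotient of the absolute values of \<open>a0\<close> and \<open>b0\<close>.\<close>
  define Y where "Y = (if a0 > 0 then 1 else -1) * c / \<bar>b0\<bar>"
  define X where "X = a0 * Y * i"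
  define \<sigma> where "\<sigma> = - b0 * Y * i"
  have i: "i * c = 1" using c by (simp add: i_def)
  have ii: "i * i = 2" using c i by algebra
  have ab2: "2 * a0\<^sup>2 = 1 + 2 * b0\<^sup>2" using ab(2) by simp
  have "a0\<^sup>2 > 0" using ab(2) zero_le_power2[of b0] by linarith
  then have a0: "a0 \<noteq> 0" by auto
  have Y2: "b0\<^sup>2 * Y\<^sup>2 = c\<^sup>2" using ab(1) by (simp add: Y_def power_mult_distrib power_divide)
  have "X = \<bar>a0\<bar> * (c * i) / \<bar>b0\<bar>" using a0 by (simp add: X_def Y_def)
  then have X0: "X > 0" using a0 ab(1) i by (simp add: mult.commute[of c])
  have XY: "X\<^sup>2 = 1 + Y\<^sup>2"
  proof -
    have "X\<^sup>2 = a0\<^sup>2 * Y\<^sup>2 * (i * i)" unfolding X_def by algebra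
    then show ?thesis using ab2 Y2 c(2) unfolding ii by algebra
  qed
  have \<sigma>2: "\<sigma>\<^sup>2 = 1"
  proof -
    have "\<sigma>\<^sup>2 = (b0\<^sup>2 * Y\<^sup>2) * (i * i)" unfolding \<sigma>_def by algebra
    then show ?thesis using c(2) unfolding Y2 ii by simp
  qed
  have "\<bar>Y\<bar>\<^sup>2 < X\<^sup>2" using XY by simp
  then have YX: "\<bar>Y\<bar> < X" by (rule power2_less_imp_less) (use X0 in simp)
  have "1\<^sup>2 < X\<^sup>2 \<or> Y = 0" using XY by auto
  moreover have "Y \<noteq> 0" using c ab(1) by (simp add: Y_def)
  ultimately have X1: "X > 1" using power2_less_imp_less[of 1 X] X0 by auto
  obtain p0 where p0: "p0 \<in> M" using ne by blast
  define L where "L z = transfer N X Y \<sigma> z p0" for z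
  have TL: "transfer N X Y \<sigma> z p = L z" if p: "p \<in> M" for z p
  proof -
    have "\<exists>k. \<forall>p\<in>M. transfer N X Y \<sigma> z p = k"
    proof (rule constant_by_charts[of "transfer N X Y \<sigma> z"])
      fix V \<phi> y assume ch: "hyper_chart M N k1 k2 k3 V \<phi>" and y: "y \<in> V"
      interpret C: hyper_chart M N k1 k2 k3 V \<phi> by fact
      have eq: "C.F.r y = c" "C.G.r y = c" "C.a y = a0" "C.b y = b0" "C.d y = a0"
        using C.invariants(1,2)[of y] C.coefficient_invariants[OF y] k C.V_M[OF y] by simp_all
      note st = C.transfer_stationary[OF y eq(1,2,3,5,4) i ii ab2 X_def \<sigma>_def]
      show "(\<lambda>y. transfer N X Y \<sigma> z (\<phi> y)) differentiable (at y)" by (rule st(1))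
      show "dird (\<lambda>y. transfer N X Y \<sigma> z (\<phi> y)) y v = 0" for v by (rule st(2))
    qed blast
    then show ?thesis unfolding L_def using p p0 by force
  qed
  have at: "lor (fst p) (fst p) = -1" "lor (snd p) (snd p) = -1" "lor (fst p) (n1 N p) = 0" "lor (snd p) (n2 N p) = 0"
      "lor (n1 N p) (n1 N p) = 1" "lor (n2 N p) (n2 N p) = 1" "lor (n1 N p) (fst p) = 0" "lor (n2 N p) (snd p) = 0"
      "lor (m1 N p) (m1 N p) = 1" "lor (m1 N p) (fst p) = 0" "lor (m1 N p) (n1 N p) = 0" "lor (fst p) (m1 N p) = 0" "lor (n1 N p) (m1 N p) = 0"
      "lor (snd p) (m2 N p) = 0"
    if p: "p \<in> M" for p
    using on_M(1,2)[OF p] frame_on_M[OF p] by (simp_all add: m1_def m2_def lor_lcross lor_sym)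
  \<comment> \<open>The second point is carried to the geodesic through the first one tangent to
    \<open>n1\<close>, at distance \<open>arcosh X\<close>; hence \<tau> is
    \<open>- X\<close>.\<close>
  have Lq: "L (snd p) = X *\<^sub>R fst p + Y *\<^sub>R n1 N p" if p: "p \<in> M" for p
    using TL[OF p, of "snd p", symmetric] by (simp add: transfer_def at[OF p])
  have lorentz: "lorentz L"
    unfolding lorentz_def
  proof (intro conjI allI bexI)
    show "linear L"
      unfolding L_def transfer_def by (auto simp: linear_iff lor_simps algebra_simps)
    fix z z'
    have ex: "lor z z' = - lor z (snd p0) * lor z' (snd p0) + lor z (n2 N p0) * lor z' (n2 N p0) + lor z (m2 N p0) * lor z' (m2 N p0)"
    proof -
      have "z = (- lor z (snd p0)) *\<^sub>R snd p0 + lor z (n2 N p0) *\<^sub>R n2 N p0 + lor z (m2 N p0) *\<^sub>R m2 N p0"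
        unfolding m2_def by (rule lor_expand) (use at[OF p0] in auto)
      then have "lor z z' = lor ((- lor z (snd p0)) *\<^sub>R snd p0 + lor z (n2 N p0) *\<^sub>R n2 N p0 + lor z (m2 N p0) *\<^sub>R m2 N p0) z'"
        by simp
      then show ?thesis by (simp add: lor_simps lor_sym[of _ z'])
    qed
    define a1 where "a1 = - lor z (snd p0)"
    define a2 where "a2 = lor z (n2 N p0)"
    define a3 where "a3 = lor z (m2 N p0)"
    define d1 where "d1 = - lor z' (snd p0)"
    define d2 where "d2 = lor z' (n2 N p0)"
    define d3 where "d3 = lor z' (m2 N p0)"
    have "lor (L z) (L z') = (a1 * d1 - a2 * d2) * (Y\<^sup>2 - X\<^sup>2) + a3 * d3 * \<sigma>\<^sup>2"
      unfolding L_def transfer_def a1_def[symmetric] a2_def[symmetric] a3_def[symmetric] d1_def[symmetric] d2_def[symmetric] d3_def[symmetric]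
      by (simp add: lor_simps at[OF p0] algebra_simps power2_eq_square)
    then show "lor (L z) (L z') = lor z z'"
      unfolding ex XY \<sigma>2 a1_def a2_def a3_def d1_def d2_def d3_def by simp
  next
    show "snd p0 \<in> H2" by (rule frame_on_M(6)[OF p0])
    have b: "\<bar>n1 N p0 $ 1\<bar> < fst p0 $ 1" by (rule normal_component_bound[OF frame_on_M(5)[OF p0] frame_on_M(1)[OF p0] frame_on_M(2)[OF p0]])
    have "\<bar>Y * n1 N p0 $ 1\<bar> \<le> \<bar>Y\<bar> * fst p0 $ 1" unfolding abs_mult using b by (intro mult_left_mono) auto
    also have "\<dots> < X * fst p0 $ 1" using YX on_M(3)[OF p0] by simp
    finally have "L (snd p0) $ 1 > 0" unfolding Lq[OF p0] by simp
    moreover have "lor (L (snd p0)) (L (snd p0)) = -1"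
      unfolding Lq[OF p0] using XY by (simp add: lor_simps at[OF p0] power2_eq_square)
    ultimately show "L (snd p0) \<in> H2" by (simp add: H2_def)
  qed
  define F where "F = (\<lambda>x::R6. (fst x, L (snd x)))"
  have "F ` M \<subseteq> Mtau (- X)"
  proof
    fix y assume "y \<in> F ` M"
    then obtain p where p: "p \<in> M" "y = (fst p, L (snd p))" unfolding F_def by blast
    have "lor (fst p) (L (snd p)) = - X" unfolding Lq[OF p(1)] by (simp add: lor_simps at[OF p(1)])
    then show "y \<in> Mtau (- X)"
      using p frame_on_M(5)[OF p(1)] lorentz_H2[OF lorentz frame_on_M(6)[OF p(1)]] by (simp add: Mtau_def H2xH2_def)
  qed
  then have "open_part_of (F ` M) (Mtau (- X))"
    using open_part_of_image[OF lorentz_id lorentz F_def] Mtau_local_coordinates[of "- X"] X1 by simp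
  moreover have "isometry_H2xH2 F" unfolding F_def by (rule isometry_product[OF lorentz_id lorentz])
  ultimately show ?thesis using X1 by (intro exI[of _ F] exI[of _ "- X"]) auto
qed

text \<open>The null vectors \<open>A1\<close> and \<open>A2\<close> have fixed rays. The logarithms
  of their first coordinates have differentials \<open>\<epsilon> s \<eta>\<close> and
  \<open>- \<delta> c \<eta>\<close>, so one linear combination is a constant \<open>K\<close>;
  moving the rays to (1, 0, 1) turns this into the equation of \<open>horo_set\<close>.\<close>

lemma horospheric_case:
  assumes cs: "c > 0" "s > 0" "c\<^sup>2 + s\<^sup>2 = 1" and \<epsilon>: "\<epsilon> * \<epsilon> = 1" and \<delta>: "\<delta> * \<delta> = 1"
    and k: "\<forall>p\<in>M. cN N p = c" "\<forall>p\<in>M. sN N p = s" "\<forall>p\<in>M. shape_coef1 M N p = \<epsilon> * c"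
      "\<forall>p\<in>M. shape_coef12 M N p = 0" "\<forall>p\<in>M. shape_coef2 M N p = \<delta> * s"
  shows "\<exists>F. isometry_H2xH2 F \<and> open_part_of (F ` M) (horo_set c (- (\<epsilon> * \<delta>) * s))"
proof -
  define A1 where "A1 p = fst p + \<epsilon> *\<^sub>R n1 N p" for p
  define A2 where "A2 p = snd p + \<delta> *\<^sub>R n2 N p" for p
  have abs1: "\<bar>\<epsilon>\<bar> = 1" "\<bar>\<delta>\<bar> = 1" using \<epsilon> \<delta> by (metis abs_mult_self_eq abs_1 abs_mult abs_ge_zero power2_eq_1_iff power2_eq_square abs_minus_cancel)+
  have pos: "A1 p $ 1 > 0" "A2 p $ 1 > 0" if p: "p \<in> M" for p
  proof -
    note f = frame_on_M[OF p]
    have "\<bar>\<epsilon> * n1 N p $ 1\<bar> < fst p $ 1" "\<bar>\<delta> * n2 N p $ 1\<bar> < snd p $ 1"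
      using normal_component_bound[OF f(5,1,2)] normal_component_bound[OF f(6,3,4)] by (simp_all add: abs_mult abs1)
    then show "A1 p $ 1 > 0" "A2 p $ 1 > 0" by (auto simp: A1_def A2_def)
  qed
  \<comment> \<open>The form \<eta> of a chart, named outside any chart so that the facts below can
    range over all charts.\<close>
  define e where "e \<phi> = adapted_chart.\<eta> (\<lambda>y. fst (\<phi> y)) (\<lambda>y. snd (\<phi> y)) (\<lambda>y. fst (N (\<phi> y))) (\<lambda>y. snd (N (\<phi> y)))" for \<phi>
  have chart_facts:
    "(\<lambda>y. A1 (\<phi> y)) differentiable (at y)" "dird (\<lambda>y. A1 (\<phi> y)) y v = (\<epsilon> * (s * e \<phi> y v)) *\<^sub>R A1 (\<phi> y)"
    "(\<lambda>y. A2 (\<phi> y)) differentiable (at y)" "dird (\<lambda>y. A2 (\<phi> y)) y v = (\<delta> * (- c * e \<phi> y v)) *\<^sub>R A2 (\<phi> y)"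
    if ch: "hyper_chart M N k1 k2 k3 V \<phi>" and y: "y \<in> V" for V \<phi> y v
  proof -
    interpret C: hyper_chart M N k1 k2 k3 V \<phi> by fact
    have eq: "C.F.r y = c" "C.G.r y = s" "C.a y = \<epsilon> * c" "C.b y = 0" "C.d y = \<delta> * s"
      using C.invariants(1,2)[of y] C.coefficient_invariants[OF y] k C.V_M[OF y] by simp_all
    note h = C.horospheric_sections[OF y eq(4) _ _ \<epsilon> \<delta>, unfolded eq, OF refl refl, folded A1_def A2_def]
    show "(\<lambda>y. A1 (\<phi> y)) differentiable (at y)" "dird (\<lambda>y. A1 (\<phi> y)) y v = (\<epsilon> * (s * e \<phi> y v)) *\<^sub>R A1 (\<phi> y)"
      "(\<lambda>y. A2 (\<phi> y)) differentiable (at y)" "dird (\<lambda>y. A2 (\<phi> y)) y v = (\<delta> * (- c * e \<phi> y v)) *\<^sub>R A2 (\<phi> y)"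
      unfolding e_def by (rule h)+
  qed
  have inM: "\<phi> y \<in> M" if "hyper_chart M N k1 k2 k3 V \<phi>" "y \<in> V" for V \<phi> y
    using hyper_chart.V_M that by blast
  have N1: "(\<lambda>y. ln (A1 (\<phi> y) $ 1)) differentiable (at y)" "dird (\<lambda>y. ln (A1 (\<phi> y) $ 1)) y v = \<epsilon> * (s * e \<phi> y v)"
    "(\<lambda>y. inverse (A1 (\<phi> y) $ 1) *\<^sub>R A1 (\<phi> y)) differentiable (at y)" "dird (\<lambda>y. inverse (A1 (\<phi> y) $ 1) *\<^sub>R A1 (\<phi> y)) y v = 0"
    and N2: "(\<lambda>y. ln (A2 (\<phi> y) $ 1)) differentiable (at y)" "dird (\<lambda>y. ln (A2 (\<phi> y) $ 1)) y v = \<delta> * (- c * e \<phi> y v)"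
    "(\<lambda>y. inverse (A2 (\<phi> y) $ 1) *\<^sub>R A2 (\<phi> y)) differentiable (at y)" "dird (\<lambda>y. inverse (A2 (\<phi> y) $ 1) *\<^sub>R A2 (\<phi> y)) y v = 0"
    if ch: "hyper_chart M N k1 k2 k3 V \<phi>" and y: "y \<in> V" for V \<phi> y v
    by (rule normalized_eigencurve[OF chart_facts(1,2)[OF ch y] pos(1)[OF inM[OF ch y]]]
      normalized_eigencurve[OF chart_facts(3,4)[OF ch y] pos(2)[OF inM[OF ch y]]])+
  have "\<exists>w. \<forall>p\<in>M. inverse (A1 p $ 1) *\<^sub>R A1 p = w"
    by (rule constant_by_charts[of "\<lambda>p. inverse (A1 p $ 1) *\<^sub>R A1 p"]; (erule (1) N1(3) | erule (1) N1(4) | erule exI))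
  then obtain w1 where w1: "\<forall>p\<in>M. inverse (A1 p $ 1) *\<^sub>R A1 p = w1" by (elim exE)
  have "\<exists>w. \<forall>p\<in>M. inverse (A2 p $ 1) *\<^sub>R A2 p = w"
    by (rule constant_by_charts[of "\<lambda>p. inverse (A2 p $ 1) *\<^sub>R A2 p"]; (erule (1) N2(3) | erule (1) N2(4) | erule exI))
  then obtain w2 where w2: "\<forall>p\<in>M. inverse (A2 p $ 1) *\<^sub>R A2 p = w2" by (elim exE)
  have "\<exists>K. \<forall>p\<in>M. \<epsilon> * c * ln (A1 p $ 1) + \<delta> * s * ln (A2 p $ 1) = K"
  proof (rule constant_by_charts[of "\<lambda>p. \<epsilon> * c * ln (A1 p $ 1) + \<delta> * s * ln (A2 p $ 1)"])
    fix V \<phi> y assume ch: "hyper_chart M N k1 k2 k3 V \<phi>" and y: "y \<in> V"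
    note d1 = N1(1,2)[OF ch y] and d2 = N2(1,2)[OF ch y]
    have m: "(\<lambda>y. \<epsilon> * c * ln (A1 (\<phi> y) $ 1)) differentiable (at y)" "(\<lambda>y. \<delta> * s * ln (A2 (\<phi> y) $ 1)) differentiable (at y)"
      by (intro differentiable_mult differentiable_const d1 d2)+
    then show "(\<lambda>y. \<epsilon> * c * ln (A1 (\<phi> y) $ 1) + \<delta> * s * ln (A2 (\<phi> y) $ 1)) differentiable (at y)"
      by (rule differentiable_add)
    fix v
    show "dird (\<lambda>y. \<epsilon> * c * ln (A1 (\<phi> y) $ 1) + \<delta> * s * ln (A2 (\<phi> y) $ 1)) y v = 0"
      unfolding dird_add[OF m] dird_mult[OF differentiable_const d1(1)] dird_mult[OF differentiable_const d2(1)] d1(2) d2(2)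
      using \<epsilon> \<delta> by simp
  qed blast
  then obtain K where K: "\<And>p. p \<in> M \<Longrightarrow> \<epsilon> * c * ln (A1 p $ 1) + \<delta> * s * ln (A2 p $ 1) = K" by blast
  obtain p0 where p0: "p0 \<in> M" using ne by blast
  have null: "lor (A1 p) (A1 p) = 0" "lor (A2 p) (A2 p) = 0" "lor (fst p) (A1 p) = -1" "lor (snd p) (A2 p) = -1" if p: "p \<in> M" for p
    using on_M(1,2)[OF p] frame_on_M(1-4)[OF p] \<epsilon> \<delta> lor_sym[of "fst p" "n1 N p"] lor_sym[of "snd p" "n2 N p"]
    by (simp_all add: A1_def A2_def lor_simps)
  have w: "lor w1 w1 = 0" "lor w2 w2 = 0" "w1 $ 1 > 0" "w2 $ 1 > 0"
    using w1[THEN bspec, OF p0, symmetric] w2[THEN bspec, OF p0, symmetric] null[OF p0] pos[OF p0] by (simp_all add: lor_simps)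
  have pw: "lor (fst p) w1 = - inverse (A1 p $ 1)" "lor (snd p) w2 = - inverse (A2 p $ 1)" if p: "p \<in> M" for p
    using w1[THEN bspec, OF p, symmetric] w2[THEN bspec, OF p, symmetric] null[OF p] by (simp_all add: lor_simps)
  \<comment> \<open>The equation of \<open>horo_set\<close> has no constant term; stretching
    \<open>w1\<close> by \<open>exp \<kappa>\<close> absorbs \<open>K\<close>.\<close>
  define \<kappa> where "\<kappa> = - \<epsilon> * K / c"
  obtain L where L: "lorentz L" "L w1 = exp \<kappa> *\<^sub>R vector [1, 0, 1]" by (rule null_normalize[OF w(1,3) exp_gt_zero])
  obtain L' where L': "lorentz L'" "L' w2 = 1 *\<^sub>R vector [1, 0, 1]" by (rule null_normalize[OF w(2,4) zero_less_one])
  define F where "F = (\<lambda>x. (L (fst x), L' (snd x)))"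
  have "F ` M \<subseteq> horo_set c (- (\<epsilon> * \<delta>) * s)"
  proof
    fix y assume "y \<in> F ` M"
    then obtain p where p: "p \<in> M" and y: "y = (L (fst p), L' (snd p))" unfolding F_def by blast
    define h1 where "h1 = A1 p $ 1"
    define h2 where "h2 = A2 p $ 1"
    have hp: "h1 > 0" "h2 > 0" using pos[OF p] by (simp_all add: h1_def h2_def)
    have "lor (L (fst p)) (L w1) = - inverse h1" "lor (L' (snd p)) (L' w2) = - inverse h2"
      using pw[OF p] by (simp_all add: lorentz_D(2)[OF L(1)] lorentz_D(2)[OF L'(1)] h1_def h2_def)
    then have 1: "exp \<kappa> * (L (fst p) $ 1 - L (fst p) $ 3) = inverse h1" and 2: "L' (snd p) $ 1 - L' (snd p) $ 3 = inverse h2"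
      unfolding L(2) L'(2) by (simp_all add: lor_def algebra_simps)
    have "L (fst p) $ 1 - L (fst p) $ 3 = exp (- \<kappa>) * (exp \<kappa> * (L (fst p) $ 1 - L (fst p) $ 3))" by (simp add: exp_minus)
    then have e: "L (fst p) $ 1 - L (fst p) $ 3 = inverse h1 * exp (- \<kappa>)" "L' (snd p) $ 1 - L' (snd p) $ 3 = inverse h2"
      using 2 unfolding 1 by simp_all
    have l: "ln (L (fst p) $ 1 - L (fst p) $ 3) = - ln h1 - \<kappa>" "ln (L' (snd p) $ 1 - L' (snd p) $ 3) = - ln h2"
      unfolding e using hp by (simp_all add: ln_mult ln_inverse)
    have ck: "c * \<kappa> = - \<epsilon> * K" using cs(1) by (simp add: \<kappa>_def)
    have "c * (- ln h1 - \<kappa>) = - c * ln h1 + \<epsilon> * (\<epsilon> * c * ln h1 + \<delta> * s * ln h2)"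
      using ck K[OF p] by (simp add: h1_def h2_def algebra_simps)
    also have "\<dots> = (- (\<epsilon> * \<delta>) * s) * (- ln h2)" using \<epsilon> by algebra
    finally show "y \<in> horo_set c (- (\<epsilon> * \<delta>) * s)"
      unfolding horo_set_def y using l lorentz_H2[OF L(1) frame_on_M(5)[OF p]] lorentz_H2[OF L'(1) frame_on_M(6)[OF p]]
      by (simp add: H2xH2_def)
  qed
  moreover have "- (\<epsilon> * \<delta>) * s \<noteq> 0" using \<epsilon> \<delta> cs(2) by auto
  ultimately have "open_part_of (F ` M) (horo_set c (- (\<epsilon> * \<delta>) * s))"
    using open_part_of_image[OF L(1) L'(1) F_def] horo_set_local_coordinates by blast
  moreover have "isometry_H2xH2 F" unfolding F_def by (rule isometry_product[OF L(1) L'(1)])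
  ultimately show ?thesis by blast
qed

theorem classification:
  "\<exists>F. isometry_H2xH2 F \<and>
           ((\<exists>c. c \<in> {0<..<1/2} \<union> {1/2<..<1} \<and> open_part_of (F ` M) (M1m1 c)) \<or>
            (\<exists>c. c \<in> {0<..<1} \<and> open_part_of (F ` M) (M11 c)) \<or>
            (\<exists>\<tau>. \<tau> < -1 \<and> open_part_of (F ` M) (Mtau \<tau>)))"
proof -
  obtain c s a b d where cs: "c > 0" "s > 0" "c\<^sup>2 + s\<^sup>2 = 1" and disc: "(a - d)\<^sup>2 + 4 * b\<^sup>2 \<noteq> 0"
    and br: "b = 0 \<and> a\<^sup>2 = c\<^sup>2 \<and> d\<^sup>2 = s\<^sup>2 \<or> b \<noteq> 0 \<and> a = d \<and> c = s \<and> a\<^sup>2 - b\<^sup>2 = 1 / 2"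
    and k: "\<forall>p\<in>M. cN N p = c" "\<forall>p\<in>M. sN N p = s" "\<forall>p\<in>M. shape_coef1 M N p = a"
      "\<forall>p\<in>M. shape_coef12 M N p = b" "\<forall>p\<in>M. shape_coef2 M N p = d"
    by (rule constant_data)
  from br show ?thesis
  proof (elim disjE conjE)
    assume b: "b \<noteq> 0" "a = d" "c = s" "a\<^sup>2 - b\<^sup>2 = 1 / 2"
    have "\<exists>F \<tau>. isometry_H2xH2 F \<and> \<tau> < -1 \<and> open_part_of (F ` M) (Mtau \<tau>)"
      by (rule Mtau_case[of c b a]) (use cs b k in auto)
    then show ?thesis by blast
  next
    assume b: "b = 0" "a\<^sup>2 = c\<^sup>2" "d\<^sup>2 = s\<^sup>2"
    define \<epsilon> where "\<epsilon> = a / c"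
    define \<delta> where "\<delta> = d / s"
    have a: "a = \<epsilon> * c" and d: "d = \<delta> * s" using cs by (simp_all add: \<epsilon>_def \<delta>_def)
    have sq: "\<epsilon> * \<epsilon> = 1" "\<delta> * \<delta> = 1"
      using b(2,3) cs by (simp_all add: \<epsilon>_def \<delta>_def power2_eq_square)
    obtain F where F: "isometry_H2xH2 F" "open_part_of (F ` M) (horo_set c (- (\<epsilon> * \<delta>) * s))"
      using horospheric_case[OF cs sq] k unfolding a d b(1) by blast
    \<comment> \<open>In the equations of the models the root of the parameter multiplies the
      logarithm of the second factor, so the parameter is \<open>s\<^sup>2\<close>.\<close>
    define C where "C = s\<^sup>2"
    have "c\<^sup>2 > 0" using cs(1) by simp
    then have "s\<^sup>2 < 1" using cs(3) by linarith
    then have C: "0 < C" "C < 1" "sqrt C = s" "sqrt (1 - C) = c"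
      using cs by (auto simp: C_def real_sqrt_unique algebra_simps)
    have "(\<epsilon> * \<delta>) * (\<epsilon> * \<delta>) = 1" using sq by algebra
    then consider "\<epsilon> * \<delta> = 1" | "\<epsilon> * \<delta> = -1" using square_eq_1_iff by blast
    then show ?thesis
    proof cases
      case 1
      \<comment> \<open>At 1/2 with equal signs the block would have \<open>a = d\<close> and
        \<open>b = 0\<close>, that is, a double curvature.\<close>
      have "C \<noteq> 1 / 2"
      proof
        assume "C = 1 / 2"
        then have "s\<^sup>2 = c\<^sup>2" using cs(3) by (simp add: C_def)
        then have "s = c" using cs by (simp add: power2_eq_iff_nonneg)
        moreover have "\<epsilon> = \<delta>" using 1 sq by algebra
        ultimately show False using disc b(1) a d by simp
      qed
      moreover have "open_part_of (F ` M) (M1m1 C)" using F(2) M1m1_eq[OF C(1,2)] 1 C(3,4) by simp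
      ultimately show ?thesis using F(1) C(1,2) by (intro exI[of _ F] conjI disjI1 exI[of _ C]) auto
    next
      case 2
      have "open_part_of (F ` M) (M11 C)" using F(2) M11_eq[OF C(1,2)] 2 C(3,4) by simp
      then show ?thesis using F(1) C(1,2) by (intro exI[of _ F] conjI disjI2 disjI1 exI[of _ C]) auto
    qed
  qed
qed

end

theorem theorem1p5:
  fixes M :: "R6 set" and N :: "R6 \<Rightarrow> R6" and k1 k2 k3 :: real
  assumes hyp: "hypersurface M" and conn: "connected M" and ne: "M \<noteq> {}"
    and normal: "unit_normal M N"
    and distinct: "k1 \<noteq> k2" "k1 \<noteq> k3" "k2 \<noteq> k3"
    and const_pc: "\<forall>p\<in>M. principal_curvatures M N p = {k1, k2, k3}"
    and GK_zero: "k1 * k2 * k3 = 0"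
    and V_two: "\<forall>p\<in>M. \<exists>X1 X2 X3. X1 \<in> eigenspace M N p k1 \<and> X2 \<in> eigenspace M N p k2 \<and>
                   X3 \<in> eigenspace M N p k3 \<and> Vfield N p = X1 + X2 + X3 \<and>
                   (X1 = 0 \<or> X2 = 0 \<or> X3 = 0)"
  shows "\<exists>F. isometry_H2xH2 F \<and>
           ((\<exists>c. c \<in> {0<..<1/2} \<union> {1/2<..<1} \<and> open_part_of (F ` M) (M1m1 c)) \<or>
            (\<exists>c. c \<in> {0<..<1} \<and> open_part_of (F ` M) (M11 c)) \<or>
            (\<exists>\<tau>. \<tau> < -1 \<and> open_part_of (F ` M) (Mtau \<tau>)))"
  by (rule hyper_setting.classification, unfold_locales) (fact assms)+

end
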